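(* Let $V$ be a real Euclidean space of dimension $n$, $\Phi\subset V$ a root system spanning $V$ with finite Weyl group $W$ and simple roots $\Delta=\{\alpha_1,\dots,\alpha_n\}$, $\mathcal{G}$ a $W$-invariant building set associated with $\Phi$ with $V\in\mathcal{G}$, and fix a suitable list $\epsilon_1<\dots<\epsilon_n=a$. Then the permutonestohedron $P_{\mathcal{G}}(\Phi)$ coincides with the convex hull of the polytopes $\sigma P_{\mathcal{G}_{fund}}$, $\sigma\in W$ (each of which lies in an open chamber), and its vertices are the points $\sigma v_{\mathcal{S}}$, where $\sigma\in W$ and $\mathcal{S}$ ranges over the maximal $\mathcal{G}_{fund}$-nested sets.
   Context: Notation. $(\cdot,\cdot)$ is the inner product; $\Phi^+$ the positive roots. For a subspace $A$ spanned by roots, $\pi_A=\frac12\sum_{\alpha\in\Phi^+\cap A}\alpha$; $\delta=\pi_V$; for $A\ne V$, $\delta_A=\delta-\pi_A$, $\delta_V=\delta$. $\mathcal{C}_\Phi$ is the set of subspaces spanned by nonempty subsets of $\Phi$. A building set is $\mathcal{G}\subseteq\mathcal{C}_\Phi$ containing every line $\langle\alpha\rangle$, $\alpha\in\Phi$, such that every $C\in\mathcal{C}_\Phi$ is the direct sum of the maximal elements of $\mathcal{G}$ contained in $C$. $\mathcal{G}_{fund}$ = elements of $\mathcal{G}$ spanned by subsets of $\Delta$; $\mathcal{C}_{fund}$ = subspaces spanned by nonempty subsets of $\Delta$. $\mathcal{S}\subseteq\mathcal{G}_{fund}$ is nested if for all $h\ge2$ pairwise inclusion-incomparable $U_1,\dots,U_h\in\mathcal{S}$,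 $U_1+\dots+U_h\notin\mathcal{G}$. Suitable list: for $B\subsetneq A$ in $\mathcal{G}_{fund}$, $R^A_B=p/q$ with $p$ the maximal coefficient of $\pi_A$ and $q$ the minimal coefficient of $\pi_B$ over simple roots in $B$ (coefficients w.r.t. $\Delta$); $R^i_j=\max R^A_B$ over pairs with $\dim A=i,\dim B=j$; a suitable list is $0<\epsilon_1<\dots<\epsilon_n=a$ with $\epsilon_i>2R^i_{i-1}\epsilon_{i-1}$ ($i\ge2$). Hyperplanes: $H_V=\{(x,\delta)=a\}$, $HS_V=\{(x,\delta)\le a\}$; for $A\in\mathcal{G}_{fund}\setminus\{V\}$: $H_A=\{(x,\delta_A)=a-\epsilon_{\dim A}\}$, $HS_A=\{(x,\delta_A)\le a-\epsilon_{\dim A}\}$. For $B\in\mathcal{C}_{fund}\setminus\mathcal{G}_{fund}$ with $\mathcal{G}_{fund}$-decomposition $B=A_1\oplus\dots\oplus A_k$ (the $A_i$ are the maximal elements of $\mathcal{G}_{fund}$ contained in $B$): $\delta_B=\delta-\sum_i\pi_{A_i}$, $\overline{H}_B=\{(x,\delta_B)=a-\sum_i\epsilon_{\dim A_i}\}$, $\overline{HS}_B$ the closed half-space bounded by $\overline H_B$ containing the origin. $P_{\mathcal{G}_{fund}}=H_V\cap\bigcap_{A\in\mathcal{G}_{fund}\setminus\{V\}}HS_A$. The permutonestohedron is $P_{\mathcal{G}}(\Phi)=\bigcap_{\sigma\in W}\big(\bigcap_{A\in\mathcal{G}_{fund}}\sigma HS_A\cap\bigcap_{B\in\mathcal{C}_{fund}\setminus\mathcal{G}_{fund}}\sigma\overline{HS}_B\big)$.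 For a maximal nested $\mathcal{S}$ (which contains $V$, has $n$ elements and $\{\delta_A\}_{A\in\mathcal{S}}$ is a basis), $v_{\mathcal{S}}$ is the unique point of $\bigcap_{A\in\mathcal{S}}H_A$.
   Formalization: When no pair B ⊊ A in G_fund has dim A = i, dim B = i−1, the maximum R^i_{i-1} is undefined; it is taken to be 1, so a suitable list must then satisfy ε_i > 2ε_{i-1} (with no condition there the claim fails, e.g. for A1×A1×A1 with G = {the three lines, V}). *)

theory Defs
  imports "HOL-Analysis.Analysis"
begin

section \<open>Root systems\<close>

definition reflection :: "'a::euclidean_space \<Rightarrow> 'a \<Rightarrow> 'a" where
  "reflection \<alpha> x = x - (2 * (x \<bullet> \<alpha>) / (\<alpha> \<bullet> \<alpha>)) *\<^sub>R \<alpha>"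

text \<open>Reduced, spanning, and finite (equivalently, with finite reflection group). No integrality
  is imposed, so the non-crystallographic systems are included.\<close>

definition root_system :: "'a::euclidean_space set \<Rightarrow> bool" where
  "root_system \<Phi> \<longleftrightarrow>
     finite \<Phi> \<and> 0 \<notin> \<Phi> \<and> span \<Phi> = UNIV \<and>
     (\<forall>\<alpha>\<in>\<Phi>. \<Phi> \<inter> span {\<alpha>} = {\<alpha>, - \<alpha>}) \<and>
     (\<forall>\<alpha>\<in>\<Phi>. reflection \<alpha> ` \<Phi> = \<Phi>)"

text \<open>Reflections are involutions, so the monoid they generate is already a group.\<close>

inductive_set weyl_group :: "'a::euclidean_space set \<Rightarrow> ('a \<Rightarrow> 'a) set"
  for \<Phi> :: "'a set" where
  id: "id \<in> weyl_group \<Phi>"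
| step: "\<alpha> \<in> \<Phi> \<Longrightarrow> \<sigma> \<in> weyl_group \<Phi> \<Longrightarrow> reflection \<alpha> \<circ> \<sigma> \<in> weyl_group \<Phi>"

definition simple_system :: "'a::euclidean_space set \<Rightarrow> 'a set \<Rightarrow> bool" where
  "simple_system \<Phi> \<Delta> \<longleftrightarrow>
     \<Delta> \<subseteq> \<Phi> \<and> independent \<Delta> \<and> span \<Delta> = UNIV \<and>
     (\<forall>\<beta>\<in>\<Phi>. (\<forall>\<alpha>\<in>\<Delta>. 0 \<le> representation \<Delta> \<beta> \<alpha>) \<or> (\<forall>\<alpha>\<in>\<Delta>. representation \<Delta> \<beta> \<alpha> \<le> 0))"

definition positive_roots :: "'a::euclidean_space set \<Rightarrow> 'a set \<Rightarrow> 'a set" where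
  "positive_roots \<Phi> \<Delta> = {\<beta>\<in>\<Phi>. \<forall>\<alpha>\<in>\<Delta>. 0 \<le> representation \<Delta> \<beta> \<alpha>}"

definition open_chambers :: "'a::euclidean_space set \<Rightarrow> 'a set set" where
  "open_chambers \<Phi> = components (UNIV - (\<Union>\<alpha>\<in>\<Phi>. {x. x \<bullet> \<alpha> = 0}))"

definition half_sum :: "'a::euclidean_space set \<Rightarrow> 'a set \<Rightarrow> 'a set \<Rightarrow> 'a" where
  "half_sum \<Phi> \<Delta> A = (1/2) *\<^sub>R (\<Sum>\<alpha> \<in> positive_roots \<Phi> \<Delta> \<inter> A. \<alpha>)"


section \<open>Building sets and nested sets\<close>

definition root_subspaces :: "'a::euclidean_space set \<Rightarrow> 'a set set" where
  "root_subspaces \<Phi> = {span S | S. S \<subseteq> \<Phi> \<and> S \<noteq> {}}"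

definition maximal_in :: "'a set set \<Rightarrow> 'a set \<Rightarrow> 'a set set" where
  "maximal_in \<G> C = {A\<in>\<G>. A \<subseteq> C \<and> (\<forall>A'\<in>\<G>. A' \<subseteq> C \<and> A \<subseteq> A' \<longrightarrow> A' = A)}"

definition is_direct_sum :: "'a::euclidean_space set \<Rightarrow> 'a set set \<Rightarrow> bool" where
  "is_direct_sum C \<M> \<longleftrightarrow>
     finite \<M> \<and> (\<forall>A\<in>\<M>. subspace A) \<and> C = span (\<Union>\<M>) \<and>
     (\<forall>f. (\<forall>A\<in>\<M>. f A \<in> A) \<and> (\<Sum>A\<in>\<M>. f A) = 0 \<longrightarrow> (\<forall>A\<in>\<M>. f A = 0))"

definition building_set :: "'a::euclidean_space set \<Rightarrow> 'a set set \<Rightarrow> bool" where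
  "building_set \<Phi> \<G> \<longleftrightarrow>
     \<G> \<subseteq> root_subspaces \<Phi> \<and> (\<forall>\<alpha>\<in>\<Phi>. span {\<alpha>} \<in> \<G>) \<and>
     (\<forall>C\<in>root_subspaces \<Phi>. is_direct_sum C (maximal_in \<G> C))"

definition weyl_invariant :: "'a::euclidean_space set \<Rightarrow> 'a set set \<Rightarrow> bool" where
  "weyl_invariant \<Phi> \<G> \<longleftrightarrow> (\<forall>\<sigma>\<in>weyl_group \<Phi>. \<forall>A\<in>\<G>. \<sigma> ` A \<in> \<G>)"

definition fund_building :: "'a::euclidean_space set \<Rightarrow> 'a set set \<Rightarrow> 'a set set" where
  "fund_building \<Delta> \<G> = {A\<in>\<G>. \<exists>S. S \<subseteq> \<Delta> \<and> A = span S}"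

definition fund_subspaces :: "'a::euclidean_space set \<Rightarrow> 'a set set" where
  "fund_subspaces \<Delta> = {span S | S. S \<subseteq> \<Delta> \<and> S \<noteq> {}}"

text \<open>\<open>span (\<Union>\<T>)\<close> is the sum of the members of a family of subspaces \<open>\<T>\<close>.\<close>

definition nested :: "'a::euclidean_space set \<Rightarrow> 'a set set \<Rightarrow> 'a set set \<Rightarrow> bool" where
  "nested \<Delta> \<G> \<S> \<longleftrightarrow>
     \<S> \<subseteq> fund_building \<Delta> \<G> \<and>
     (\<forall>\<T>. \<T> \<subseteq> \<S> \<and> finite \<T> \<and> 2 \<le> card \<T> \<and>
          pairwise (\<lambda>A B. \<not> A \<subseteq> B \<and> \<not> B \<subseteq> A) \<T> \<longrightarrow> span (\<Union>\<T>) \<notin> \<G>)"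

definition maximal_nested :: "'a::euclidean_space set \<Rightarrow> 'a set set \<Rightarrow> 'a set set \<Rightarrow> bool" where
  "maximal_nested \<Delta> \<G> \<S> \<longleftrightarrow>
     nested \<Delta> \<G> \<S> \<and> (\<forall>\<T>. nested \<Delta> \<G> \<T> \<and> \<S> \<subseteq> \<T> \<longrightarrow> \<T> = \<S>)"


section \<open>Suitable lists\<close>

definition ratio :: "'a::euclidean_space set \<Rightarrow> 'a set \<Rightarrow> 'a set \<Rightarrow> 'a set \<Rightarrow> real" where
  "ratio \<Phi> \<Delta> A B =
     Max (representation \<Delta> (half_sum \<Phi> \<Delta> A) ` \<Delta>) /
     Min (representation \<Delta> (half_sum \<Phi> \<Delta> B) ` (\<Delta> \<inter> B))"

definition ratios :: "'a::euclidean_space set \<Rightarrow> 'a set \<Rightarrow> 'a set set \<Rightarrow> nat \<Rightarrow> nat \<Rightarrow> real set" where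
  "ratios \<Phi> \<Delta> \<G> i j =
     {ratio \<Phi> \<Delta> A B | A B. A \<in> fund_building \<Delta> \<G> \<and> B \<in> fund_building \<Delta> \<G> \<and> B \<subset> A \<and>
        dim A = i \<and> dim B = j}"

text \<open>Every ratio is at least 1, because for \<open>B \<subseteq> A\<close> each coefficient of \<open>half_sum \<Phi> \<Delta> A\<close> bounds the
  corresponding one of \<open>half_sum \<Phi> \<Delta> B\<close>. The maximum over an empty set of pairs is therefore taken
  to be 1, the least possible ratio. Dimensions may indeed be skipped by \<open>\<G>\<close>, for
  instance when \<open>\<G>\<close> consists of \<open>UNIV\<close> and the root lines in type \<open>A\<^sub>1 \<times> A\<^sub>1 \<times> A\<^sub>1\<close>; imposing no
  condition there would allow \<open>\<epsilon> 1 > a / 3\<close>, for which \<open>fund_nestohedron\<close> below is empty.\<close>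

definition max_ratio :: "'a::euclidean_space set \<Rightarrow> 'a set \<Rightarrow> 'a set set \<Rightarrow> nat \<Rightarrow> nat \<Rightarrow> real" where
  "max_ratio \<Phi> \<Delta> \<G> i j =
     (if ratios \<Phi> \<Delta> \<G> i j = {} then 1 else Max (ratios \<Phi> \<Delta> \<G> i j))"

definition suitable_list ::
    "'a::euclidean_space set \<Rightarrow> 'a set \<Rightarrow> 'a set set \<Rightarrow> (nat \<Rightarrow> real) \<Rightarrow> real \<Rightarrow> bool" where
  "suitable_list \<Phi> \<Delta> \<G> \<epsilon> a \<longleftrightarrow>
     0 < \<epsilon> 1 \<and> (\<forall>i\<in>{2..DIM('a)}. \<epsilon> (i - 1) < \<epsilon> i) \<and> \<epsilon> DIM('a) = a \<and>
     (\<forall>i\<in>{2..DIM('a)}. \<epsilon> i > 2 * max_ratio \<Phi> \<Delta> \<G> i (i - 1) * \<epsilon> (i - 1))"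


section \<open>The nestohedron and the permutonestohedron\<close>

definition delta :: "'a::euclidean_space set \<Rightarrow> 'a set \<Rightarrow> 'a set \<Rightarrow> 'a" where
  "delta \<Phi> \<Delta> A =
     (if A = UNIV then half_sum \<Phi> \<Delta> UNIV else half_sum \<Phi> \<Delta> UNIV - half_sum \<Phi> \<Delta> A)"

definition level :: "(nat \<Rightarrow> real) \<Rightarrow> real \<Rightarrow> 'a::euclidean_space set \<Rightarrow> real" where
  "level \<epsilon> a A = (if A = UNIV then a else a - \<epsilon> (dim A))"

definition H :: "'a::euclidean_space set \<Rightarrow> 'a set \<Rightarrow> (nat \<Rightarrow> real) \<Rightarrow> real \<Rightarrow> 'a set \<Rightarrow> 'a set" where
  "H \<Phi> \<Delta> \<epsilon> a A = {x. x \<bullet> delta \<Phi> \<Delta> A = level \<epsilon> a A}"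

definition HS :: "'a::euclidean_space set \<Rightarrow> 'a set \<Rightarrow> (nat \<Rightarrow> real) \<Rightarrow> real \<Rightarrow> 'a set \<Rightarrow> 'a set" where
  "HS \<Phi> \<Delta> \<epsilon> a A = {x. x \<bullet> delta \<Phi> \<Delta> A \<le> level \<epsilon> a A}"

definition delta_bar :: "'a::euclidean_space set \<Rightarrow> 'a set \<Rightarrow> 'a set set \<Rightarrow> 'a set \<Rightarrow> 'a" where
  "delta_bar \<Phi> \<Delta> \<G> B =
     half_sum \<Phi> \<Delta> UNIV - (\<Sum>A\<in>maximal_in (fund_building \<Delta> \<G>) B. half_sum \<Phi> \<Delta> A)"

definition level_bar ::
    "'a::euclidean_space set \<Rightarrow> 'a set set \<Rightarrow> (nat \<Rightarrow> real) \<Rightarrow> real \<Rightarrow> 'a set \<Rightarrow> real" where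
  "level_bar \<Delta> \<G> \<epsilon> a B = a - (\<Sum>A\<in>maximal_in (fund_building \<Delta> \<G>) B. \<epsilon> (dim A))"

text \<open>The closed side, containing the origin, of the hyperplane
  \<open>{x. x \<bullet> delta_bar \<Phi> \<Delta> \<G> B = level_bar \<Delta> \<G> \<epsilon> a B}\<close>.
  For a suitable list the level is positive, so this side is unique.\<close>

definition HS_bar ::
    "'a::euclidean_space set \<Rightarrow> 'a set \<Rightarrow> 'a set set \<Rightarrow> (nat \<Rightarrow> real) \<Rightarrow> real \<Rightarrow> 'a set \<Rightarrow> 'a set" where
  "HS_bar \<Phi> \<Delta> \<G> \<epsilon> a B =
     (if 0 \<le> level_bar \<Delta> \<G> \<epsilon> a B
      then {x. x \<bullet> delta_bar \<Phi> \<Delta> \<G> B \<le> level_bar \<Delta> \<G> \<epsilon> a B}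
      else {x. x \<bullet> delta_bar \<Phi> \<Delta> \<G> B \<ge> level_bar \<Delta> \<G> \<epsilon> a B})"

definition fund_nestohedron ::
    "'a::euclidean_space set \<Rightarrow> 'a set \<Rightarrow> 'a set set \<Rightarrow> (nat \<Rightarrow> real) \<Rightarrow> real \<Rightarrow> 'a set" where
  "fund_nestohedron \<Phi> \<Delta> \<G> \<epsilon> a =
     H \<Phi> \<Delta> \<epsilon> a UNIV \<inter> (\<Inter>A \<in> fund_building \<Delta> \<G> - {UNIV}. HS \<Phi> \<Delta> \<epsilon> a A)"

definition permutonestohedron ::
    "'a::euclidean_space set \<Rightarrow> 'a set \<Rightarrow> 'a set set \<Rightarrow> (nat \<Rightarrow> real) \<Rightarrow> real \<Rightarrow> 'a set" where
  "permutonestohedron \<Phi> \<Delta> \<G> \<epsilon> a =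
     (\<Inter>\<sigma> \<in> weyl_group \<Phi>.
        (\<Inter>A \<in> fund_building \<Delta> \<G>. \<sigma> ` HS \<Phi> \<Delta> \<epsilon> a A) \<inter>
        (\<Inter>B \<in> fund_subspaces \<Delta> - fund_building \<Delta> \<G>. \<sigma> ` HS_bar \<Phi> \<Delta> \<G> \<epsilon> a B))"

definition nested_vertex ::
    "'a::euclidean_space set \<Rightarrow> 'a set \<Rightarrow> (nat \<Rightarrow> real) \<Rightarrow> real \<Rightarrow> 'a set set \<Rightarrow> 'a" where
  "nested_vertex \<Phi> \<Delta> \<epsilon> a \<S> = (THE x. x \<in> (\<Inter>A\<in>\<S>. H \<Phi> \<Delta> \<epsilon> a A))"

end

theory Submission
  imports Defs
begin

text \<open>Since \<open>H\<close> and \<open>HS\<close> bound pairings with half sums, everything is controlled by linear programming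
  over the dominant chamber. Every dominant \<open>\<mu>\<close> can be written as
  \<open>t \<delta> - (\<Sum>A\<in>N. w A * \<pi>\<^sub>A)\<close> with \<open>N\<close> nested, \<open>w \<ge> 0\<close>, and weight at most \<open>t\<close>
  along each chain of \<open>N\<close>. A fractional antichain cover of \<open>N\<close> then combines the bounds for
  direct sums of members of \<open>N\<close> (this is what the half-spaces \<open>HS_bar\<close> are for) into
  \<open>x \<bullet> \<mu> \<le> v \<bullet> \<mu>\<close>, where \<open>v\<close> is the vertex of any maximal nested set containing \<open>N\<close>. Hence the
  permutonestohedron is the hull of the orbits of these vertices. The converse inclusion holds because
  the normals \<open>\<delta> - \<pi>\<^sub>A\<close> are dominant, and suitability of the list is what makes each vertex satisfy
  the inequalities of all members of the building set.\<close>

section \<open>Reflections and simple roots\<close>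

text \<open>The weight bound along chains rests on one identity: for a simple root \<alpha> in I,
  \<open>hsum I \<bullet> \<alpha>\<close> equals \<open>(\<alpha> \<bullet> \<alpha>) / 2\<close>,
  whatever I is. In a nested set every chain has a simple root \<alpha> common to its members and
  orthogonal to each member of the nested set that avoids \<alpha>. Pairing \<mu> with it gives a
  positive multiple of \<open>t\<close> minus the weight of the members containing \<alpha>, and
  dominance makes this nonnegative. Taking \<open>t\<close> least leaves some simple root outside
  all members, so their unions are proper subsets of \<Delta>, where bounds are available. The
  obstacle is that suitability compares consecutive dimensions only, while children of a node may be
  much smaller than the node. Bridging the gap costs nothing but yields a factor 2 per dimension. A
  node of a maximal nested set has exactly one root more than its children together, so the children
  use at most half of its level; the half kept by the owned root also suffices for every other
  member of the building set.\<close>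

lemma linear_reflection: "linear (reflection \<alpha>)"
  unfolding reflection_def
  by (rule linearI) (simp_all add: inner_add_left algebra_simps add_divide_distrib)

lemma reflection_involution [simp]: "reflection \<alpha> (reflection \<alpha> x) = x"
  unfolding reflection_def
  by (cases "\<alpha> = 0") (simp_all add: inner_diff_left algebra_simps flip: scaleR_add_left)

lemma inner_reflection [simp]: "reflection \<alpha> x \<bullet> reflection \<alpha> y = x \<bullet> y"
  unfolding reflection_def
  by (cases "\<alpha> = 0") (simp_all add: inner_diff_left inner_diff_right inner_commute field_simps)

lemma inner_reflection_swap: "reflection \<alpha> x \<bullet> y = x \<bullet> reflection \<alpha> y"
  by (metis inner_reflection reflection_involution)

lemma reflection_uminus_root [simp]: "reflection (- \<alpha>) = reflection \<alpha>"
  by (auto simp: reflection_def fun_eq_iff)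

lemma reflection_self: "\<alpha> \<noteq> 0 \<Longrightarrow> reflection \<alpha> \<alpha> = - \<alpha>"
  by (simp add: reflection_def algebra_simps flip: scaleR_2)

text \<open>An isometry carries mirrors to mirrors: expanding the middle reflection by linearity
  leaves the pairing of \<open>reflection \<alpha> x\<close> with \<beta>, and a reflection can be
  moved across the inner product.\<close>

lemma reflection_conj: "reflection (reflection \<alpha> \<beta>) = reflection \<alpha> \<circ> reflection \<beta> \<circ> reflection \<alpha>"
proof
  fix x
  have "reflection \<alpha> (reflection \<beta> (reflection \<alpha> x)) =
    reflection \<alpha> (reflection \<alpha> x) -
      (2 * (reflection \<alpha> x \<bullet> \<beta>) / (\<beta> \<bullet> \<beta>)) *\<^sub>R reflection \<alpha> \<beta>"
    unfolding reflection_def[of \<beta>]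
    by (simp only: linear_diff[OF linear_reflection] linear_scale[OF linear_reflection])
  then show "reflection (reflection \<alpha> \<beta>) x = (reflection \<alpha> \<circ> reflection \<beta> \<circ> reflection \<alpha>) x"
    by (simp add: reflection_def[of "reflection \<alpha> \<beta>"] inner_reflection_swap)
qed

section \<open>Coordinates and signs of roots over the simple roots\<close>

locale simple_root_basis =
  fixes \<Phi> \<Delta> :: "'a::euclidean_space set"
  assumes root_system: "root_system \<Phi>"
    and simple_system: "simple_system \<Phi> \<Delta>"
begin

abbreviation coef :: "'a \<Rightarrow> 'a \<Rightarrow> real" where "coef \<equiv> representation \<Delta>"
abbreviation pos :: "'a set" where "pos \<equiv> positive_roots \<Phi> \<Delta>"

definition hsum :: "'a set \<Rightarrow> 'a" where "hsum I = half_sum \<Phi> \<Delta> (span I)"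

definition dominant :: "'a \<Rightarrow> bool" where "dominant x \<longleftrightarrow> (\<forall>\<alpha>\<in>\<Delta>. 0 \<le> x \<bullet> \<alpha>)"

lemma finite_roots [simp]: "finite \<Phi>"
  and zero_not_root: "0 \<notin> \<Phi>"
  and span_roots: "span \<Phi> = UNIV"
  and root_multiples: "\<alpha> \<in> \<Phi> \<Longrightarrow> \<beta> \<in> \<Phi> \<Longrightarrow> \<beta> \<in> span {\<alpha>} \<Longrightarrow> \<beta> = \<alpha> \<or> \<beta> = - \<alpha>"
  and uminus_root: "\<alpha> \<in> \<Phi> \<Longrightarrow> - \<alpha> \<in> \<Phi>"
  and reflection_image_roots: "\<alpha> \<in> \<Phi> \<Longrightarrow> reflection \<alpha> ` \<Phi> = \<Phi>"
  using root_system unfolding root_system_def by blast+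

lemma reflection_root: "\<alpha> \<in> \<Phi> \<Longrightarrow> \<beta> \<in> \<Phi> \<Longrightarrow> reflection \<alpha> \<beta> \<in> \<Phi>"
  using reflection_image_roots by blast

lemma simple_subset: "\<Delta> \<subseteq> \<Phi>"
  and indep: "independent \<Delta>"
  and span_simple: "span \<Delta> = UNIV"
  and coef_sign: "\<beta> \<in> \<Phi> \<Longrightarrow> (\<forall>\<alpha>\<in>\<Delta>. 0 \<le> coef \<beta> \<alpha>) \<or> (\<forall>\<alpha>\<in>\<Delta>. coef \<beta> \<alpha> \<le> 0)"
  using simple_system unfolding simple_system_def by blast+

lemma simple_root [simp]: "\<alpha> \<in> \<Delta> \<Longrightarrow> \<alpha> \<in> \<Phi>"
  using simple_subset by blast

lemma finite_simple [simp]: "finite \<Delta>"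
  using finite_subset[OF simple_subset] by simp

lemma simple_nonzero: "\<alpha> \<in> \<Delta> \<Longrightarrow> \<alpha> \<noteq> 0"
  using zero_not_root by auto

lemma simple_norm_pos: "\<alpha> \<in> \<Delta> \<Longrightarrow> 0 < \<alpha> \<bullet> \<alpha>"
  using simple_nonzero by auto

lemma simple_nonempty: "\<Delta> \<noteq> {}"
proof
  assume "\<Delta> = {}"
  then have "(UNIV :: 'a set) = {0}" using span_simple by simp
  then show False using UNIV_not_singleton by blast
qed

lemma coef_expansion: "v = (\<Sum>\<beta>\<in>\<Delta>. coef v \<beta> *\<^sub>R \<beta>)"
  using sum_representation_eq[OF indep, of v \<Delta>] span_simple by simp

lemma linear_coef: "linear (\<lambda>v. coef v \<beta>)"
  using span_simple by (intro linearI)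
    (simp_all add: representation_add[OF indep] representation_scale[OF indep])

lemma coef_add [simp]: "coef (v + w) \<beta> = coef v \<beta> + coef w \<beta>"
  and coef_diff [simp]: "coef (v - w) \<beta> = coef v \<beta> - coef w \<beta>"
  and coef_uminus [simp]: "coef (- v) \<beta> = - coef v \<beta>"
  and coef_scale [simp]: "coef (r *\<^sub>R v) \<beta> = r * coef v \<beta>"
  and coef_sum: "coef (\<Sum>i\<in>X. f i) \<beta> = (\<Sum>i\<in>X. coef (f i) \<beta>)"
  using linear_add[OF linear_coef] linear_diff[OF linear_coef] linear_neg[OF linear_coef]
    linear_scale[OF linear_coef] linear_sum[OF linear_coef] by auto

lemma coef_zero [simp]: "coef 0 \<beta> = 0"
  using coef_scale[of 0 0 \<beta>] by simp

lemma coef_simple: "\<alpha> \<in> \<Delta> \<Longrightarrow> coef \<alpha> \<beta> = (if \<beta> = \<alpha> then 1 else 0)"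
  using representation_basis[OF indep, of \<alpha>] by auto

lemma coef_eqI: "(\<And>\<beta>. \<beta> \<in> \<Delta> \<Longrightarrow> coef v \<beta> = coef w \<beta>) \<Longrightarrow> v = w"
  using coef_expansion[of v] coef_expansion[of w] by (metis (no_types, lifting) sum.cong)

lemma in_span_iff:
  assumes "I \<subseteq> \<Delta>"
  shows "v \<in> span I \<longleftrightarrow> (\<forall>\<beta>\<in>\<Delta> - I. coef v \<beta> = 0)"
proof
  assume "v \<in> span I"
  then show "\<forall>\<beta>\<in>\<Delta> - I. coef v \<beta> = 0"
    using representation_extend[OF indep _ assms, of v] by (metis DiffD2 representation_ne_zero)
next
  assume *: "\<forall>\<beta>\<in>\<Delta> - I. coef v \<beta> = 0"
  have "(\<Sum>\<beta>\<in>\<Delta>. coef v \<beta> *\<^sub>R \<beta>) = (\<Sum>\<beta>\<in>I. coef v \<beta> *\<^sub>R \<beta>)"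
    using assms * by (intro sum.mono_neutral_right) auto
  then have "v = (\<Sum>\<beta>\<in>I. coef v \<beta> *\<^sub>R \<beta>)" using coef_expansion[of v] by simp
  then show "v \<in> span I" by (metis (no_types, lifting) span_base span_scale span_sum)
qed

lemma simple_in_span: "I \<subseteq> \<Delta> \<Longrightarrow> \<alpha> \<in> \<Delta> \<Longrightarrow> \<alpha> \<in> span I \<longleftrightarrow> \<alpha> \<in> I"
  using span_base[of \<alpha> I] by (auto simp: in_span_iff coef_simple)

lemma simple_Int_span: "I \<subseteq> \<Delta> \<Longrightarrow> \<Delta> \<inter> span I = I"
  using simple_in_span by auto

lemma span_subset_iff: "I \<subseteq> \<Delta> \<Longrightarrow> J \<subseteq> \<Delta> \<Longrightarrow> span I \<subseteq> span J \<longleftrightarrow> I \<subseteq> J"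
  by (metis simple_Int_span inf_mono order_refl span_mono)

lemma span_eq_iff_simple: "I \<subseteq> \<Delta> \<Longrightarrow> J \<subseteq> \<Delta> \<Longrightarrow> span I = span J \<longleftrightarrow> I = J"
  by (metis simple_Int_span)

lemma span_eq_UNIV_iff: "I \<subseteq> \<Delta> \<Longrightarrow> span I = UNIV \<longleftrightarrow> I = \<Delta>"
  using span_eq_iff_simple[of I \<Delta>] span_simple by auto

lemma dim_simple: "I \<subseteq> \<Delta> \<Longrightarrow> dim I = card I"
  by (metis dim_eq_card independent_mono[OF indep] dim_span)

lemma card_simple: "card \<Delta> = DIM('a)"
  using dim_simple[of \<Delta>] span_simple by (metis dim_UNIV dim_span order_refl)

lemma pos_root: "\<gamma> \<in> pos \<Longrightarrow> \<gamma> \<in> \<Phi>"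
  and pos_coef: "\<gamma> \<in> pos \<Longrightarrow> \<beta> \<in> \<Delta> \<Longrightarrow> 0 \<le> coef \<gamma> \<beta>"
  by (auto simp: positive_roots_def)

lemma finite_pos [simp]: "finite pos"
  using finite_roots pos_root by (meson finite_subset subsetI)

lemma simple_pos [simp]: "\<alpha> \<in> \<Delta> \<Longrightarrow> \<alpha> \<in> pos"
  by (simp add: positive_roots_def coef_simple)

lemma pos_cases: "\<gamma> \<in> \<Phi> \<Longrightarrow> \<gamma> \<in> pos \<or> - \<gamma> \<in> pos"
  using coef_sign[of \<gamma>] uminus_root by (auto simp: positive_roots_def)

lemma pos_nonzero: "\<gamma> \<in> pos \<Longrightarrow> \<gamma> \<noteq> 0"
  using pos_root zero_not_root by auto

lemma pos_not_neg: "\<gamma> \<in> pos \<Longrightarrow> - \<gamma> \<notin> pos"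
proof
  assume "\<gamma> \<in> pos" "- \<gamma> \<in> pos"
  then have "\<forall>\<beta>\<in>\<Delta>. coef \<gamma> \<beta> = 0" by (fastforce simp: positive_roots_def)
  then have "\<gamma> = 0" by (intro coef_eqI) auto
  then show False using \<open>\<gamma> \<in> pos\<close> pos_nonzero by blast
qed

lemma root_posI: "\<gamma> \<in> \<Phi> \<Longrightarrow> \<beta> \<in> \<Delta> \<Longrightarrow> 0 < coef \<gamma> \<beta> \<Longrightarrow> \<gamma> \<in> pos"
  using coef_sign[of \<gamma>] by (fastforce simp: positive_roots_def)

lemma coef_reflection:
  "coef (reflection \<alpha> v) \<beta> = coef v \<beta> - (2 * (v \<bullet> \<alpha>) / (\<alpha> \<bullet> \<alpha>)) * coef \<alpha> \<beta>"
  by (simp add: reflection_def)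

text \<open>Since \<Phi> is reduced, \<gamma> has a positive coefficient at some simple root other
  than \<alpha>. The reflection changes only the coefficient at \<alpha>, and one positive
  coefficient decides the sign of a root.\<close>

lemma simple_reflection_pos:
  assumes "\<alpha> \<in> \<Delta>" "\<gamma> \<in> pos" "\<gamma> \<noteq> \<alpha>"
  shows "reflection \<alpha> \<gamma> \<in> pos"
proof -
  have "\<exists>\<beta>\<in>\<Delta> - {\<alpha>}. coef \<gamma> \<beta> \<noteq> 0"
  proof (rule ccontr)
    assume "\<not> ?thesis"
    then have "\<gamma> \<in> span {\<alpha>}" using assms by (subst in_span_iff) auto
    then show False
      using root_multiples[of \<alpha> \<gamma>] assms pos_root pos_not_neg[of \<alpha>] simple_pos by auto
  qed
  then obtain \<beta> where \<beta>: "\<beta> \<in> \<Delta>" "\<beta> \<noteq> \<alpha>" "coef \<gamma> \<beta> \<noteq> 0" by auto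
  then have "0 < coef (reflection \<alpha> \<gamma>) \<beta>"
    using pos_coef[OF assms(2), of \<beta>] assms by (simp add: coef_reflection coef_simple)
  then show ?thesis using root_posI \<beta> assms pos_root reflection_root simple_root by metis
qed

text \<open>The positive root \<open>reflection \<alpha> \<beta>\<close> has coefficient \<open>- 2
  * (\<beta> \<bullet> \<alpha>) / (\<alpha> \<bullet> \<alpha>)\<close> at \<alpha>.\<close>

lemma simple_obtuse:
  assumes "\<alpha> \<in> \<Delta>" "\<beta> \<in> \<Delta>" "\<alpha> \<noteq> \<beta>"
  shows "\<alpha> \<bullet> \<beta> \<le> 0"
proof -
  have "0 \<le> coef (reflection \<alpha> \<beta>) \<alpha>"
    using simple_reflection_pos[of \<alpha> \<beta>] assms pos_coef by auto
  then have "2 * (\<beta> \<bullet> \<alpha>) / (\<alpha> \<bullet> \<alpha>) \<le> 0" using assms by (simp add: coef_reflection coef_simple)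
  then show ?thesis using simple_norm_pos[OF assms(1)]
    by (simp add: divide_le_0_iff inner_commute)
qed

lemma inner_expansion: "v \<bullet> w = (\<Sum>\<beta>\<in>\<Delta>. coef v \<beta> * (\<beta> \<bullet> w))"
  by (subst coef_expansion[of v]) (simp add: inner_sum_left)

section \<open>Height and orthogonal pieces of a set of simple roots\<close>

definition height :: "'a \<Rightarrow> real" where "height v = (\<Sum>\<beta>\<in>\<Delta>. coef v \<beta>)"

lemma height_reflection:
  "\<alpha> \<in> \<Delta> \<Longrightarrow> height (reflection \<alpha> v) = height v - 2 * (v \<bullet> \<alpha>) / (\<alpha> \<bullet> \<alpha>)"
  by (simp add: height_def coef_reflection sum_subtractf coef_simple
      flip: sum_distrib_left sum_divide_distrib)

text \<open>Without integrality, heights are mere real numbers; descent is justified by the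
  finiteness of the set of positive roots.\<close>

lemma height_minimal:
  assumes "X \<subseteq> pos" "X \<noteq> {}"
  obtains \<gamma> where "\<gamma> \<in> X" "\<And>\<gamma>'. \<gamma>' \<in> X \<Longrightarrow> height \<gamma> \<le> height \<gamma>'"
proof -
  have "finite X" using assms finite_pos finite_subset by blast
  then show thesis using that assms ex_is_arg_min_if_finite[of X height]
    by (metis is_arg_min_linorder)
qed

lemma height_reflection_less:
  "\<alpha> \<in> \<Delta> \<Longrightarrow> 0 < v \<bullet> \<alpha> \<Longrightarrow> height (reflection \<alpha> v) < height v"
  using simple_norm_pos by (simp add: height_reflection)

text \<open>A counterexample of least height has a nonzero part b over I, and
  \<open>0 < b \<bullet> b\<close> yields \<alpha> in I with
  \<open>0 < \<gamma> \<bullet> \<alpha>\<close>. Reflecting in \<alpha> stays positive and outside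
  both spans, but lowers the height. This is what makes half sums additive over orthogonal
  pieces.\<close>

lemma root_in_orthogonal_part:
  assumes IJ: "I \<subseteq> \<Delta>" "J \<subseteq> \<Delta>" "I \<inter> J = {}" "\<And>\<alpha> \<beta>. \<alpha> \<in> I \<Longrightarrow> \<beta> \<in> J \<Longrightarrow> \<alpha> \<bullet> \<beta> = 0"
    and \<gamma>: "\<gamma> \<in> pos" "\<gamma> \<in> span (I \<union> J)"
  shows "\<gamma> \<in> span I \<or> \<gamma> \<in> span J"
proof (rule ccontr)
  define X where "X = {\<gamma> \<in> pos. \<gamma> \<in> span (I \<union> J) \<and> \<gamma> \<notin> span I \<and> \<gamma> \<notin> span J}"
  assume "\<not> ?thesis"
  then have "X \<noteq> {}" using \<gamma> by (auto simp: X_def)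
  then obtain \<gamma> where g: "\<gamma> \<in> X" and min: "\<And>\<gamma>'. \<gamma>' \<in> X \<Longrightarrow> height \<gamma> \<le> height \<gamma>'"
    using height_minimal[of X] by (auto simp: X_def)
  have gp: "\<gamma> \<in> pos" and gs: "\<gamma> \<in> span (I \<union> J)" using g by (auto simp: X_def)
  have zero: "coef \<gamma> \<beta> = 0" if "\<beta> \<in> \<Delta> - (I \<union> J)" for \<beta>
    using gs that IJ by (subst (asm) in_span_iff) auto
  obtain \<beta> where \<beta>: "\<beta> \<in> I" "coef \<gamma> \<beta> > 0"
  proof -
    have "\<exists>\<beta>\<in>\<Delta> - J. coef \<gamma> \<beta> \<noteq> 0" using g IJ in_span_iff[of J \<gamma>] by (auto simp: X_def)
    then show thesis using zero that pos_coef[OF gp] by (metis Diff_iff UnE less_eq_real_def)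
  qed
  obtain \<kappa> where \<kappa>: "\<kappa> \<in> J" "coef \<gamma> \<kappa> > 0"
  proof -
    have "\<exists>\<beta>\<in>\<Delta> - I. coef \<gamma> \<beta> \<noteq> 0" using g IJ in_span_iff[of I \<gamma>] by (auto simp: X_def)
    then show thesis using zero that pos_coef[OF gp] by (metis Diff_iff UnE less_eq_real_def)
  qed
  define b where "b = (\<Sum>\<beta>\<in>I. coef \<gamma> \<beta> *\<^sub>R \<beta>)"
  have fin: "finite I" "finite J" using IJ finite_subset finite_simple by blast+
  have g_eq: "\<gamma> = b + (\<Sum>\<beta>\<in>J. coef \<gamma> \<beta> *\<^sub>R \<beta>)"
  proof -
    have "(\<Sum>\<beta>\<in>\<Delta>. coef \<gamma> \<beta> *\<^sub>R \<beta>) = (\<Sum>\<beta>\<in>I \<union> J. coef \<gamma> \<beta> *\<^sub>R \<beta>)"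
      using IJ zero by (intro sum.mono_neutral_right) auto
    then show ?thesis using coef_expansion[of \<gamma>] fin IJ(3) by (simp add: b_def sum.union_disjoint)
  qed
  have inner_b: "\<gamma> \<bullet> \<alpha> = b \<bullet> \<alpha>" if "\<alpha> \<in> I" for \<alpha>
  proof -
    have "(\<Sum>\<beta>\<in>J. coef \<gamma> \<beta> *\<^sub>R \<beta>) \<bullet> \<alpha> = 0"
      unfolding inner_sum_left using IJ(4)[OF that] by (intro sum.neutral) (simp add: inner_commute)
    then show ?thesis using g_eq by (metis add.right_neutral inner_add_left)
  qed
  have "b \<noteq> 0"
  proof
    assume "b = 0"
    then have "\<gamma> \<in> span J" using g_eq by (metis (no_types, lifting) add_0 span_base span_scale span_sum)
    then show False using g by (simp add: X_def)
  qed
  then have "0 < b \<bullet> b" by simp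
  also have "b \<bullet> b = (\<Sum>\<alpha>\<in>I. coef \<gamma> \<alpha> * (\<gamma> \<bullet> \<alpha>))"
    by (subst (2) b_def) (simp add: inner_sum_right inner_b)
  finally obtain \<alpha> where \<alpha>: "\<alpha> \<in> I" "0 < coef \<gamma> \<alpha> * (\<gamma> \<bullet> \<alpha>)"
    by (metis (no_types, lifting) sum_nonpos not_le)
  then have \<alpha>': "\<alpha> \<in> \<Delta>" "0 < \<gamma> \<bullet> \<alpha>"
    using IJ pos_coef[OF gp, of \<alpha>] by (auto simp: zero_less_mult_iff)
  have "\<alpha> \<noteq> \<gamma>" using g \<alpha>(1) span_base by (force simp: X_def)
  then have rp: "reflection \<alpha> \<gamma> \<in> pos" using simple_reflection_pos \<alpha>' gp by blast
  have "reflection \<alpha> \<gamma> \<notin> span I"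
  proof -
    have "coef (reflection \<alpha> \<gamma>) \<kappa> = coef \<gamma> \<kappa>"
      using \<kappa> \<alpha>(1) \<alpha>'(1) IJ(3) by (auto simp: coef_reflection coef_simple)
    then show ?thesis using \<kappa> IJ in_span_iff[of I "reflection \<alpha> \<gamma>"] by force
  qed
  moreover have "reflection \<alpha> \<gamma> \<notin> span J"
  proof
    \<comment> \<open>In this case b would be exactly the multiple of \<alpha> subtracted by the
      reflection, so \<open>b \<bullet> \<alpha>\<close> would be twice
      \<open>\<gamma> \<bullet> \<alpha>\<close>, although both pairings agree and are
      positive.\<close>
    assume J: "reflection \<alpha> \<gamma> \<in> span J"
    then have 0: "coef (reflection \<alpha> \<gamma>) \<beta> = 0" if "\<beta> \<in> I" for \<beta>
      using in_span_iff[of J "reflection \<alpha> \<gamma>"] IJ that by blast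
    have co: "coef \<gamma> \<beta> = (2 * (\<gamma> \<bullet> \<alpha>) / (\<alpha> \<bullet> \<alpha>)) * coef \<alpha> \<beta>" if "\<beta> \<in> I" for \<beta>
      using 0[OF that] by (simp add: coef_reflection)
    have "b = (\<Sum>\<beta>\<in>I. ((2 * (\<gamma> \<bullet> \<alpha>) / (\<alpha> \<bullet> \<alpha>)) * coef \<alpha> \<beta>) *\<^sub>R \<beta>)"
      unfolding b_def using co by (intro sum.cong) auto
    also have "\<dots> = (2 * (\<gamma> \<bullet> \<alpha>) / (\<alpha> \<bullet> \<alpha>)) *\<^sub>R \<alpha>"
      using \<alpha>(1) \<alpha>'(1) fin by (simp add: coef_simple if_distrib if_distribR sum.delta cong: if_cong)
    finally have "b \<bullet> \<alpha> = 2 * (\<gamma> \<bullet> \<alpha>)" using simple_norm_pos[OF \<alpha>'(1)] by simp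
    then show False using inner_b[OF \<alpha>(1)] \<alpha>' by simp
  qed
  moreover have "reflection \<alpha> \<gamma> \<in> span (I \<union> J)"
    unfolding reflection_def using gs \<alpha>(1) by (intro span_diff span_scale) (auto intro: span_base)
  ultimately have "reflection \<alpha> \<gamma> \<in> X" using rp by (simp add: X_def)
  then show False using min height_reflection_less[OF \<alpha>'] by fastforce
qed

section \<open>Half sums of positive roots\<close>

lemma coef_hsum: "coef (hsum I) \<beta> = (1/2) * (\<Sum>\<gamma>\<in>pos \<inter> span I. coef \<gamma> \<beta>)"
  by (simp add: hsum_def half_sum_def coef_sum)

lemma coef_hsum_nonneg: "\<beta> \<in> \<Delta> \<Longrightarrow> 0 \<le> coef (hsum I) \<beta>"
  by (auto simp: coef_hsum intro!: sum_nonneg pos_coef)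

lemma coef_hsum_pos: "I \<subseteq> \<Delta> \<Longrightarrow> \<beta> \<in> I \<Longrightarrow> 0 < coef (hsum I) \<beta>"
proof -
  assume *: "I \<subseteq> \<Delta>" "\<beta> \<in> I"
  then have b: "\<beta> \<in> \<Delta>" by auto
  have "coef \<beta> \<beta> \<le> (\<Sum>\<gamma>\<in>pos \<inter> span I. coef \<gamma> \<beta>)"
    using * b by (intro member_le_sum) (auto intro: pos_coef span_base)
  then show ?thesis using b by (simp add: coef_hsum coef_simple)
qed

lemma hsum_in_span: "hsum I \<in> span I"
  unfolding hsum_def half_sum_def by (intro span_scale span_sum) auto

lemma coef_hsum_outside: "I \<subseteq> \<Delta> \<Longrightarrow> \<beta> \<in> \<Delta> \<Longrightarrow> \<beta> \<notin> I \<Longrightarrow> coef (hsum I) \<beta> = 0"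
  using hsum_in_span in_span_iff by blast

lemma coef_hsum_mono: "I \<subseteq> J \<Longrightarrow> \<beta> \<in> \<Delta> \<Longrightarrow> coef (hsum I) \<beta> \<le> coef (hsum J) \<beta>"
  unfolding coef_hsum using span_mono[of I J]
  by (intro mult_left_mono sum_mono2) (auto intro: pos_coef)

lemma hsum_inner: "I \<subseteq> \<Delta> \<Longrightarrow> x \<bullet> hsum I = (\<Sum>\<beta>\<in>I. coef (hsum I) \<beta> * (x \<bullet> \<beta>))"
proof -
  assume I: "I \<subseteq> \<Delta>"
  have "x \<bullet> hsum I = (\<Sum>\<beta>\<in>\<Delta>. coef (hsum I) \<beta> * (x \<bullet> \<beta>))"
    using inner_expansion[of "hsum I" x] by (simp add: inner_commute)
  also have "\<dots> = (\<Sum>\<beta>\<in>I. coef (hsum I) \<beta> * (x \<bullet> \<beta>))"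
    using I by (intro sum.mono_neutral_right) (auto simp: coef_hsum_outside)
  finally show ?thesis .
qed

lemma hsum_singleton: "\<alpha> \<in> \<Delta> \<Longrightarrow> hsum {\<alpha>} = (1/2) *\<^sub>R \<alpha>"
proof -
  assume a: "\<alpha> \<in> \<Delta>"
  have "pos \<inter> span {\<alpha>} = {\<alpha>}"
    using root_multiples[of \<alpha>] a pos_not_neg[of \<alpha>] pos_root by (auto intro: span_base)
  then show ?thesis by (simp add: hsum_def half_sum_def)
qed

text \<open>The reflection in \<alpha> permutes the positive roots of \<open>span I\<close> other
  than \<alpha>, so their sum is orthogonal to \<alpha> and only \<alpha> itself
  contributes.\<close>

lemma hsum_inner_member:
  assumes "I \<subseteq> \<Delta>" "\<alpha> \<in> I"
  shows "hsum I \<bullet> \<alpha> = (\<alpha> \<bullet> \<alpha>) / 2"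
proof -
  have a: "\<alpha> \<in> \<Delta>" using assms by auto
  define X where "X = (pos \<inter> span I) - {\<alpha>}"
  have maps: "reflection \<alpha> \<gamma> \<in> X" if "\<gamma> \<in> X" for \<gamma>
  proof -
    have "reflection \<alpha> \<gamma> \<noteq> \<alpha>"
      using that pos_not_neg[OF simple_pos[OF a]] reflection_involution[of \<alpha> \<gamma>]
        reflection_self[OF simple_nonzero[OF a]] by (metis DiffD1 IntD1 X_def)
    moreover have "reflection \<alpha> \<gamma> \<in> span I" unfolding reflection_def
      using that assms by (intro span_diff span_scale) (auto simp: X_def intro: span_base)
    ultimately show ?thesis using that simple_reflection_pos[OF a, of \<gamma>] by (simp add: X_def)
  qed
  have "(\<Sum>\<gamma>\<in>X. \<gamma>) \<bullet> \<alpha> = (\<Sum>\<gamma>\<in>X. reflection \<alpha> \<gamma>) \<bullet> \<alpha>"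
  proof -
    have "bij_betw (reflection \<alpha>) X X"
      by (rule bij_betw_byWitness[where f' = "reflection \<alpha>"]) (auto simp: maps)
    then show ?thesis using sum.reindex_bij_betw[of "reflection \<alpha>" X X "\<lambda>x. x"] by simp
  qed
  also have "\<dots> = (\<Sum>\<gamma>\<in>X. \<gamma>) \<bullet> reflection \<alpha> \<alpha>"
    by (simp add: inner_sum_left inner_reflection_swap)
  finally have "(\<Sum>\<gamma>\<in>X. \<gamma>) \<bullet> \<alpha> = 0"
    using reflection_self[OF simple_nonzero[OF a]] by simp
  moreover have "hsum I = (1/2) *\<^sub>R (\<alpha> + (\<Sum>\<gamma>\<in>X. \<gamma>))"
    unfolding hsum_def half_sum_def X_def
    using assms a by (subst sum.remove[of _ \<alpha>]) (auto intro: span_base)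
  ultimately show ?thesis by (simp add: inner_add_left)
qed

lemma hsum_inner_nonmember:
  assumes "I \<subseteq> \<Delta>" "\<alpha> \<in> \<Delta>" "\<alpha> \<notin> I"
  shows "hsum I \<bullet> \<alpha> \<le> 0"
proof -
  have "coef (hsum I) \<beta> * (\<alpha> \<bullet> \<beta>) \<le> 0" if "\<beta> \<in> I" for \<beta>
    using that assms coef_hsum_nonneg[of \<beta> I] simple_obtuse[of \<alpha> \<beta>]
    by (intro mult_nonneg_nonpos) auto
  then show ?thesis using hsum_inner[of I \<alpha>] assms sum_nonpos by (simp add: inner_commute sum_nonpos)
qed

lemma hsum_inner_orthogonal:
  assumes "I \<subseteq> \<Delta>" "\<And>\<beta>. \<beta> \<in> I \<Longrightarrow> \<beta> \<bullet> \<alpha> = 0"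
  shows "hsum I \<bullet> \<alpha> = 0"
proof -
  have "(\<Sum>\<beta>\<in>I. coef (hsum I) \<beta> * (\<alpha> \<bullet> \<beta>)) = 0"
    using assms(2) by (intro sum.neutral) (simp add: inner_commute)
  then show ?thesis using hsum_inner[of I \<alpha>] assms by (simp add: inner_commute)
qed

text \<open>At a simple root in I the two pairings cancel; at any other one the subtracted pairing
  is nonpositive because simple roots are mutually obtuse.\<close>

lemma dominant_hsum_diff: "I \<subseteq> \<Delta> \<Longrightarrow> dominant (hsum \<Delta> - hsum I)"
  unfolding dominant_def
proof
  fix \<alpha> assume I: "I \<subseteq> \<Delta>" and a: "\<alpha> \<in> \<Delta>"
  show "0 \<le> (hsum \<Delta> - hsum I) \<bullet> \<alpha>"
    using hsum_inner_member[of \<Delta> \<alpha>] hsum_inner_member[of I \<alpha>] hsum_inner_nonmember[of I \<alpha>]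
      inner_ge_zero[of \<alpha>] I a
    by (cases "\<alpha> \<in> I") (simp_all add: inner_diff_left del: inner_ge_zero)
qed

lemma dominant_inner_hsum_nonneg: "I \<subseteq> \<Delta> \<Longrightarrow> dominant x \<Longrightarrow> 0 \<le> x \<bullet> (hsum \<Delta> - hsum I)"
  unfolding inner_commute[of x] inner_expansion[of "hsum \<Delta> - hsum I" x]
  using coef_hsum_mono[of I \<Delta>]
  by (intro sum_nonneg mult_nonneg_nonneg) (auto simp: dominant_def inner_commute[of _ x])

end

section \<open>The Weyl group\<close>

text \<open>Explicit words supply the length on which the exchange argument inducts; a group element
  given as a map does not carry it.\<close>

definition reflection_word :: "'a::euclidean_space list \<Rightarrow> 'a \<Rightarrow> 'a" where
  "reflection_word ws = foldr (\<lambda>\<alpha> f. reflection \<alpha> \<circ> f) ws id"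

lemma reflection_word_Nil [simp]: "reflection_word [] = id"
  and reflection_word_Cons [simp]: "reflection_word (\<alpha> # ws) = reflection \<alpha> \<circ> reflection_word ws"
  by (simp_all add: reflection_word_def)

lemma reflection_word_append: "reflection_word (ws @ vs) = reflection_word ws \<circ> reflection_word vs"
  by (induction ws) auto

lemma linear_reflection_word: "linear (reflection_word ws)"
  by (induction ws)
    (simp_all add: linear_id linear_compose linear_reflection del: comp_apply id_apply)

lemma inner_reflection_word [simp]: "reflection_word ws x \<bullet> reflection_word ws y = x \<bullet> y"
  by (induction ws) auto

lemma reflection_word_rev: "reflection_word (rev ws) \<circ> reflection_word ws = id"
  by (induction ws) (auto simp: reflection_word_append fun_eq_iff)

lemma reflection_conj_word:
  "reflection (reflection_word ws \<beta>) \<circ> reflection_word ws = reflection_word ws \<circ> reflection \<beta>"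
proof (induction ws)
  case (Cons \<alpha> ws)
  have "reflection (reflection_word ws \<beta>) (reflection_word ws x) = reflection_word ws (reflection \<beta> x)" for x
    using Cons by (metis comp_apply)
  then show ?case by (auto simp: reflection_conj fun_eq_iff)
qed auto

context simple_root_basis
begin

lemma reflection_word_root: "set ws \<subseteq> \<Phi> \<Longrightarrow> \<beta> \<in> \<Phi> \<Longrightarrow> reflection_word ws \<beta> \<in> \<Phi>"
  by (induction ws) (auto simp: reflection_root)

text \<open>A counterexample of least height is not simple, and
  \<open>0 < \<gamma> \<bullet> \<gamma>\<close> gives a simple \<alpha> with positive pairing.
  Reflecting in \<alpha> produces a lower positive root, whose word is then conjugated by
  \<alpha>.\<close>

lemma root_reflection_word:
  assumes "\<gamma> \<in> pos"
  shows "\<exists>ws. set ws \<subseteq> \<Delta> \<and> reflection \<gamma> = reflection_word ws"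
proof (rule ccontr)
  define X where "X = {\<gamma> \<in> pos. \<not> (\<exists>ws. set ws \<subseteq> \<Delta> \<and> reflection \<gamma> = reflection_word ws)}"
  assume "\<not> ?thesis"
  then have "X \<noteq> {}" using assms by (auto simp: X_def)
  then obtain \<gamma> where g: "\<gamma> \<in> X" and min: "\<And>\<gamma>'. \<gamma>' \<in> X \<Longrightarrow> height \<gamma> \<le> height \<gamma>'"
    using height_minimal[of X] by (auto simp: X_def)
  have gp: "\<gamma> \<in> pos" and gX: "\<nexists>ws. set ws \<subseteq> \<Delta> \<and> reflection \<gamma> = reflection_word ws"
    using g by (auto simp: X_def)
  have "\<gamma> \<notin> \<Delta>"
  proof
    assume "\<gamma> \<in> \<Delta>"
    then have "set [\<gamma>] \<subseteq> \<Delta> \<and> reflection \<gamma> = reflection_word [\<gamma>]" by auto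
    then show False using gX by blast
  qed
  have "0 < \<gamma> \<bullet> \<gamma>" using pos_nonzero[OF gp] by simp
  then obtain \<alpha> where \<alpha>: "\<alpha> \<in> \<Delta>" "0 < coef \<gamma> \<alpha> * (\<alpha> \<bullet> \<gamma>)"
    unfolding inner_expansion[of \<gamma> \<gamma>] by (metis (no_types, lifting) sum_nonpos not_le)
  then have \<alpha>': "0 < \<gamma> \<bullet> \<alpha>"
    using pos_coef[OF gp, of \<alpha>] by (auto simp: zero_less_mult_iff inner_commute)
  have "reflection \<alpha> \<gamma> \<in> pos" using simple_reflection_pos \<alpha> gp \<open>\<gamma> \<notin> \<Delta>\<close> by metis
  moreover have "reflection \<alpha> \<gamma> \<notin> X"
    using min height_reflection_less[OF \<alpha>(1) \<alpha>'] by fastforce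
  ultimately obtain ws where ws: "set ws \<subseteq> \<Delta>" "reflection (reflection \<alpha> \<gamma>) = reflection_word ws"
    by (auto simp: X_def)
  have "reflection \<gamma> = reflection \<alpha> \<circ> reflection (reflection \<alpha> \<gamma>) \<circ> reflection \<alpha>"
    using reflection_conj[of \<alpha> "reflection \<alpha> \<gamma>"] by simp
  also have "\<dots> = reflection_word (\<alpha> # ws @ [\<alpha>])"
    using ws by (simp add: reflection_word_append fun_eq_iff)
  finally show False using gX ws(1) \<alpha>(1) by (metis Un_subset_iff empty_subsetI insert_subset list.set(1) list.set(2) set_append)
qed

lemma weyl_group_word:
  assumes "\<sigma> \<in> weyl_group \<Phi>"
  obtains ws where "set ws \<subseteq> \<Delta>" "\<sigma> = reflection_word ws"
proof -
  have "\<exists>ws. set ws \<subseteq> \<Delta> \<and> \<sigma> = reflection_word ws"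
    using assms
  proof induction
    case id
    show ?case by (rule exI[of _ "[]"]) auto
  next
    case (step \<alpha> \<sigma>)
    obtain vs where vs: "set vs \<subseteq> \<Delta>" "reflection \<alpha> = reflection_word vs"
      using pos_cases[OF step(1)] root_reflection_word[of \<alpha>] root_reflection_word[of "- \<alpha>"] by auto
    obtain ws where "set ws \<subseteq> \<Delta>" "\<sigma> = reflection_word ws" using step by auto
    then show ?case using vs by (intro exI[of _ "vs @ ws"]) (auto simp: reflection_word_append)
  qed
  then show thesis using that by blast
qed

lemma reflection_word_weyl: "set ws \<subseteq> \<Phi> \<Longrightarrow> reflection_word ws \<in> weyl_group \<Phi>"
  by (induction ws) (auto intro: weyl_group.intros simp del: id_apply)

lemma weyl_linear: "\<sigma> \<in> weyl_group \<Phi> \<Longrightarrow> linear \<sigma>"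
  and weyl_inner: "\<sigma> \<in> weyl_group \<Phi> \<Longrightarrow> \<sigma> x \<bullet> \<sigma> y = x \<bullet> y"
  and weyl_root: "\<sigma> \<in> weyl_group \<Phi> \<Longrightarrow> \<beta> \<in> \<Phi> \<Longrightarrow> \<sigma> \<beta> \<in> \<Phi>"
  using linear_reflection_word inner_reflection_word reflection_word_root simple_subset
  by (metis weyl_group_word subset_trans)+

lemma weyl_inverse:
  assumes "\<sigma> \<in> weyl_group \<Phi>"
  obtains \<tau> where "\<tau> \<in> weyl_group \<Phi>" "\<And>x. \<tau> (\<sigma> x) = x" "\<And>x. \<sigma> (\<tau> x) = x"
proof -
  obtain ws where ws: "set ws \<subseteq> \<Delta>" "\<sigma> = reflection_word ws" using assms weyl_group_word by blast
  have "reflection_word (rev ws) (\<sigma> x) = x" "\<sigma> (reflection_word (rev ws) x) = x" for x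
    using reflection_word_rev[of ws] reflection_word_rev[of "rev ws"] ws
    by (simp_all add: fun_eq_iff)
  moreover have "reflection_word (rev ws) \<in> weyl_group \<Phi>"
    using ws simple_subset by (intro reflection_word_weyl) auto
  ultimately show thesis using that by blast
qed

lemma weyl_comp:
  assumes "\<sigma> \<in> weyl_group \<Phi>" "\<tau> \<in> weyl_group \<Phi>"
  shows "\<sigma> \<circ> \<tau> \<in> weyl_group \<Phi>"
proof -
  obtain ws vs where "set ws \<subseteq> \<Delta>" "\<sigma> = reflection_word ws" "set vs \<subseteq> \<Delta>" "\<tau> = reflection_word vs"
    using assms weyl_group_word by metis
  then show ?thesis using reflection_word_weyl[of "ws @ vs"] simple_subset
    by (auto simp: reflection_word_append)
qed

lemma weyl_finite: "finite (weyl_group \<Phi>)"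
proof -
  \<comment> \<open>The restriction to \<Phi>, with \<open>undefined\<close> elsewhere, lies in a
    finite set of functions and determines the element because \<Phi> spans.\<close>
  let ?r = "\<lambda>\<sigma> \<beta>. if \<beta> \<in> \<Phi> then \<sigma> \<beta> else undefined"
  have "?r ` weyl_group \<Phi> \<subseteq> {f. \<forall>\<beta>. (\<beta> \<in> \<Phi> \<longrightarrow> f \<beta> \<in> \<Phi>) \<and> (\<beta> \<notin> \<Phi> \<longrightarrow> f \<beta> = undefined)}"
    using weyl_root by auto
  then have "finite (?r ` weyl_group \<Phi>)"
    by (rule finite_subset) (intro finite_set_of_finite_funs finite_roots)
  moreover have "inj_on ?r (weyl_group \<Phi>)"
  proof (rule inj_onI)
    fix \<sigma> \<tau> assume st: "\<sigma> \<in> weyl_group \<Phi>" "\<tau> \<in> weyl_group \<Phi>" "?r \<sigma> = ?r \<tau>"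
    have "\<sigma> \<beta> = \<tau> \<beta>" if "\<beta> \<in> \<Phi>" for \<beta> using fun_cong[OF st(3), of \<beta>] that by simp
    then have "\<sigma> x = \<tau> x" for x
      using linear_eq_on[OF weyl_linear[OF st(1)] weyl_linear[OF st(2)], of x \<Phi>] span_roots by auto
    then show "\<sigma> = \<tau>" by auto
  qed
  ultimately show ?thesis by (rule finite_imageD)
qed

text \<open>Read from the right, the word carries the positive root \<alpha> to a root that is not
  positive. The letter that turns the sign can be deleted in exchange for a factor
  \<open>reflection \<alpha>\<close> at the end.\<close>

lemma exchange:
  assumes "set ws \<subseteq> \<Delta>" "\<alpha> \<in> \<Delta>" "reflection_word ws \<alpha> \<notin> pos"
  shows "\<exists>vs. set vs \<subseteq> \<Delta> \<and> Suc (length vs) = length ws \<and>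
    reflection_word vs = reflection_word ws \<circ> reflection \<alpha>"
  using assms
proof (induction ws)
  case (Cons \<beta> ws)
  show ?case
  proof (cases "reflection_word ws \<alpha> \<in> pos")
    case False
    then obtain vs where "set vs \<subseteq> \<Delta>" "Suc (length vs) = length ws"
        "reflection_word vs = reflection_word ws \<circ> reflection \<alpha>"
      using Cons.IH Cons.prems by (metis insert_subset list.set(2))
    then show ?thesis using Cons(2) by (intro exI[of _ "\<beta> # vs"]) (auto simp: fun_eq_iff)
  next
    case True
    \<comment> \<open>The only positive root that the reflection in \<beta> makes non-positive is
      \<beta> itself.\<close>
    then have "reflection_word ws \<alpha> = \<beta>"
      using simple_reflection_pos[of \<beta> "reflection_word ws \<alpha>"] Cons by auto
    then have "reflection_word ws \<circ> reflection \<alpha> = reflection \<beta> \<circ> reflection_word ws"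
      using reflection_conj_word[of ws \<alpha>] by simp
    then have "reflection_word ws = reflection_word (\<beta> # ws) \<circ> reflection \<alpha>"
      by (simp add: fun_eq_iff)
    then show ?thesis using Cons(2) by (metis insert_subset length_Cons list.set(2))
  qed
qed simp

lemma dominant_pos: "dominant x \<Longrightarrow> \<gamma> \<in> pos \<Longrightarrow> 0 \<le> x \<bullet> \<gamma>"
  unfolding inner_commute[of x] inner_expansion[of \<gamma> x]
  by (intro sum_nonneg mult_nonneg_nonneg) (auto simp: pos_coef dominant_def inner_commute)

text \<open>Split off the last letter \<alpha>. If the remaining word keeps \<alpha> positive,
  appending the letter subtracts a nonnegative multiple of a nonnegative pairing; otherwise the
  exchange lemma gives a shorter word for the same element.\<close>

lemma dominant_inner_word_le:
  assumes "dominant x" "dominant \<mu>" "set ws \<subseteq> \<Delta>"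
  shows "x \<bullet> reflection_word ws \<mu> \<le> x \<bullet> \<mu>"
  using assms(3)
proof (induction "length ws" arbitrary: ws rule: less_induct)
  case less
  show ?case
  proof (cases ws rule: rev_cases)
    case (snoc vs \<alpha>)
    have a: "\<alpha> \<in> \<Delta>" and vs: "set vs \<subseteq> \<Delta>" using less snoc by auto
    show ?thesis
    proof (cases "reflection_word vs \<alpha> \<in> pos")
      case True
      let ?k = "2 * (\<mu> \<bullet> \<alpha>) / (\<alpha> \<bullet> \<alpha>)"
      have "reflection_word ws \<mu> = reflection_word vs (\<mu> - ?k *\<^sub>R \<alpha>)"
        by (simp add: snoc reflection_word_append reflection_def)
      also have "\<dots> = reflection_word vs \<mu> - ?k *\<^sub>R reflection_word vs \<alpha>"
        by (simp only: linear_diff[OF linear_reflection_word] linear_scale[OF linear_reflection_word])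
      finally have "x \<bullet> reflection_word ws \<mu> =
          x \<bullet> reflection_word vs \<mu> - ?k * (x \<bullet> reflection_word vs \<alpha>)"
        by (simp add: inner_diff_right)
      moreover have "0 \<le> ?k * (x \<bullet> reflection_word vs \<alpha>)"
        using dominant_pos[OF assms(1) True] assms(2) a by (simp add: dominant_def)
      ultimately show ?thesis using less(1)[of vs] vs snoc by simp
    next
      case False
      then obtain us where "set us \<subseteq> \<Delta>" "length us < length ws"
          "reflection_word us = reflection_word ws"
        using exchange[OF vs a] snoc by (auto simp: reflection_word_append)
      then show ?thesis using less(1)[of us] by simp
    qed
  qed simp
qed

lemma dominant_inner_weyl_le:
  "dominant x \<Longrightarrow> dominant \<mu> \<Longrightarrow> \<sigma> \<in> weyl_group \<Phi> \<Longrightarrow> x \<bullet> \<sigma> \<mu> \<le> x \<bullet> \<mu>"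
  by (metis weyl_group_word dominant_inner_word_le)

text \<open>Choose a point of the finite orbit with largest pairing with
  \<open>hsum \<Delta>\<close>. A simple reflection lowers that pairing by exactly the pairing with
  \<alpha>, which therefore cannot be negative.\<close>

lemma weyl_dominant_conjugate: "\<exists>\<sigma>\<in>weyl_group \<Phi>. dominant (\<sigma> x)"
proof -
  have "weyl_group \<Phi> \<noteq> {}" using weyl_group.id by blast
  then obtain \<sigma> where s: "\<sigma> \<in> weyl_group \<Phi>"
    and max: "\<And>\<tau>. \<tau> \<in> weyl_group \<Phi> \<Longrightarrow> - (\<sigma> x \<bullet> hsum \<Delta>) \<le> - (\<tau> x \<bullet> hsum \<Delta>)"
    using ex_is_arg_min_if_finite[OF weyl_finite, of "\<lambda>\<sigma>. - (\<sigma> x \<bullet> hsum \<Delta>)"]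
    by (metis is_arg_min_linorder)
  have "0 \<le> \<sigma> x \<bullet> \<alpha>" if a: "\<alpha> \<in> \<Delta>" for \<alpha>
  proof -
    have "(reflection \<alpha> \<circ> \<sigma>) x \<bullet> hsum \<Delta> \<le> \<sigma> x \<bullet> hsum \<Delta>"
      using max[OF weyl_group.step[OF simple_root[OF a] s]] by simp
    then have "0 \<le> (2 * (\<sigma> x \<bullet> \<alpha>) / (\<alpha> \<bullet> \<alpha>)) * (hsum \<Delta> \<bullet> \<alpha>)"
      by (simp add: reflection_def inner_diff_left inner_commute[of \<alpha> "hsum \<Delta>"])
    then show ?thesis using hsum_inner_member[of \<Delta> \<alpha>] a simple_norm_pos[OF a] by simp
  qed
  then show ?thesis using s by (auto simp: dominant_def)
qed

end

section \<open>Building sets and nested sets of simple roots\<close>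

definition antichain :: "'a set set \<Rightarrow> bool" where
  "antichain T \<longleftrightarrow> pairwise (\<lambda>A B. \<not> A \<subseteq> B \<and> \<not> B \<subseteq> A) T"

lemma maximal_in_above:
  assumes "finite X" "A \<in> X" "A \<subseteq> C"
  obtains M where "M \<in> maximal_in X C" "A \<subseteq> M"
proof -
  have "finite {B \<in> X. B \<subseteq> C}" "A \<in> {B \<in> X. B \<subseteq> C}" using assms by auto
  from finite_has_maximal2[OF this] obtain M
    where "M \<in> {B \<in> X. B \<subseteq> C}" "A \<subseteq> M" "\<forall>B\<in>{B \<in> X. B \<subseteq> C}. M \<subseteq> B \<longrightarrow> M = B" by blast
  then show thesis by (intro that[of M]) (auto simp: maximal_in_def)
qed

locale simple_building_set = simple_root_basis +
  fixes \<G> :: "'a set set"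
  assumes building: "building_set \<Phi> \<G>"
    and whole_space: "UNIV \<in> \<G>"
begin

text \<open>Fundamental subspaces are encoded by the simple roots they contain.\<close>

definition bld :: "'a set set" where "bld = {I. I \<subseteq> \<Delta> \<and> span I \<in> \<G>}"

definition comps :: "'a set \<Rightarrow> 'a set set" where "comps U = maximal_in bld U"

definition nested_index :: "'a set set \<Rightarrow> bool" where
  "nested_index N \<longleftrightarrow> N \<subseteq> bld \<and> (\<forall>T. T \<subseteq> N \<and> 2 \<le> card T \<and> antichain T \<longrightarrow> \<Union>T \<notin> bld)"

definition maximal_nested_index :: "'a set set \<Rightarrow> bool" where
  "maximal_nested_index N \<longleftrightarrow> nested_index N \<and> (\<forall>N'. nested_index N' \<and> N \<subseteq> N' \<longrightarrow> N' = N)"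

lemma building_subset: "\<G> \<subseteq> root_subspaces \<Phi>"
  and root_line: "\<alpha> \<in> \<Phi> \<Longrightarrow> span {\<alpha>} \<in> \<G>"
  and direct_sum: "C \<in> root_subspaces \<Phi> \<Longrightarrow> is_direct_sum C (maximal_in \<G> C)"
  using building by (simp_all add: building_set_def)

lemma finite_building: "finite \<G>"
proof -
  have "root_subspaces \<Phi> \<subseteq> span ` Pow \<Phi>" unfolding root_subspaces_def by auto
  then have "\<G> \<subseteq> span ` Pow \<Phi>" using building_subset by (rule subset_trans[rotated])
  then show ?thesis by (rule finite_subset) simp
qed

lemma bld_subset: "I \<in> bld \<Longrightarrow> I \<subseteq> \<Delta>"
  by (simp add: bld_def)

text \<open>The definition of \<open>bld\<close> does not exclude the empty set; it is ruled out
  because \<open>{0}\<close> is not the span of a nonempty set of roots.\<close>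

lemma bld_nonempty: "I \<in> bld \<Longrightarrow> I \<noteq> {}"
proof
  assume "I \<in> bld" "I = {}"
  then have "{0} \<in> root_subspaces \<Phi>" using building_subset by (auto simp: bld_def)
  then obtain S where "S \<subseteq> \<Phi>" "S \<noteq> {}" and S: "{0} = span S" unfolding root_subspaces_def by blast
  moreover have "S \<subseteq> {0}" unfolding S by (rule span_superset)
  ultimately have "0 \<in> S" by blast
  then show False using zero_not_root \<open>S \<subseteq> \<Phi>\<close> by blast
qed

lemma finite_bld [simp]: "finite bld"
  by (rule finite_subset[of _ "Pow \<Delta>"]) (auto simp: bld_def)

lemma bld_finite: "I \<in> bld \<Longrightarrow> finite I"
  by (rule finite_subset[OF bld_subset finite_simple])

lemma bld_singleton: "\<alpha> \<in> \<Delta> \<Longrightarrow> {\<alpha>} \<in> bld"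
  using root_line by (simp add: bld_def)

lemma bld_simple: "\<Delta> \<in> bld"
  using whole_space span_simple by (simp add: bld_def)

lemma bld_card: "I \<in> bld \<Longrightarrow> 1 \<le> card I \<and> card I \<le> DIM('a)"
  using bld_nonempty[of I] bld_finite[of I] card_mono[OF finite_simple bld_subset, of I]
  by (simp add: card_simple Suc_le_eq card_gt_0_iff)

lemma fund_building_eq: "fund_building \<Delta> \<G> = span ` bld"
  by (auto simp: fund_building_def bld_def)

text \<open>The root r = \<beta> - k \<alpha> obtained by reflecting \<beta> in \<alpha> lies in
  some summand of the decomposition of C, and k is nonzero. If \<alpha> and \<beta> lay in different
  summands, the relation between the three roots would contradict directness. So one summand
  contains both I and J, and it is all of C.\<close>

lemma bld_union:
  assumes I: "I \<in> bld" and J: "J \<in> bld" and ab: "\<alpha> \<in> I" "\<beta> \<in> J" "\<alpha> \<bullet> \<beta> \<noteq> 0"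
  shows "I \<union> J \<in> bld"
proof -
  define C where "C = span (I \<union> J)"
  have sub: "I \<union> J \<subseteq> \<Delta>" and ab': "\<alpha> \<in> \<Delta>" "\<beta> \<in> \<Delta>" using I J ab bld_subset by auto
  have "C \<in> root_subspaces \<Phi>"
    unfolding root_subspaces_def C_def mem_Collect_eq
    using sub simple_subset ab(1) by (intro exI[of _ "I \<union> J"]) auto
  then have ds: "is_direct_sum C (maximal_in \<G> C)" by (rule direct_sum)
  have ext: "\<exists>A'\<in>maximal_in \<G> C. A \<subseteq> A'" if "A \<in> \<G>" "A \<subseteq> C" for A
    using maximal_in_above[OF finite_building that] by metis
  have "span I \<subseteq> C" "span J \<subseteq> C" unfolding C_def by (rule span_mono, blast)+
  then obtain A1 A2 where A1: "A1 \<in> maximal_in \<G> C" "span I \<subseteq> A1"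
    and A2: "A2 \<in> maximal_in \<G> C" "span J \<subseteq> A2"
    using ext[of "span I"] ext[of "span J"] I J by (auto simp: bld_def)
  have subsp: "subspace A" if "A \<in> maximal_in \<G> C" for A
    using ds that by (simp add: is_direct_sum_def)
  have in12: "\<alpha> \<in> A1" "\<beta> \<in> A2" using ab A1 A2 by (auto intro: span_base)
  have "A1 = A2"
  proof (rule ccontr)
    assume ne: "A1 \<noteq> A2"
    define k where "k = 2 * (\<beta> \<bullet> \<alpha>) / (\<alpha> \<bullet> \<alpha>)"
    have k: "k \<noteq> 0" using ab simple_norm_pos[OF ab'(1)] by (simp add: k_def inner_commute)
    define r where "r = reflection \<alpha> \<beta>"
    have r: "r = \<beta> - k *\<^sub>R \<alpha>" by (simp add: r_def k_def reflection_def)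
    have "r \<in> C" unfolding r C_def using ab by (intro span_diff span_scale) (auto intro: span_base)
    then have "span {r} \<subseteq> C" unfolding C_def by (metis insert_subset empty_subsetI span_minimal subspace_span)
    moreover have "span {r} \<in> \<G>" unfolding r_def using ab' by (intro root_line reflection_root) auto
    ultimately obtain A3 where A3: "A3 \<in> maximal_in \<G> C" "r \<in> A3"
      using ext[of "span {r}"] by (auto intro: span_base)
    \<comment> \<open>This distributes the relation k \<alpha> - \<beta> + r = 0 over the summands;
      the conditional terms add up because A3 may coincide with A1 or A2.\<close>
    define f where "f A = (if A = A1 then k *\<^sub>R \<alpha> else 0) + (if A = A2 then - \<beta> else 0)
      + (if A = A3 then r else 0)" for A
    have "f A \<in> A" if "A \<in> maximal_in \<G> C" for A
    proof -
      have "(if A = A1 then k *\<^sub>R \<alpha> else 0) \<in> A" "(if A = A2 then - \<beta> else 0) \<in> A"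
          "(if A = A3 then r else 0) \<in> A"
        using subsp[OF that] in12 A3(2) by (auto simp: subspace_scale subspace_neg subspace_0)
      then show ?thesis unfolding f_def by (intro subspace_add[OF subsp[OF that]])
    qed
    moreover have "(\<Sum>A\<in>maximal_in \<G> C. f A) = 0"
    proof -
      have "finite (maximal_in \<G> C)" using ds by (simp add: is_direct_sum_def)
      then show ?thesis unfolding f_def sum.distrib using A1 A2 A3 by (simp add: r)
    qed
    ultimately have z: "f A1 = 0" "f A2 = 0" using ds A1 A2 unfolding is_direct_sum_def by blast+
    \<comment> \<open>A3 differs from A1 or from A2. At the summand it misses, the value of f is a
      nonzero multiple of a simple root.\<close>
    show False
    proof (cases "A3 = A2")
      case True
      then show False using z(1) ne k simple_nonzero[OF ab'(1)] by (simp add: f_def)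
    next
      case False
      then show False using z(2) ne simple_nonzero[OF ab'(2)] by (simp add: f_def)
    qed
  qed
  then have "I \<union> J \<subseteq> A1" using A1(2) A2(2) span_superset[of I] span_superset[of J] by blast
  then have "C \<subseteq> A1" unfolding C_def using subsp[OF A1(1)] by (rule span_minimal)
  then have "C \<in> \<G>" using A1(1) unfolding maximal_in_def by auto
  then show ?thesis using sub by (simp add: bld_def C_def)
qed

text \<open>A common root is not orthogonal to itself, so \<open>bld_union\<close> applies with
  \<beta> equal to \<alpha>.\<close>

lemma bld_union_meet:
  assumes "I \<in> bld" "J \<in> bld" "I \<inter> J \<noteq> {}"
  shows "I \<union> J \<in> bld"
proof -
  obtain \<alpha> where a: "\<alpha> \<in> I" "\<alpha> \<in> J" using assms by auto
  then have "\<alpha> \<bullet> \<alpha> \<noteq> 0" using bld_subset[OF assms(1)] simple_nonzero[of \<alpha>] by auto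
  then show ?thesis using bld_union[OF assms(1,2) a] by simp
qed

lemma bld_Union_meet:
  assumes "finite T" "T \<subseteq> bld" "K \<in> bld" "\<And>J. J \<in> T \<Longrightarrow> J \<inter> K \<noteq> {}"
  shows "K \<union> \<Union>T \<in> bld"
  using assms
proof induction
  case (insert J T)
  then have "K \<union> \<Union>T \<in> bld" "J \<in> bld" "J \<inter> (K \<union> \<Union>T) \<noteq> {}" by auto
  then have "J \<union> (K \<union> \<Union>T) \<in> bld" using bld_union_meet by blast
  moreover have "J \<union> (K \<union> \<Union>T) = K \<union> \<Union>(insert J T)" by auto
  ultimately show ?case by metis
qed simp

section \<open>Components of a set of simple roots\<close>

lemma compsD: "J \<in> comps U \<Longrightarrow> J \<in> bld" "J \<in> comps U \<Longrightarrow> J \<subseteq> U"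
  and comps_maximal: "J \<in> comps U \<Longrightarrow> K \<in> bld \<Longrightarrow> K \<subseteq> U \<Longrightarrow> J \<subseteq> K \<Longrightarrow> K = J"
  by (auto simp: comps_def maximal_in_def)

lemma finite_comps [simp]: "finite (comps U)"
  by (rule finite_subset[of _ bld]) (auto dest: compsD)

lemma comps_absorb:
  assumes "J \<in> comps U" "K \<in> bld" "K \<subseteq> U" "J \<union> K \<in> bld"
  shows "K \<subseteq> J"
  using comps_maximal[OF assms(1,4)] compsD(2)[OF assms(1)] assms(3) by auto

lemma comps_absorb_meet: "J \<in> comps U \<Longrightarrow> K \<in> bld \<Longrightarrow> K \<subseteq> U \<Longrightarrow> J \<inter> K \<noteq> {} \<Longrightarrow> K \<subseteq> J"
  using comps_absorb bld_union_meet compsD(1) by metis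

lemma comps_union:
  assumes "J \<in> comps U" "K \<in> comps U" "J \<union> K \<in> bld"
  shows "J = K"
  using comps_absorb[OF assms(1) compsD[OF assms(2)] assms(3)]
    comps_absorb[OF assms(2) compsD[OF assms(1)]] assms(3) by (simp add: Un_commute)

lemma comps_orthogonal:
  assumes "J \<in> comps U" "K \<in> comps U" "J \<noteq> K" "\<alpha> \<in> J" "\<beta> \<in> K"
  shows "\<alpha> \<bullet> \<beta> = 0"
  using bld_union[OF compsD(1)[OF assms(1)] compsD(1)[OF assms(2)] assms(4,5)]
    comps_union[OF assms(1,2)] assms(3) by blast

lemma comps_disjoint:
  assumes "J \<in> comps U" "K \<in> comps U" "J \<noteq> K"
  shows "J \<inter> K = {}"
  using bld_union_meet[OF compsD(1)[OF assms(1)] compsD(1)[OF assms(2)]]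
    comps_union[OF assms(1,2)] assms(3) by blast

lemma comps_extend: "K \<in> bld \<Longrightarrow> K \<subseteq> U \<Longrightarrow> \<exists>J\<in>comps U. K \<subseteq> J"
  unfolding comps_def using maximal_in_above[OF finite_bld] by metis

lemma comps_cover: "U \<subseteq> \<Delta> \<Longrightarrow> \<alpha> \<in> U \<Longrightarrow> \<exists>J\<in>comps U. \<alpha> \<in> J"
  using comps_extend[of "{\<alpha>}" U] bld_singleton by auto

lemma comps_bld: "U \<in> bld \<Longrightarrow> comps U = {U}"
  by (auto simp: comps_def maximal_in_def)

text \<open>On subsets of \<Delta> the map \<open>span\<close> is an order embedding. This lets the
  decompositions in \<open>delta_bar\<close> and \<open>level_bar\<close> be computed with index
  sets.\<close>

lemma maximal_fund_building:
  "U \<subseteq> \<Delta> \<Longrightarrow> maximal_in (fund_building \<Delta> \<G>) (span U) = span ` comps U"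
proof -
  assume U: "U \<subseteq> \<Delta>"
  have 1: "span I \<subseteq> span U \<longleftrightarrow> I \<subseteq> U" if "I \<in> bld" for I
    by (rule span_subset_iff[OF bld_subset[OF that] U])
  have 2: "span I \<subseteq> span J \<longleftrightarrow> I \<subseteq> J" "span I = span J \<longleftrightarrow> I = J" if "I \<in> bld" "J \<in> bld" for I J
    using span_subset_iff[OF bld_subset bld_subset] span_eq_iff_simple[OF bld_subset bld_subset] that
    by auto
  have "(\<forall>A'\<in>span ` bld. A' \<subseteq> span U \<and> span I \<subseteq> A' \<longrightarrow> A' = span I) \<longleftrightarrow>
      (\<forall>J\<in>bld. J \<subseteq> U \<and> I \<subseteq> J \<longrightarrow> J = I)" if "I \<in> bld" for I
    unfolding ball_simps using 1 2[OF that] 2[OF _ that] by (intro ball_cong) simp_all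
  then have "{I \<in> bld. span I \<subseteq> span U \<and>
      (\<forall>A'\<in>span ` bld. A' \<subseteq> span U \<and> span I \<subseteq> A' \<longrightarrow> A' = span I)} = comps U"
    unfolding comps_def maximal_in_def using 1 by (intro Collect_cong) metis
  moreover have "{A \<in> span ` bld. P A} = span ` {I \<in> bld. P (span I)}" for P by auto
  ultimately show ?thesis unfolding fund_building_eq maximal_in_def by simp
qed

lemma inj_on_span: "X \<subseteq> Pow \<Delta> \<Longrightarrow> inj_on span X"
  by (rule inj_onI) (metis PowD span_eq_iff_simple subsetD)

lemma comps_Pow: "comps U \<subseteq> Pow \<Delta>"
  using compsD bld_subset by blast

text \<open>Distinct components are disjoint and mutually orthogonal, so a positive root in
  \<open>span U\<close> lies in the span of exactly one of them.\<close>

lemma hsum_comps: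
  assumes U: "U \<subseteq> \<Delta>"
  shows "hsum U = (\<Sum>J\<in>comps U. hsum J)"
proof -
  have sub: "J \<subseteq> \<Delta>" if "J \<in> comps U" for J using that comps_Pow by auto
  have "pos \<inter> span U = (\<Union>J\<in>comps U. pos \<inter> span J)"
  proof (intro equalityI subsetI)
    fix \<gamma> assume g: "\<gamma> \<in> pos \<inter> span U"
    then have "\<exists>\<beta>\<in>\<Delta>. coef \<gamma> \<beta> \<noteq> 0"
      using coef_eqI[of \<gamma> 0] pos_nonzero by auto
    then obtain \<beta> where b: "\<beta> \<in> U" "coef \<gamma> \<beta> \<noteq> 0" using g U in_span_iff[OF U, of \<gamma>] by auto
    then obtain J where J: "J \<in> comps U" "\<beta> \<in> J" using comps_cover U by blast
    have orth: "\<alpha> \<bullet> \<kappa> = 0" if ak: "\<alpha> \<in> J" "\<kappa> \<in> U - J" for \<alpha> \<kappa>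
    proof -
      obtain K where K: "K \<in> comps U" "\<kappa> \<in> K" using comps_cover[OF U, of \<kappa>] ak(2) by auto
      then have "J \<noteq> K" using ak(2) by auto
      then show ?thesis using comps_orthogonal[OF J(1) K(1)] K(2) ak(1) by simp
    qed
    have "J \<union> (U - J) = U" using compsD(2)[OF J(1)] by auto
    then have "\<gamma> \<in> span J \<or> \<gamma> \<in> span (U - J)"
      using U g by (intro root_in_orthogonal_part[of J "U - J"] sub[OF J(1)] orth) auto
    moreover have "\<gamma> \<notin> span (U - J)" using b J U in_span_iff[of "U - J" \<gamma>] by auto
    ultimately show "\<gamma> \<in> (\<Union>J\<in>comps U. pos \<inter> span J)" using g J by auto
  next
    fix \<gamma> assume "\<gamma> \<in> (\<Union>J\<in>comps U. pos \<inter> span J)"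
    then show "\<gamma> \<in> pos \<inter> span U" using compsD(2) span_mono by blast
  qed
  moreover have "(pos \<inter> span J) \<inter> (pos \<inter> span K) = {}"
    if "J \<in> comps U" "K \<in> comps U" "J \<noteq> K" for J K
  proof -
    have "\<gamma> = 0" if "\<gamma> \<in> span J" "\<gamma> \<in> span K" for \<gamma>
      using that sub[of J] sub[of K] \<open>J \<in> _\<close> \<open>K \<in> _\<close> comps_disjoint[of J U K] \<open>J \<noteq> K\<close>
      by (intro coef_eqI) (auto simp: in_span_iff)
    then show ?thesis using pos_nonzero by auto
  qed
  ultimately show ?thesis
    unfolding hsum_def half_sum_def scaleR_sum_right[symmetric]
    by (subst sum.UNION_disjoint[symmetric]) auto
qed

section \<open>Nested families of index sets\<close>

lemma nested_indexD: "nested_index N \<Longrightarrow> N \<subseteq> bld"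
  and nested_index_Union: "nested_index N \<Longrightarrow> T \<subseteq> N \<Longrightarrow> 2 \<le> card T \<Longrightarrow> antichain T \<Longrightarrow> \<Union>T \<notin> bld"
  by (auto simp: nested_index_def)

lemma nested_index_finite: "nested_index N \<Longrightarrow> finite N"
  by (rule finite_subset[OF nested_indexD finite_bld])

lemma nested_index_pair:
  assumes "nested_index N" "A \<in> N" "B \<in> N" "\<not> A \<subseteq> B" "\<not> B \<subseteq> A"
  shows "A \<union> B \<notin> bld"
proof -
  have "A \<noteq> B" using assms by auto
  then have "2 \<le> card {A, B}" "antichain {A, B}" using assms by (auto simp: antichain_def pairwise_insert)
  then have "\<Union>{A, B} \<notin> bld" using assms by (intro nested_index_Union) auto
  then show ?thesis by simp
qed

lemma nested_index_orthogonal: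
  assumes "nested_index N" "A \<in> N" "B \<in> N" "\<not> A \<subseteq> B" "\<not> B \<subseteq> A" "\<alpha> \<in> A" "\<beta> \<in> B"
  shows "\<alpha> \<bullet> \<beta> = 0"
  using nested_index_pair[OF assms(1-5)] bld_union[OF _ _ assms(6,7)] nested_indexD[OF assms(1)]
    assms(2,3) by blast

lemma nested_index_laminar:
  assumes "nested_index N" "A \<in> N" "B \<in> N" "A \<inter> B \<noteq> {}"
  shows "A \<subseteq> B \<or> B \<subseteq> A"
  using nested_index_pair[OF assms(1-3)] bld_union_meet[OF _ _ assms(4)] nested_indexD[OF assms(1)]
    assms(2,3) by blast

lemma card_ge_2_iff: "finite T \<Longrightarrow> 2 \<le> card T \<longleftrightarrow> (\<exists>x\<in>T. \<exists>y\<in>T. x \<noteq> y)"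
  by (metis card_le_Suc0_iff_eq not_less_eq_eq numeral_2_eq_2)

text \<open>A component K of the union absorbs every member it meets, so it is the union of the
  members inside it. Two or more such members would contradict nestedness, hence K is itself a
  member.\<close>

lemma comps_antichain:
  assumes N: "nested_index N" and T: "T \<subseteq> N" "antichain T"
  shows "comps (\<Union>T) = T"
proof -
  have bT: "T \<subseteq> bld" using nested_indexD[OF N] T by simp
  then have fT: "finite T" by (rule finite_subset) simp
  have *: "K \<in> T" if K: "K \<in> comps (\<Union>T)" for K
  proof -
    define T' where "T' = {J \<in> T. J \<subseteq> K}"
    have "J \<subseteq> K" if "J \<in> T" "J \<inter> K \<noteq> {}" for J
      using that bT K comps_absorb_meet[OF K, of J] by blast
    then have KT: "K = \<Union>T'" using compsD(2)[OF K] unfolding T'_def by blast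
    have "antichain T'" "T' \<subseteq> N" "finite T'"
      using T fT by (auto simp: T'_def antichain_def pairwise_def)
    then have "\<not> (\<exists>x\<in>T'. \<exists>y\<in>T'. x \<noteq> y)"
      using nested_index_Union[OF N, of T'] KT compsD(1)[OF K] card_ge_2_iff by blast
    moreover have "T' \<noteq> {}" using KT compsD(1)[OF K] bld_nonempty by auto
    ultimately obtain J where J: "T' = {J}" by (metis is_singletonI' is_singletonE)
    then have "K = J" using KT by simp
    moreover have "T' \<subseteq> T" by (auto simp: T'_def)
    ultimately show ?thesis using J by simp
  qed
  have "J \<in> comps (\<Union>T)" if J: "J \<in> T" for J
  proof -
    obtain K where K: "K \<in> comps (\<Union>T)" "J \<subseteq> K" using comps_extend[of J "\<Union>T"] J bT by blast
    then have "J = K" using *[OF K(1)] J T(2) unfolding antichain_def pairwise_def by blast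
    then show ?thesis using K by simp
  qed
  then show ?thesis using * by blast
qed

text \<open>Inclusion, equality and cardinality transfer through the embedding \<open>span\<close>,
  and the sum of the subspaces of a subfamily is the span of the union of its index sets.\<close>

lemma nested_span_iff:
  assumes N: "N \<subseteq> Pow \<Delta>"
  shows "nested \<Delta> \<G> (span ` N) \<longleftrightarrow> nested_index N"
proof -
  have sp: "span (\<Union>(span ` T)) = span (\<Union>T)" for T :: "'a set set"
  proof
    show "span (\<Union>(span ` T)) \<subseteq> span (\<Union>T)"
      by (intro span_minimal UN_least span_mono subspace_span) auto
    show "span (\<Union>T) \<subseteq> span (\<Union>(span ` T))"
      by (rule span_mono) (auto intro: span_base)
  qed
  have fN: "finite N" using N finite_subset by (metis finite_Pow_iff finite_simple)
  have b: "span ` N \<subseteq> fund_building \<Delta> \<G> \<longleftrightarrow> N \<subseteq> bld"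
    using N by (auto simp: fund_building_def bld_def)
  have inj: "inj_on span T" if "T \<subseteq> N" for T using that N inj_on_span by blast
  have card: "card (span ` T) = card T" if "T \<subseteq> N" for T using card_image[OF inj[OF that]] .
  have pw: "pairwise (\<lambda>A B. \<not> A \<subseteq> B \<and> \<not> B \<subseteq> A) (span ` T) \<longleftrightarrow> antichain T" if "T \<subseteq> N" for T
  proof -
    have "span A \<subseteq> span B \<longleftrightarrow> A \<subseteq> B" "span A = span B \<longleftrightarrow> A = B" if "A \<in> T" "B \<in> T" for A B
    proof -
      have "A \<subseteq> \<Delta>" "B \<subseteq> \<Delta>" using that \<open>T \<subseteq> N\<close> N by auto
      then show "span A \<subseteq> span B \<longleftrightarrow> A \<subseteq> B" "span A = span B \<longleftrightarrow> A = B"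
        by (simp_all add: span_subset_iff span_eq_iff_simple)
    qed
    then show ?thesis unfolding antichain_def pairwise_def by (simp add: ball_simps cong: ball_cong)
  qed
  have un: "span (\<Union>T) \<in> \<G> \<longleftrightarrow> \<Union>T \<in> bld" if "T \<subseteq> N" for T
    using that N by (auto simp: bld_def)
  have "(\<forall>\<T>. \<T> \<subseteq> span ` N \<and> finite \<T> \<and> 2 \<le> card \<T> \<and>
          pairwise (\<lambda>A B. \<not> A \<subseteq> B \<and> \<not> B \<subseteq> A) \<T> \<longrightarrow> span (\<Union>\<T>) \<notin> \<G>) \<longleftrightarrow>
      (\<forall>T. T \<subseteq> N \<longrightarrow> finite (span ` T) \<and> 2 \<le> card (span ` T) \<and>
          pairwise (\<lambda>A B. \<not> A \<subseteq> B \<and> \<not> B \<subseteq> A) (span ` T) \<longrightarrow> span (\<Union>(span ` T)) \<notin> \<G>)"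
    unfolding subset_image_iff by blast
  also have "\<dots> \<longleftrightarrow> (\<forall>T. T \<subseteq> N \<and> 2 \<le> card T \<and> antichain T \<longrightarrow> \<Union>T \<notin> bld)"
  proof (rule all_cong1)
    show "(T \<subseteq> N \<longrightarrow> finite (span ` T) \<and> 2 \<le> card (span ` T) \<and>
          pairwise (\<lambda>A B. \<not> A \<subseteq> B \<and> \<not> B \<subseteq> A) (span ` T) \<longrightarrow> span (\<Union>(span ` T)) \<notin> \<G>) \<longleftrightarrow>
        (T \<subseteq> N \<and> 2 \<le> card T \<and> antichain T \<longrightarrow> \<Union>T \<notin> bld)" for T
      using card[of T] pw[of T] un[of T] sp[of T] finite_subset[OF _ fN, of T] by (cases "T \<subseteq> N") auto
  qed
  finally show ?thesis unfolding nested_def nested_index_def b by simp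
qed

lemma nested_obtain_index:
  assumes "nested \<Delta> \<G> \<S>"
  obtains N where "\<S> = span ` N" "nested_index N"
proof -
  have "\<S> \<subseteq> span ` bld" using assms fund_building_eq by (simp add: nested_def)
  then obtain N where "N \<subseteq> bld" "\<S> = span ` N" by (auto simp: subset_image_iff)
  moreover have "N \<subseteq> Pow \<Delta>" using \<open>N \<subseteq> bld\<close> bld_subset by auto
  ultimately show thesis using that assms nested_span_iff by metis
qed

lemma maximal_nested_iff:
  "maximal_nested \<Delta> \<G> \<S> \<longleftrightarrow> (\<exists>N. \<S> = span ` N \<and> maximal_nested_index N)"
proof -
  have pow: "N \<subseteq> Pow \<Delta>" if "nested_index N" for N using that nested_indexD bld_subset by blast
  have im: "span ` N \<subseteq> span ` N' \<longleftrightarrow> N \<subseteq> N'" if "nested_index N" "nested_index N'" for N N'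
    using inj_on_image_subset_iff[of span "Pow \<Delta>" N N'] inj_on_span pow that by blast
  show ?thesis
  proof
    assume *: "maximal_nested \<Delta> \<G> \<S>"
    then obtain N where N: "\<S> = span ` N" "nested_index N"
      using nested_obtain_index maximal_nested_def by metis
    have "N' = N" if "nested_index N'" "N \<subseteq> N'" for N'
      using * N that nested_span_iff[OF pow] im unfolding maximal_nested_def
      by (metis image_mono subset_antisym subset_refl)
    then show "\<exists>N. \<S> = span ` N \<and> maximal_nested_index N" using N by (auto simp: maximal_nested_index_def)
  next
    assume "\<exists>N. \<S> = span ` N \<and> maximal_nested_index N"
    then obtain N where N: "\<S> = span ` N" "maximal_nested_index N" by blast
    then have nN: "nested_index N" by (simp add: maximal_nested_index_def)
    have "\<T> = \<S>" if T: "nested \<Delta> \<G> \<T>" "\<S> \<subseteq> \<T>" for \<T>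
    proof -
      obtain N' where N': "\<T> = span ` N'" "nested_index N'" using nested_obtain_index[OF T(1)] .
      then have "N \<subseteq> N'" using im[OF nN N'(2)] T(2) N(1) by simp
      then have "N' = N" using N(2) N'(2) unfolding maximal_nested_index_def by simp
      then show ?thesis using N(1) N'(1) by simp
    qed
    then show "maximal_nested \<Delta> \<G> \<S>"
      using N nN nested_span_iff[OF pow[OF nN]] by (simp add: maximal_nested_def)
  qed
qed

lemma nested_index_extend:
  assumes "nested_index N"
  obtains N' where "N \<subseteq> N'" "maximal_nested_index N'"
proof -
  have "{N'. nested_index N'} \<subseteq> Pow bld" using nested_indexD by auto
  then have "finite {N'. nested_index N'}" by (rule finite_subset) simp
  from finite_has_maximal2[OF this, of N] assms obtain M where "N \<subseteq> M" "nested_index M"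
    "\<And>N'. nested_index N' \<Longrightarrow> M \<subseteq> N' \<Longrightarrow> M = N'" by auto
  then show thesis by (intro that[of M]) (auto simp: maximal_nested_index_def)
qed

end

section \<open>Suitable lists\<close>

locale suitable_building_set = simple_building_set +
  fixes \<epsilon> :: "nat \<Rightarrow> real" and a :: real
  assumes suitable: "suitable_list \<Phi> \<Delta> \<G> \<epsilon> a"
begin

lemma eps_top: "\<epsilon> (card \<Delta>) = a"
  using suitable by (simp add: suitable_list_def card_simple)

lemma ratio_bounds:
  assumes "I \<in> bld" "J \<in> bld" "I \<subset> J" "\<beta> \<in> I"
  shows "coef (hsum J) \<beta> / coef (hsum I) \<beta> \<le> ratio \<Phi> \<Delta> (span J) (span I)"
proof -
  have I: "I \<subseteq> \<Delta>" using bld_subset assms by simp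
  have b: "\<beta> \<in> \<Delta>" using I assms by auto
  have fin: "finite (coef (hsum J) ` \<Delta>)" "finite (coef (hsum I) ` I)" using bld_finite assms by auto
  have "Min (coef (hsum I) ` I) \<in> coef (hsum I) ` I" using fin assms(4) by (intro Min_in) auto
  then have "0 < Min (coef (hsum I) ` I)" using coef_hsum_pos[OF I] by auto
  moreover have "Min (coef (hsum I) ` I) \<le> coef (hsum I) \<beta>" using fin assms(4) by (intro Min_le) auto
  moreover have "coef (hsum J) \<beta> \<le> Max (coef (hsum J) ` \<Delta>)" using fin b by (intro Max_ge) auto
  moreover have "0 \<le> coef (hsum J) \<beta>" using coef_hsum_nonneg b by simp
  ultimately have "coef (hsum J) \<beta> / coef (hsum I) \<beta> \<le> Max (coef (hsum J) ` \<Delta>) / Min (coef (hsum I) ` I)"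
    by (intro frac_le) linarith+
  then show ?thesis by (simp add: ratio_def hsum_def simple_Int_span[OF I])
qed

lemma max_ratio_bounds:
  assumes "I \<in> bld" "J \<in> bld" "I \<subset> J" "\<beta> \<in> I"
  shows "coef (hsum J) \<beta> / coef (hsum I) \<beta> \<le> max_ratio \<Phi> \<Delta> \<G> (card J) (card I)"
proof -
  have IJ: "I \<subseteq> \<Delta>" "J \<subseteq> \<Delta>" using bld_subset assms by auto
  let ?R = "ratios \<Phi> \<Delta> \<G> (card J) (card I)"
  have "span I \<subset> span J" using assms(3) span_subset_iff[OF IJ] span_eq_iff_simple[OF IJ] by auto
  moreover have "span I \<in> fund_building \<Delta> \<G>" "span J \<in> fund_building \<Delta> \<G>"
    using assms fund_building_eq by auto
  ultimately have mem: "ratio \<Phi> \<Delta> (span J) (span I) \<in> ?R"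
    unfolding ratios_def mem_Collect_eq using dim_simple IJ dim_span by metis
  have "?R \<subseteq> (\<lambda>(A, B). ratio \<Phi> \<Delta> A B) ` (fund_building \<Delta> \<G> \<times> fund_building \<Delta> \<G>)"
    by (auto simp: ratios_def)
  then have "finite ?R" by (rule finite_subset) (simp add: fund_building_eq)
  then have "ratio \<Phi> \<Delta> (span J) (span I) \<le> Max ?R" using mem by (rule Max_ge)
  then show ?thesis using ratio_bounds[OF assms] mem by (auto simp: max_ratio_def)
qed

text \<open>Coefficients of half sums grow with the index set; if no pair exists, the default value
  1 is taken. Hence \<epsilon> more than doubles from one dimension to the next, even where the
  building set skips dimensions.\<close>

lemma max_ratio_ge_1: "1 \<le> max_ratio \<Phi> \<Delta> \<G> i j"
proof (cases "ratios \<Phi> \<Delta> \<G> i j = {}")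
  case False
  then obtain A B where AB: "A \<in> fund_building \<Delta> \<G>" "B \<in> fund_building \<Delta> \<G>" "B \<subset> A"
    "dim A = i" "dim B = j" by (auto simp: ratios_def)
  then obtain I J where IJ: "I \<in> bld" "J \<in> bld" "B = span I" "A = span J" by (auto simp: fund_building_eq)
  have sub: "I \<subseteq> \<Delta>" "J \<subseteq> \<Delta>" using IJ bld_subset by auto
  have "I \<subset> J" using AB(3) IJ span_subset_iff[OF sub] by auto
  moreover obtain \<beta> where b: "\<beta> \<in> I" using bld_nonempty[OF IJ(1)] by auto
  ultimately have "coef (hsum J) \<beta> / coef (hsum I) \<beta> \<le> max_ratio \<Phi> \<Delta> \<G> i j"
    using max_ratio_bounds[OF IJ(1,2)] AB(4,5) IJ(3,4) dim_simple sub by auto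
  moreover have "1 \<le> coef (hsum J) \<beta> / coef (hsum I) \<beta>"
    using coef_hsum_mono[of I J \<beta>] coef_hsum_pos[OF sub(1) b] \<open>I \<subset> J\<close> b sub by auto
  ultimately show ?thesis by linarith
qed (simp add: max_ratio_def)

lemma eps_step: "i \<in> {2..DIM('a)} \<Longrightarrow> 2 * max_ratio \<Phi> \<Delta> \<G> i (i - 1) * \<epsilon> (i - 1) < \<epsilon> i"
  using suitable by (simp add: suitable_list_def)

lemma eps_pos:
  assumes "1 \<le> i" "i \<le> DIM('a)"
  shows "0 < \<epsilon> i"
  using assms
proof (induction i rule: dec_induct)
  case base
  then show ?case using suitable by (simp add: suitable_list_def)
next
  case (step i)
  have "\<forall>i\<in>{2..DIM('a)}. \<epsilon> (i - 1) < \<epsilon> i" using suitable by (simp add: suitable_list_def)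
  moreover have "Suc i \<in> {2..DIM('a)}" using step by simp
  ultimately have "\<epsilon> (Suc i - 1) < \<epsilon> (Suc i)" by blast
  then show ?case using step by simp
qed

lemma eps_double:
  assumes "1 \<le> i" "Suc i \<le> DIM('a)"
  shows "2 * \<epsilon> i < \<epsilon> (Suc i)"
proof -
  have "2 * max_ratio \<Phi> \<Delta> \<G> (Suc i) i * \<epsilon> i < \<epsilon> (Suc i)"
    using eps_step[of "Suc i"] assms by simp
  moreover have "1 * \<epsilon> i \<le> max_ratio \<Phi> \<Delta> \<G> (Suc i) i * \<epsilon> i"
    using max_ratio_ge_1 eps_pos[of i] assms by (intro mult_right_mono) auto
  ultimately show ?thesis by linarith
qed

lemma eps_growth:
  assumes "1 \<le> i" "i \<le> j" "j \<le> DIM('a)"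
  shows "2 ^ (j - i) * \<epsilon> i \<le> \<epsilon> j"
  using assms(2,1,3)
proof (induction j rule: dec_induct)
  case (step j)
  then show ?case using eps_double[of j] by (simp add: Suc_diff_le)
qed simp

text \<open>The suitability condition for a single pair, multiplied out so that no quotient
  remains.\<close>

lemma coef_ratio_step:
  assumes "I \<in> bld" "J \<in> bld" "I \<subset> J" "card J = Suc (card I)" "\<beta> \<in> I"
  shows "2 * coef (hsum J) \<beta> * \<epsilon> (card I) < coef (hsum I) \<beta> * \<epsilon> (card J)"
proof -
  let ?m = "max_ratio \<Phi> \<Delta> \<G> (card J) (card I)"
  have cI: "0 < coef (hsum I) \<beta>" using coef_hsum_pos bld_subset assms by simp
  have e: "0 < \<epsilon> (card I)" using eps_pos bld_card[OF assms(1)] by simp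
  have "2 * ?m * \<epsilon> (card I) < \<epsilon> (card J)"
    using eps_step[of "card J"] bld_card[OF assms(1)] bld_card[OF assms(2)] assms(4) by simp
  then have "coef (hsum I) \<beta> * (2 * ?m * \<epsilon> (card I)) < coef (hsum I) \<beta> * \<epsilon> (card J)"
    using cI by simp
  moreover have "coef (hsum J) \<beta> \<le> ?m * coef (hsum I) \<beta>"
    using max_ratio_bounds[OF assms(1-3,5)] cI by (simp add: pos_divide_le_eq)
  then have "coef (hsum J) \<beta> * (2 * \<epsilon> (card I)) \<le> ?m * coef (hsum I) \<beta> * (2 * \<epsilon> (card I))"
    using e by (intro mult_right_mono) auto
  ultimately show ?thesis by (simp add: algebra_simps)
qed

text \<open>The suitability condition only compares consecutive dimensions. If a simple root of \<open>J\<close>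
  outside \<open>I\<close> is not orthogonal to \<open>I\<close>, adding it keeps \<open>I\<close> in the building set and raises the
  dimension by one; otherwise \<open>I\<close> is a union of connected components of \<open>J\<close> and the
  coefficients over \<open>I\<close> agree.\<close>

lemma coef_ratio:
  assumes "I \<in> bld" "J \<in> bld" "I \<subseteq> J" "\<beta> \<in> I"
  shows "2 ^ (card J - card I) * coef (hsum J) \<beta> * \<epsilon> (card I) \<le> coef (hsum I) \<beta> * \<epsilon> (card J)"
  using assms
proof (induction "card J - card I" arbitrary: I rule: less_induct)
  case less
  note I = less.prems(1) and J = less.prems(2)
  have sub: "I \<subseteq> \<Delta>" "J \<subseteq> \<Delta>" using bld_subset I J by auto
  have cI: "0 < coef (hsum I) \<beta>" using coef_hsum_pos[OF sub(1)] less.prems by simp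
  show ?case
  proof (cases "\<exists>\<kappa>\<in>J - I. \<exists>\<alpha>\<in>I. \<alpha> \<bullet> \<kappa> \<noteq> 0")
    case True
    then obtain \<kappa> \<alpha> where k: "\<kappa> \<in> J" "\<kappa> \<notin> I" "\<alpha> \<in> I" "\<alpha> \<bullet> \<kappa> \<noteq> 0" by auto
    define K where "K = I \<union> {\<kappa>}"
    have K: "K \<in> bld" unfolding K_def
      using k sub by (intro bld_union[OF I bld_singleton, of \<kappa> \<alpha> \<kappa>]) auto
    have KJ: "K \<subseteq> J" "I \<subset> K" using less.prems(3) k by (auto simp: K_def)
    have card: "card K = Suc (card I)" using k bld_finite[OF I] by (simp add: K_def)
    have le: "card K \<le> card J" using card_mono[OF bld_finite[OF J] KJ(1)] .
    have eK: "0 < \<epsilon> (card K)" "0 < \<epsilon> (card I)" "0 < \<epsilon> (card J)"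
      using eps_pos bld_card K I J by auto
    have "2 ^ (card J - card K) * coef (hsum J) \<beta> * \<epsilon> (card K) \<le> coef (hsum K) \<beta> * \<epsilon> (card J)"
    proof (rule less.hyps[OF _ K J KJ(1)])
      show "\<beta> \<in> K" using less.prems(4) KJ(2) by blast
    qed (use card le in simp)
    \<comment> \<open>The bound from K to J is combined with the single step from I to K; the
      positive factor \<open>\<epsilon> (card K)\<close> cancels and the 2 of the step completes the
      power.\<close>
    then have "(2 ^ (card J - card K) * coef (hsum J) \<beta> * \<epsilon> (card K)) * (2 * \<epsilon> (card I))
        \<le> (coef (hsum K) \<beta> * \<epsilon> (card J)) * (2 * \<epsilon> (card I))"
      using eK by (intro mult_right_mono) auto
    also have "\<dots> = (2 * coef (hsum K) \<beta> * \<epsilon> (card I)) * \<epsilon> (card J)" by (simp add: algebra_simps)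
    also have "\<dots> \<le> (coef (hsum I) \<beta> * \<epsilon> (card K)) * \<epsilon> (card J)"
      using coef_ratio_step[OF I K KJ(2) card less.prems(4)] eK by (intro mult_right_mono) auto
    finally have "(2 * 2 ^ (card J - card K) * coef (hsum J) \<beta> * \<epsilon> (card I)) * \<epsilon> (card K)
        \<le> (coef (hsum I) \<beta> * \<epsilon> (card J)) * \<epsilon> (card K)" by (simp add: algebra_simps)
    then have "2 * 2 ^ (card J - card K) * coef (hsum J) \<beta> * \<epsilon> (card I) \<le> coef (hsum I) \<beta> * \<epsilon> (card J)"
      using eK(1) by simp
    moreover have "card J - card I = Suc (card J - card K)" using card le by simp
    ultimately show ?thesis by simp
  next
    case False
    have "pos \<inter> span J = (pos \<inter> span I) \<union> (pos \<inter> span (J - I))"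
    proof
      have "I \<union> (J - I) = J" "J - I \<subseteq> \<Delta>" using less.prems(3) sub by auto
      then show "pos \<inter> span J \<subseteq> (pos \<inter> span I) \<union> (pos \<inter> span (J - I))"
        using root_in_orthogonal_part[of I "J - I"] False sub by auto
      show "(pos \<inter> span I) \<union> (pos \<inter> span (J - I)) \<subseteq> pos \<inter> span J"
        using span_mono[OF less.prems(3)] span_mono[of "J - I" J] by auto
    qed
    moreover have "coef \<gamma> \<beta> = 0" if "\<gamma> \<in> pos \<inter> span (J - I)" for \<gamma>
      using that sub less.prems(4) in_span_iff[of "J - I" \<gamma>] by auto
    ultimately have "(\<Sum>\<gamma>\<in>pos \<inter> span J. coef \<gamma> \<beta>) = (\<Sum>\<gamma>\<in>pos \<inter> span I. coef \<gamma> \<beta>)"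
      by (intro sum.mono_neutral_right) auto
    then have "coef (hsum J) \<beta> = coef (hsum I) \<beta>" by (simp add: coef_hsum)
    moreover have "2 ^ (card J - card I) * \<epsilon> (card I) \<le> \<epsilon> (card J)"
      using bld_card I J card_mono[OF bld_finite[OF J] less.prems(3)] by (intro eps_growth) auto
    ultimately show ?thesis using cI by simp
  qed
qed

end

section \<open>Vertices of maximal nested sets\<close>

text \<open>If x and y are at least 2, then \<open>1 \<le> (x - 1) * (y - 1)\<close>, that is
  \<open>x + y \<le> x * y\<close>. The exponents will be the sizes of nonempty disjoint
  nodes.\<close>

lemma sum_power2_le:
  assumes "finite T" "\<And>x. x \<in> T \<Longrightarrow> 1 \<le> f x"
  shows "(\<Sum>x\<in>T. 2 ^ f x :: real) \<le> 2 ^ (\<Sum>x\<in>T. f x)"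
  using assms
proof induction
  case (insert y T)
  show ?case
  proof (cases "T = {}")
    case False
    then obtain z where "z \<in> T" by auto
    then have "1 \<le> (\<Sum>x\<in>T. f x)"
      using insert member_le_sum[of z T f] by (metis insert_iff le_trans zero_le)
    then have Y: "(2::real) \<le> 2 ^ (\<Sum>x\<in>T. f x)" and X: "(2::real) \<le> 2 ^ f y"
      using insert.prems[of y] power_increasing[of 1 _ "2::real"] by auto
    have "0 \<le> (2 ^ f y - 1) * ((2::real) ^ (\<Sum>x\<in>T. f x) - 1) - 1"
      using mult_mono[of 1 "2 ^ f y - 1" 1 "(2::real) ^ (\<Sum>x\<in>T. f x) - 1"] X Y by simp
    then have "2 ^ f y + (2::real) ^ (\<Sum>x\<in>T. f x) \<le> 2 ^ f y * 2 ^ (\<Sum>x\<in>T. f x)"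
      by (simp add: algebra_simps)
    then show ?thesis using insert by (simp add: power_add)
  qed simp
qed simp

context simple_building_set
begin

section \<open>The forest formed by a nested set under inclusion\<close>

definition below :: "'a set set \<Rightarrow> 'a set \<Rightarrow> 'a set set" where "below N I = {J \<in> N. J \<subset> I}"

definition children :: "'a set set \<Rightarrow> 'a set \<Rightarrow> 'a set set" where
  "children N I = maximal_in (below N I) I"

text \<open>The roots of I that no smaller node claims. For a maximal nested set there is exactly
  one, which makes the equations of the nodes a triangular system.\<close>

definition own :: "'a set set \<Rightarrow> 'a set \<Rightarrow> 'a set" where "own N I = I - \<Union>(below N I)"

lemma childrenD: "J \<in> children N I \<Longrightarrow> J \<in> N" "J \<in> children N I \<Longrightarrow> J \<subset> I"
  by (auto simp: children_def maximal_in_def below_def)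

lemma children_maximal: "J \<in> children N I \<Longrightarrow> K \<in> N \<Longrightarrow> K \<subset> I \<Longrightarrow> J \<subseteq> K \<Longrightarrow> K = J"
  by (auto simp: children_def maximal_in_def below_def)

lemma children_antichain: "T \<subseteq> children N I \<Longrightarrow> antichain T"
proof -
  assume T: "T \<subseteq> children N I"
  have "\<not> J \<subseteq> K" if "J \<in> T" "K \<in> T" "J \<noteq> K" for J K
    using children_maximal[of J N I K] childrenD[of K N I] that T by auto
  then show ?thesis unfolding antichain_def pairwise_def by blast
qed

lemma children_above:
  assumes "finite N" "J \<in> N" "J \<subset> I"
  obtains K where "K \<in> children N I" "J \<subseteq> K"
proof -
  have "finite (below N I)" "J \<in> below N I" "J \<subseteq> I" using assms by (auto simp: below_def)
  from maximal_in_above[OF this] show thesis using that unfolding children_def by blast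
qed

lemma Union_children: "finite N \<Longrightarrow> \<Union>(children N I) = \<Union>(below N I)"
proof
  assume "finite N"
  show "\<Union>(children N I) \<subseteq> \<Union>(below N I)"
    by (rule Union_mono) (auto simp: children_def maximal_in_def)
  show "\<Union>(below N I) \<subseteq> \<Union>(children N I)"
  proof
    fix x assume "x \<in> \<Union>(below N I)"
    then obtain J where J: "J \<in> N" "J \<subset> I" "x \<in> J" by (auto simp: below_def)
    obtain K where "K \<in> children N I" "J \<subseteq> K" using children_above[OF \<open>finite N\<close> J(1,2)] .
    then show "x \<in> \<Union>(children N I)" using J(3) by auto
  qed
qed

text \<open>If the children covered I, their union would belong to \<open>bld\<close>, so by
  nestedness there would be a single child, equal to I; but children are proper subsets.\<close>

lemma own_nonempty:
  assumes N: "nested_index N" and I: "I \<in> N"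
  shows "own N I \<noteq> {}"
proof
  assume "own N I = {}"
  then have "I \<subseteq> \<Union>(children N I)"
    using Union_children[OF nested_index_finite[OF N]] by (simp add: own_def)
  moreover have "\<Union>(children N I) \<subseteq> I" using childrenD by fast
  ultimately have eq: "\<Union>(children N I) = I" by (rule antisym[rotated])
  have Ib: "I \<in> bld" using I nested_indexD[OF N] by auto
  have sub: "children N I \<subseteq> N" using childrenD by fast
  then have fin: "finite (children N I)" using nested_index_finite[OF N] finite_subset by metis
  have "\<not> 2 \<le> card (children N I)"
    using nested_index_Union[OF N sub _ children_antichain] eq Ib by auto
  moreover have "children N I \<noteq> {}" using eq bld_nonempty[OF Ib] by auto
  ultimately obtain J where "children N I = {J}"
    using card_ge_2_iff[OF fin] by (metis is_singletonI' is_singletonE)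
  then have "J = I" "J \<subset> I" using eq childrenD(2)[of J N I] by auto
  then show False by simp
qed

text \<open>Any two members containing the nonempty set K meet, so they are comparable, and one of
  least cardinality lies in all the others.\<close>

lemma nested_index_least:
  assumes N: "nested_index N" and K: "K \<noteq> {}" "I0 \<in> N" "K \<subseteq> I0"
  obtains I where "I \<in> N" "K \<subseteq> I" "\<forall>J\<in>N. K \<subseteq> J \<longrightarrow> I \<subseteq> J"
proof -
  define X where "X = {I \<in> N. K \<subseteq> I}"
  have "finite X" using nested_index_finite[OF N] by (simp add: X_def)
  moreover have "X \<noteq> {}" using K by (auto simp: X_def)
  ultimately obtain I where I: "I \<in> X" and min: "\<And>J. J \<in> X \<Longrightarrow> card I \<le> card J"
    using ex_is_arg_min_if_finite[of X card] by (metis is_arg_min_linorder)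
  have "I \<subseteq> J" if "J \<in> N" "K \<subseteq> J" for J
  proof -
    have "I \<inter> J \<noteq> {}" using I that K by (auto simp: X_def)
    then have "I \<subseteq> J \<or> J \<subseteq> I" using nested_index_laminar[OF N] I that by (simp add: X_def)
    moreover have "finite I" using I nested_indexD[OF N] bld_finite by (auto simp: X_def)
    moreover have "card I \<le> card J" using min that by (simp add: X_def)
    ultimately show ?thesis using card_seteq by blast
  qed
  then show thesis using that[of I] I by (simp add: X_def)
qed

lemma maximal_nestedD: "maximal_nested_index N \<Longrightarrow> nested_index N"
  by (simp add: maximal_nested_index_def)

lemma maximal_nested_insert: "maximal_nested_index N \<Longrightarrow> nested_index (insert J N) \<Longrightarrow> J \<in> N"
  unfolding maximal_nested_index_def by blast

lemma nested_index_insert: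
  assumes N: "nested_index N" and J: "J \<in> bld"
    and T: "\<And>T. T \<subseteq> N \<Longrightarrow> T \<noteq> {} \<Longrightarrow> antichain (insert J T) \<Longrightarrow> J \<notin> T \<Longrightarrow> J \<union> \<Union>T \<notin> bld"
  shows "nested_index (insert J N)"
  unfolding nested_index_def
proof (intro conjI allI impI)
  show "insert J N \<subseteq> bld" using nested_indexD[OF N] J by simp
  fix T assume A: "T \<subseteq> insert J N \<and> 2 \<le> card T \<and> antichain T"
  show "\<Union>T \<notin> bld"
  proof (cases "J \<in> T")
    case True
    define T' where "T' = T - {J}"
    have eq: "T = insert J T'" and "J \<notin> T'" using True by (auto simp: T'_def)
    moreover have "T' \<noteq> {}" using A eq by auto
    moreover have "T' \<subseteq> N" using A by (auto simp: T'_def)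
    ultimately have "J \<union> \<Union>T' \<notin> bld" using T[of T'] A by simp
    then show ?thesis using eq by simp
  next
    case False
    then show ?thesis using nested_index_Union[OF N, of T] A by auto
  qed
qed

text \<open>\<Delta> contains every other member, so adding it creates no antichain with two
  elements through it.\<close>

lemma maximal_nested_top:
  assumes "maximal_nested_index N"
  shows "\<Delta> \<in> N"
proof -
  note nN = maximal_nestedD[OF assms]
  have "nested_index (insert \<Delta> N)"
  proof (rule nested_index_insert[OF nN bld_simple])
    fix T assume T: "T \<subseteq> N" "T \<noteq> {}" "antichain (insert \<Delta> T)" "\<Delta> \<notin> T"
    then obtain K where K: "K \<in> T" by auto
    then have "K \<in> bld" using T(1) nested_indexD[OF nN] by auto
    then have "K \<subseteq> \<Delta>" by (rule bld_subset)
    moreover have "K \<noteq> \<Delta>" using K T(4) by auto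
    ultimately show "\<Delta> \<union> \<Union>T \<notin> bld"
      using T(3) K unfolding antichain_def pairwise_insert by blast
  qed
  then show ?thesis by (rule maximal_nested_insert[OF assms])
qed

text \<open>If \<open>I\<close> owned two roots \<open>\<alpha>\<close> and \<open>\<beta>\<close>, the component of \<open>I - {\<alpha>}\<close> containing \<open>\<beta>\<close> could be added
  to \<open>N\<close>.\<close>

lemma own_unique:
  assumes N: "maximal_nested_index N" and I: "I \<in> N" and o: "\<alpha> \<in> own N I" "\<beta> \<in> own N I"
  shows "\<alpha> = \<beta>"
proof (rule ccontr)
  assume ne: "\<alpha> \<noteq> \<beta>"
  note nN = maximal_nestedD[OF N]
  have Ib: "I \<in> bld" using I nested_indexD[OF nN] by auto
  have sub: "I - {\<alpha>} \<subseteq> \<Delta>" using bld_subset[OF Ib] by auto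
  obtain J where J: "J \<in> comps (I - {\<alpha>})" "\<beta> \<in> J"
    using comps_cover[OF sub, of \<beta>] o ne by (auto simp: own_def)
  have JI: "J \<subset> I" using compsD(2)[OF J(1)] o(1) by (auto simp: own_def)
  have "J \<notin> N" using o(2) J(2) JI by (auto simp: own_def below_def)
  moreover have "nested_index (insert J N)"
  proof (rule nested_index_insert[OF nN compsD(1)[OF J(1)]])
    fix T assume T: "T \<subseteq> N" "T \<noteq> {}" "antichain (insert J T)" "J \<notin> T"
    have inc: "\<not> J \<subseteq> K" "\<not> K \<subseteq> J" if "K \<in> T" for K
      using that T(3,4) unfolding antichain_def pairwise_def by auto
    show "J \<union> \<Union>T \<notin> bld"
    proof
      assume U: "J \<union> \<Union>T \<in> bld"
      have dich: "K \<subset> I \<or> \<not> K \<subseteq> I \<and> \<not> I \<subseteq> K" if "K \<in> T" for K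
        using inc[OF that] JI by auto
      show False
      proof (cases "\<forall>K\<in>T. K \<subset> I")
        case True
        \<comment> \<open>No member of N properly inside I contains \<alpha>, so the union stays in
          \<open>I - {\<alpha>}\<close>, where J is already maximal.\<close>
        have "J \<union> \<Union>T \<subseteq> I - {\<alpha>}"
        proof -
          have "K \<subseteq> I - {\<alpha>}" if K: "K \<in> T" for K
          proof -
            have "K \<in> below N I" using K T(1) True unfolding below_def by blast
            then have "\<alpha> \<notin> K" using o(1) unfolding own_def by blast
            then show ?thesis using True K by blast
          qed
          then show ?thesis using compsD(2)[OF J(1)] by blast
        qed
        then have "J \<union> \<Union>T = J" using comps_maximal[OF J(1) U] by auto
        moreover obtain K where "K \<in> T" using T(2) by auto
        ultimately show False using inc(2)[of K] by blast
      next
        case False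
        \<comment> \<open>J and the members of T inside I are absorbed by I. The other members
          together with I form an antichain in N whose union is a union of two meeting elements of
          \<open>bld\<close>.\<close>
        define T' where "T' = insert I {K \<in> T. \<not> K \<subset> I}"
        have fT: "finite T" using T(1) nested_index_finite[OF nN] finite_subset by metis
        have "antichain T'"
        proof -
          have "antichain T" using T(3) by (auto simp: antichain_def pairwise_insert)
          then have "antichain {K \<in> T. \<not> K \<subset> I}" by (auto simp: antichain_def pairwise_def)
          then show ?thesis unfolding T'_def antichain_def pairwise_insert using dich by auto
        qed
        moreover have "T' \<subseteq> N" using T(1) I by (auto simp: T'_def)
        moreover have "2 \<le> card T'"
        proof -
          obtain K where "K \<in> T" "\<not> K \<subset> I" using False by auto
          then have "K \<in> T'" "I \<in> T'" "K \<noteq> I" using dich by (auto simp: T'_def)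
          moreover have "finite T'" using fT by (simp add: T'_def)
          ultimately show ?thesis using card_ge_2_iff by blast
        qed
        ultimately have "\<Union>T' \<notin> bld" using nested_index_Union[OF nN] by blast
        moreover have "I \<union> (J \<union> \<Union>T) = \<Union>T'" using JI by (auto simp: T'_def)
        moreover have "I \<union> (J \<union> \<Union>T) \<in> bld"
          using bld_union_meet[OF Ib U] JI bld_nonempty[OF compsD(1)[OF J(1)]] by auto
        ultimately show False by simp
      qed
    qed
  qed
  ultimately show False using maximal_nested_insert[OF N] by blast
qed

definition root_of :: "'a set set \<Rightarrow> 'a set \<Rightarrow> 'a" where "root_of N I = (SOME \<alpha>. \<alpha> \<in> own N I)"

lemma own_eq: "maximal_nested_index N \<Longrightarrow> I \<in> N \<Longrightarrow> own N I = {root_of N I}"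
proof -
  assume *: "maximal_nested_index N" "I \<in> N"
  have "root_of N I \<in> own N I"
    unfolding root_of_def using own_nonempty[OF maximal_nestedD[OF *(1)] *(2)] by (simp add: some_in_eq)
  then show ?thesis using own_unique[OF *] by auto
qed

lemma own_decomposition:
  assumes N: "maximal_nested_index N" and I: "I \<in> N"
  shows "I = insert (root_of N I) (\<Union>(children N I))" "root_of N I \<notin> \<Union>(children N I)"
proof -
  have "own N I = I - \<Union>(children N I)"
    using Union_children[OF nested_index_finite[OF maximal_nestedD[OF N]]] by (simp add: own_def)
  moreover have "\<Union>(children N I) \<subseteq> I" using childrenD by fast
  ultimately show "I = insert (root_of N I) (\<Union>(children N I))" "root_of N I \<notin> \<Union>(children N I)"
    using own_eq[OF N I] by auto
qed

lemma node_cases: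
  assumes "maximal_nested_index N" "I \<in> N" "\<beta> \<in> I"
  obtains "\<beta> = root_of N I" | J where "J \<in> children N I" "\<beta> \<in> J"
proof -
  have "\<beta> \<in> insert (root_of N I) (\<Union>(children N I))"
    using own_decomposition(1)[OF assms(1,2)] assms(3) by simp
  then show thesis using that by blast
qed

lemma children_disjoint:
  assumes N: "nested_index N" and JK: "J \<in> children N I" "K \<in> children N I" "J \<noteq> K"
  shows "J \<inter> K = {}"
proof (rule ccontr)
  assume "J \<inter> K \<noteq> {}"
  then have "J \<subseteq> K \<or> K \<subseteq> J" using nested_index_laminar[OF N] childrenD JK by metis
  then show False using children_antichain[of "{J, K}" N I] JK unfolding antichain_def pairwise_def by auto
qed

lemma finite_children: "nested_index N \<Longrightarrow> finite (children N I)"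
  by (rule finite_subset[OF _ nested_index_finite]) (auto dest: childrenD)

lemma sum_over_node:
  assumes N: "maximal_nested_index N" and I: "I \<in> N"
  shows "sum f I = f (root_of N I) + (\<Sum>J\<in>children N I. sum f J)"
proof -
  note nN = maximal_nestedD[OF N]
  have bN: "J \<in> children N I \<Longrightarrow> finite J" for J
    using childrenD(1) nested_indexD[OF nN] bld_finite by blast
  have "sum f (insert (root_of N I) (\<Union>(children N I))) = f (root_of N I) + sum f (\<Union>(children N I))"
    using own_decomposition(2)[OF N I] finite_children[OF nN] bN by (intro sum.insert) auto
  also have "sum f (\<Union>(children N I)) = (\<Sum>J\<in>children N I. sum f J)"
    using finite_children[OF nN] bN children_disjoint[OF nN] by (subst sum.Union_disjoint) auto
  finally show ?thesis using own_decomposition(1)[OF N I] by simp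
qed

lemma node_in_simple: "maximal_nested_index N \<Longrightarrow> I \<in> N \<Longrightarrow> I \<subseteq> \<Delta>"
  using nested_indexD[OF maximal_nestedD] bld_subset by blast

lemma root_of_mem: "maximal_nested_index N \<Longrightarrow> I \<in> N \<Longrightarrow> root_of N I \<in> I"
  using own_decomposition(1) by blast

text \<open>Nodes with the same owned root meet, so one contains the other; but the root owned by
  the larger lies in no smaller node.\<close>

lemma inj_root_of:
  assumes N: "maximal_nested_index N"
  shows "inj_on (root_of N) N"
proof (rule inj_onI)
  have *: False if "I \<in> N" "J \<in> N" "root_of N I = root_of N J" "I \<subset> J" for I J
  proof -
    have "root_of N J \<in> \<Union>(below N J)"
      using that root_of_mem[OF N that(1)] by (auto simp: below_def)
    then show False using own_eq[OF N that(2)] by (auto simp: own_def)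
  qed
  fix I J assume IJ: "I \<in> N" "J \<in> N" "root_of N I = root_of N J"
  have "I \<inter> J \<noteq> {}" using root_of_mem[OF N] IJ by fastforce
  then have "I \<subseteq> J \<or> J \<subseteq> I" using nested_index_laminar[OF maximal_nestedD[OF N]] IJ by blast
  then show "I = J" using *[of I J] *[of J I] IJ by auto
qed

text \<open>The system is triangular: once the pairings with the roots of the children vanish, the
  equation of I involves only the owned root, and its coefficient is positive.\<close>

lemma node_coordinates_zero:
  assumes N: "maximal_nested_index N" and z: "\<And>I. I \<in> N \<Longrightarrow> z \<bullet> hsum I = 0" and "I \<in> N"
  shows "\<forall>\<beta>\<in>I. z \<bullet> \<beta> = 0"
  using \<open>I \<in> N\<close>
proof (induction "card I" arbitrary: I rule: less_induct)
  case less
  let ?r = "root_of N I"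
  have ch: "z \<bullet> \<beta> = 0" if "J \<in> children N I" "\<beta> \<in> J" for J \<beta>
  proof -
    have "finite I" using node_in_simple[OF N less.prems] finite_subset finite_simple by blast
    then have "card J < card I" using childrenD(2)[OF that(1)] by (rule psubset_card_mono)
    then show ?thesis using less.hyps[of J] childrenD(1)[OF that(1)] that(2) by blast
  qed
  have "0 = (\<Sum>\<beta>\<in>I. coef (hsum I) \<beta> * (z \<bullet> \<beta>))"
    using hsum_inner[OF node_in_simple[OF N less.prems], of z] z[OF less.prems] by simp
  also have "\<dots> = coef (hsum I) ?r * (z \<bullet> ?r)"
    unfolding sum_over_node[OF N less.prems] using ch by simp
  finally have "z \<bullet> ?r = 0"
    using coef_hsum_pos[OF node_in_simple[OF N less.prems] root_of_mem[OF N less.prems]] by simp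
  then show ?case using ch by (auto elim: node_cases[OF N less.prems])
qed

lemma node_values_unique:
  assumes N: "maximal_nested_index N" and eq: "\<And>I. I \<in> N \<Longrightarrow> x \<bullet> hsum I = y \<bullet> hsum I"
  shows "x = y"
proof -
  have "\<forall>\<beta>\<in>\<Delta>. (x - y) \<bullet> \<beta> = 0"
    using eq by (intro node_coordinates_zero[OF N _ maximal_nested_top[OF N]]) (simp add: inner_diff_left)
  then have "(x - y) \<bullet> (x - y) = 0"
    using inner_expansion[of "x - y" "x - y"] by (simp add: inner_commute)
  then show ?thesis by simp
qed

text \<open>Recording the value at each node as the coefficient at its owned root gives a linear
  endomorphism L of the space. It is injective by uniqueness, hence surjective, so the nodes need
  not be counted.\<close>

lemma node_values_exist:
  assumes N: "maximal_nested_index N"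
  shows "\<exists>x. \<forall>I\<in>N. x \<bullet> hsum I = v I"
proof -
  define r where "r = root_of N"
  define L where "L x = (\<Sum>I\<in>N. (x \<bullet> hsum I) *\<^sub>R r I)" for x
  have fN: "finite N" using nested_index_finite[OF maximal_nestedD[OF N]] .
  have rD: "r I \<in> \<Delta>" if "I \<in> N" for I
    using root_of_mem[OF N that] node_in_simple[OF N that] by (auto simp: r_def)
  have inj: "r I = r J \<longleftrightarrow> I = J" if "I \<in> N" "J \<in> N" for I J
    using inj_root_of[OF N] that by (auto simp: r_def inj_on_def)
  have co: "coef (\<Sum>J\<in>N. w J *\<^sub>R r J) (r I) = w I" if "I \<in> N" for w I
  proof -
    have "coef (\<Sum>J\<in>N. w J *\<^sub>R r J) (r I) = (\<Sum>J\<in>N. if J = I then w J else 0)"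
      unfolding coef_sum using that inj rD by (intro sum.cong) (auto simp: coef_simple)
    then show ?thesis using fN that by simp
  qed
  have lin: "linear L"
    unfolding L_def by (intro linearI)
      (simp_all add: inner_add_left scaleR_add_left sum.distrib scaleR_sum_right)
  moreover have "inj L"
  proof (rule injI)
    fix x y assume "L x = L y"
    then have "x \<bullet> hsum I = y \<bullet> hsum I" if "I \<in> N" for I
      using co[OF that, of "\<lambda>I. x \<bullet> hsum I"] co[OF that, of "\<lambda>I. y \<bullet> hsum I"] by (simp add: L_def)
    then show "x = y" using node_values_unique[OF N] by blast
  qed
  ultimately have "surj L" by (rule linear_injective_imp_surjective) (rule refl)
  then obtain x where "L x = (\<Sum>I\<in>N. v I *\<^sub>R r I)" by (metis surjD)
  then have "x \<bullet> hsum I = v I" if "I \<in> N" for I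
    using co[OF that, of "\<lambda>I. x \<bullet> hsum I"] co[OF that, of v] by (simp add: L_def)
  then show ?thesis by blast
qed

end

context suitable_building_set
begin

text \<open>A maximal nested set contains \<Delta>, so its hyperplanes include
  \<open>x \<bullet> hsum \<Delta> = a\<close>. Subtracting this from the equation with normal
  \<open>hsum \<Delta> - hsum I\<close> leaves a prescribed pairing with \<open>hsum I\<close>; for
  \<Delta> the value agrees by \<open>eps_top\<close>.\<close>

definition on_vertex :: "'a set set \<Rightarrow> 'a \<Rightarrow> bool" where
  "on_vertex N x \<longleftrightarrow> (\<forall>I\<in>N. x \<bullet> hsum I = \<epsilon> (card I))"

text \<open>Growth of \<open>\<epsilon>\<close> by powers of two lets all children together contribute at most half of
  \<open>\<epsilon> (card I)\<close>; the other half is left for the owned root.\<close>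

lemma on_vertex_node:
  assumes N: "maximal_nested_index N" and x: "on_vertex N x" and "I \<in> N"
  shows "\<epsilon> (card I) / 2 \<le> coef (hsum I) (root_of N I) * (x \<bullet> root_of N I) \<and> (\<forall>\<beta>\<in>I. 0 < x \<bullet> \<beta>)"
  using \<open>I \<in> N\<close>
proof (induction "card I" arbitrary: I rule: less_induct)
  case less
  note I = less.prems
  let ?r = "root_of N I"
  note nN = maximal_nestedD[OF N]
  have bN: "K \<in> bld" if "K \<in> N" for K using that nested_indexD[OF nN] by auto
  have eI: "0 < \<epsilon> (card I)" using eps_pos bld_card[OF bN[OF I]] by simp
  have ch: "0 < x \<bullet> \<beta>" if "J \<in> children N I" "\<beta> \<in> J" for J \<beta>
  proof -
    have "card J < card I" using childrenD(2)[OF that(1)] bld_finite[OF bN[OF I]] by (intro psubset_card_mono)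
    then show ?thesis using less.hyps[of J] childrenD(1)[OF that(1)] that(2) by blast
  qed
  have part: "(\<Sum>\<beta>\<in>J. coef (hsum I) \<beta> * (x \<bullet> \<beta>)) \<le> \<epsilon> (card I) / 2 ^ card I * 2 ^ card J"
    if J: "J \<in> children N I" for J
  proof -
    note Jb = bN[OF childrenD(1)[OF J]]
    have eJ: "0 < \<epsilon> (card J)" using eps_pos bld_card[OF Jb] by simp
    have le: "card J \<le> card I" using childrenD(2)[OF J] bld_finite[OF bN[OF I]] by (intro card_mono) auto
    have "2 ^ (card I - card J) * \<epsilon> (card J) * (\<Sum>\<beta>\<in>J. coef (hsum I) \<beta> * (x \<bullet> \<beta>))
        = (\<Sum>\<beta>\<in>J. (2 ^ (card I - card J) * coef (hsum I) \<beta> * \<epsilon> (card J)) * (x \<bullet> \<beta>))"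
      by (simp add: sum_distrib_left algebra_simps)
    also have "\<dots> \<le> (\<Sum>\<beta>\<in>J. (coef (hsum J) \<beta> * \<epsilon> (card I)) * (x \<bullet> \<beta>))"
      using coef_ratio[OF Jb bN[OF I]] childrenD(2)[OF J] ch[OF J]
      by (intro sum_mono mult_right_mono) (auto simp: less_imp_le)
    also have "\<dots> = \<epsilon> (card I) * (\<Sum>\<beta>\<in>J. coef (hsum J) \<beta> * (x \<bullet> \<beta>))"
      by (simp add: sum_distrib_left algebra_simps)
    also have "(\<Sum>\<beta>\<in>J. coef (hsum J) \<beta> * (x \<bullet> \<beta>)) = \<epsilon> (card J)"
      using x childrenD(1)[OF J] hsum_inner[OF bld_subset[OF Jb], of x] by (simp add: on_vertex_def)
    finally have "2 ^ (card I - card J) * (\<Sum>\<beta>\<in>J. coef (hsum I) \<beta> * (x \<bullet> \<beta>)) * \<epsilon> (card J)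
        \<le> \<epsilon> (card I) * \<epsilon> (card J)" by (simp add: algebra_simps)
    then have "2 ^ (card I - card J) * (\<Sum>\<beta>\<in>J. coef (hsum I) \<beta> * (x \<bullet> \<beta>)) \<le> \<epsilon> (card I)"
      using eJ by simp
    moreover have "(2::real) ^ card I = 2 ^ (card I - card J) * 2 ^ card J"
      using le by (simp flip: power_add)
    ultimately show ?thesis by (simp add: field_simps)
  qed
  \<comment> \<open>The one extra root of I over its children is the source of the factor 1/2
    below.\<close>
  have cardI: "card I = Suc (\<Sum>J\<in>children N I. card J)"
    using sum_over_node[OF N I, of "\<lambda>_. 1::nat"] by simp
  have "(\<Sum>J\<in>children N I. \<Sum>\<beta>\<in>J. coef (hsum I) \<beta> * (x \<bullet> \<beta>))
      \<le> (\<Sum>J\<in>children N I. \<epsilon> (card I) / 2 ^ card I * 2 ^ card J)"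
    using part by (rule sum_mono)
  also have "\<dots> = \<epsilon> (card I) / 2 ^ card I * (\<Sum>J\<in>children N I. 2 ^ card J)"
    by (simp add: sum_distrib_left)
  also have "\<dots> \<le> \<epsilon> (card I) / 2 ^ card I * 2 ^ (\<Sum>J\<in>children N I. card J)"
    using eI finite_children[OF nN] childrenD(1) bN bld_card
    by (intro mult_left_mono sum_power2_le) auto
  also have "\<dots> = \<epsilon> (card I) / 2" using cardI by simp
  finally have half: "(\<Sum>J\<in>children N I. \<Sum>\<beta>\<in>J. coef (hsum I) \<beta> * (x \<bullet> \<beta>)) \<le> \<epsilon> (card I) / 2" .
  have "\<epsilon> (card I) = (\<Sum>\<beta>\<in>I. coef (hsum I) \<beta> * (x \<bullet> \<beta>))"
    using x I hsum_inner[OF bld_subset[OF bN[OF I]], of x] by (simp add: on_vertex_def)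
  also have "\<dots> = coef (hsum I) ?r * (x \<bullet> ?r) + (\<Sum>J\<in>children N I. \<Sum>\<beta>\<in>J. coef (hsum I) \<beta> * (x \<bullet> \<beta>))"
    by (rule sum_over_node[OF N I])
  finally have r: "\<epsilon> (card I) / 2 \<le> coef (hsum I) ?r * (x \<bullet> ?r)" using half by linarith
  then have "0 < coef (hsum I) ?r * (x \<bullet> ?r)" using eI by linarith
  then have "0 < x \<bullet> ?r"
    using coef_hsum_pos[OF node_in_simple[OF N I] root_of_mem[OF N I]] by (simp add: zero_less_mult_iff)
  then have "0 < x \<bullet> \<beta>" if "\<beta> \<in> I" for \<beta>
    using that ch by (auto elim: node_cases[OF N I])
  then show ?case using r by blast
qed

text \<open>Let I be the least node containing K. If K is proper in I, the single term of the root
  owned by I is already large enough: that root carries at least half of the level of I, and the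
  ratio bound across a gap of at least one returns the factor 2.\<close>

lemma on_vertex_feasible:
  assumes N: "maximal_nested_index N" and x: "on_vertex N x" and K: "K \<in> bld"
  shows "\<epsilon> (card K) \<le> x \<bullet> hsum K"
proof -
  note nN = maximal_nestedD[OF N]
  have pos: "0 < x \<bullet> \<beta>" if "\<beta> \<in> \<Delta>" for \<beta>
    using on_vertex_node[OF N x maximal_nested_top[OF N]] that by blast
  obtain I where I: "I \<in> N" "K \<subseteq> I" and least: "\<forall>J\<in>N. K \<subseteq> J \<longrightarrow> I \<subseteq> J"
    using nested_index_least[OF nN bld_nonempty[OF K] maximal_nested_top[OF N] bld_subset[OF K]] .
  have Ib: "I \<in> bld" using I nested_indexD[OF nN] by auto
  let ?r = "root_of N I"
  show ?thesis
  proof (cases "K = I")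
    case True
    then show ?thesis using x I by (simp add: on_vertex_def)
  next
    case False
    \<comment> \<open>Otherwise the children meeting K would cover K and have their union in
      \<open>bld\<close>. Nestedness would leave only one such child, which would contain K and
      contradict the choice of I.\<close>
    have r: "?r \<in> K"
    proof (rule ccontr)
      assume "?r \<notin> K"
      then have cov: "K \<subseteq> \<Union>(children N I)"
        using node_cases[OF N I(1)] I(2) by (metis UnionI subsetD subsetI)
      define T where "T = {J \<in> children N I. J \<inter> K \<noteq> {}}"
      have KT: "K \<subseteq> \<Union>T" using cov by (auto simp: T_def)
      have fT: "finite T" using finite_children[OF nN] by (simp add: T_def)
      have TN: "T \<subseteq> N" using childrenD(1) by (auto simp: T_def)
      have "antichain T" by (rule children_antichain[of _ N I]) (auto simp: T_def)
      moreover have "K \<union> \<Union>T \<in> bld"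
        using TN nested_indexD[OF nN] by (intro bld_Union_meet[OF fT _ K]) (auto simp: T_def)
      then have "\<Union>T \<in> bld" using KT by (simp add: Un_absorb1)
      ultimately have "\<not> 2 \<le> card T" using nested_index_Union[OF nN TN] by blast
      moreover have "T \<noteq> {}" using KT bld_nonempty[OF K] by auto
      ultimately obtain J where "T = {J}"
        using card_ge_2_iff[OF fT] by (metis is_singletonI' is_singletonE)
      then have "K \<subseteq> J" "J \<in> children N I" using KT by (auto simp: T_def)
      then show False using least childrenD[of J N I] by blast
    qed
    have le: "card K < card I" using False I(2) bld_finite[OF Ib] by (intro psubset_card_mono) auto
    have eI: "0 < \<epsilon> (card I)" "0 < \<epsilon> (card K)" using eps_pos bld_card Ib K by auto
    have cr: "0 < coef (hsum I) ?r" using coef_hsum_pos[OF bld_subset[OF Ib]] r I by auto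
    have xr: "0 < x \<bullet> ?r" using pos r bld_subset[OF K] by auto
    have "(2::real) ^ 1 \<le> 2 ^ (card I - card K)" using le by (intro power_increasing) auto
    then have "2 * (coef (hsum I) ?r * \<epsilon> (card K)) \<le> 2 ^ (card I - card K) * (coef (hsum I) ?r * \<epsilon> (card K))"
      using cr eI by (intro mult_right_mono) auto
    also have "\<dots> \<le> coef (hsum K) ?r * \<epsilon> (card I)"
      using coef_ratio[OF K Ib I(2) r] by (simp add: algebra_simps)
    finally have "(2 * (coef (hsum I) ?r * \<epsilon> (card K))) * (x \<bullet> ?r) \<le> (coef (hsum K) ?r * \<epsilon> (card I)) * (x \<bullet> ?r)"
      using xr by (intro mult_right_mono) auto
    moreover have "\<epsilon> (card I) / 2 * (2 * \<epsilon> (card K)) \<le> (coef (hsum I) ?r * (x \<bullet> ?r)) * (2 * \<epsilon> (card K))"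
      using on_vertex_node[OF N x I(1)] eI by (intro mult_right_mono) auto
    ultimately have "\<epsilon> (card K) * \<epsilon> (card I) \<le> (coef (hsum K) ?r * (x \<bullet> ?r)) * \<epsilon> (card I)"
      by (simp add: algebra_simps)
    then have "\<epsilon> (card K) \<le> coef (hsum K) ?r * (x \<bullet> ?r)" using eI by simp
    also have "\<dots> \<le> (\<Sum>\<beta>\<in>K. coef (hsum K) \<beta> * (x \<bullet> \<beta>))"
    proof (rule member_le_sum)
      fix \<beta> assume "\<beta> \<in> K - {?r}"
      then have "\<beta> \<in> \<Delta>" using bld_subset[OF K] by auto
      then show "0 \<le> coef (hsum K) \<beta> * (x \<bullet> \<beta>)"
        using pos[of \<beta>] coef_hsum_nonneg[of \<beta> K] by simp
    qed (use r bld_finite[OF K] in auto)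
    finally show ?thesis using hsum_inner[OF bld_subset[OF K], of x] by simp
  qed
qed

end

section \<open>Antichain covers and nested decompositions\<close>

text \<open>Weak LP duality for fractional antichain covers: peel off the maximal elements of the support
  of \<open>w\<close>. Every maximal chain meets them, so all chain weights drop together.\<close>

lemma antichain_chain_bound:
  fixes w y :: "'b set \<Rightarrow> real"
  assumes "finite N" "\<And>J. J \<in> N \<Longrightarrow> 0 \<le> w J"
    and anti: "\<And>T. T \<subseteq> N \<Longrightarrow> antichain T \<Longrightarrow> sum y T \<le> d"
    and chain: "\<And>C. C \<subseteq> N \<Longrightarrow> (\<forall>A\<in>C. \<forall>B\<in>C. A \<subseteq> B \<or> B \<subseteq> A) \<Longrightarrow> sum w C \<le> t"
  shows "(\<Sum>J\<in>N. w J * y J) \<le> t * d"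
  using assms(2) chain
proof (induction "card {J \<in> N. 0 < w J}" arbitrary: w t rule: less_induct)
  case less
  define S where "S = {J \<in> N. 0 < w J}"
  have SN: "S \<subseteq> N" and fS: "finite S" using assms(1) by (auto simp: S_def)
  show ?case
  proof (cases "S = {}")
    case True
    then have "w J = 0" if "J \<in> N" for J using less.prems(1)[OF that] that by (force simp: S_def)
    then have "(\<Sum>J\<in>N. w J * y J) = 0" by simp
    \<comment> \<open>Both signs come from the hypotheses for the empty chain and the empty
      antichain.\<close>
    moreover have "0 \<le> t" "0 \<le> d"
      using less.prems(2)[of "{}"] anti[of "{}"] by (auto simp: antichain_def)
    ultimately show ?thesis by simp
  next
    case False
    define M where "M = maximal_in S UNIV"
    have MS: "M \<subseteq> S" by (auto simp: M_def maximal_in_def)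
    have above: "\<exists>m\<in>M. J \<subseteq> m" if "J \<in> S" for J
      using maximal_in_above[OF fS that, of UNIV] unfolding M_def by auto
    have M: "finite M" "M \<noteq> {}" using finite_subset[OF MS fS] False above by auto
    have MN: "M \<subseteq> N" using MS SN by simp
    \<comment> \<open>Lowering the weights on M by the least of them keeps all weights nonnegative
      and removes \<open>m0\<close> from the support, so the induction measure drops.\<close>
    define \<theta> where "\<theta> = Min (w ` M)"
    have "\<theta> \<in> w ` M" unfolding \<theta>_def using M by (intro Min_in) auto
    then obtain m0 where m0: "m0 \<in> M" "w m0 = \<theta>" by auto
    have th: "0 < \<theta>" using m0 MS by (auto simp: S_def)
    have th_le: "\<theta> \<le> w m" if "m \<in> M" for m unfolding \<theta>_def using M that by (intro Min_le) auto
    define w' where "w' J = (if J \<in> M then w J - \<theta> else w J)" for J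
    have split: "(\<Sum>J\<in>C. w J * f J) = (\<Sum>J\<in>C. w' J * f J) + \<theta> * sum f (C \<inter> M)" if "finite C" for C f
    proof -
      have "(\<Sum>J\<in>C. w J * f J) = (\<Sum>J\<in>C. w' J * f J + (if J \<in> M then \<theta> * f J else 0))"
        by (intro sum.cong) (auto simp: w'_def algebra_simps)
      also have "\<dots> = (\<Sum>J\<in>C. w' J * f J) + (\<Sum>J\<in>C \<inter> M. \<theta> * f J)"
        using that by (simp add: sum.distrib sum.inter_restrict)
      finally show ?thesis by (simp add: sum_distrib_left)
    qed
    have "(\<Sum>J\<in>N. w' J * y J) \<le> (t - \<theta>) * d"
    proof (rule less.hyps)
      have "{J \<in> N. 0 < w' J} \<subset> S"
      proof
        show "{J \<in> N. 0 < w' J} \<subseteq> S" using th by (auto simp: w'_def S_def split: if_splits)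
        have "m0 \<in> S" "\<not> 0 < w' m0" using m0 MS by (auto simp: w'_def)
        then show "{J \<in> N. 0 < w' J} \<noteq> S" by auto
      qed
      then show "card {J \<in> N. 0 < w' J} < card {J \<in> N. 0 < w J}"
        using psubset_card_mono[OF fS] by (simp add: S_def)
      show "0 \<le> w' J" if "J \<in> N" for J using less.prems(1)[OF that] th_le by (simp add: w'_def)
      fix C assume C: "C \<subseteq> N" "\<forall>A\<in>C. \<forall>B\<in>C. A \<subseteq> B \<or> B \<subseteq> A"
      have fC: "finite C" using C(1) assms(1) by (rule finite_subset)
      have wC: "sum w C = sum w' C + \<theta> * card (C \<inter> M)" using split[OF fC, of "\<lambda>_. 1"] by simp
      show "sum w' C \<le> t - \<theta>"
      proof (cases "C \<inter> M = {}")
        case False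
        then have "1 \<le> real (card (C \<inter> M))" using fC by (simp add: Suc_le_eq card_gt_0_iff)
        then have "\<theta> * 1 \<le> \<theta> * real (card (C \<inter> M))" using th by (intro mult_left_mono) auto
        then show ?thesis using wC less.prems(2)[OF C] by simp
      next
        case True
        define D where "D = C \<inter> S"
        \<comment> \<open>A chain missing M still leaves room for \<theta>: its part in the support
          lies below some m in M, and adding m to that part gives a chain of weight at most
          t.\<close>
        have "\<exists>m\<in>M. \<forall>J\<in>D. J \<subseteq> m"
        proof (cases "D = {}")
          case False
          have "finite D" using fC by (simp add: D_def)
          from finite_has_maximal[OF this False] obtain c
            where c: "c \<in> D" "\<forall>J\<in>D. c \<subseteq> J \<longrightarrow> c = J" by auto
          then have "J \<subseteq> c" if "J \<in> D" for J using that C(2) unfolding D_def by blast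
          moreover obtain m where "m \<in> M" "c \<subseteq> m" using above[of c] c(1) by (auto simp: D_def)
          ultimately show ?thesis by blast
        qed (use M in auto)
        then obtain m where m: "m \<in> M" "\<forall>J\<in>D. J \<subseteq> m" by auto
        have "sum w (insert m D) \<le> t"
        proof (rule less.prems(2))
          show "insert m D \<subseteq> N" using m(1) MN C(1) by (auto simp: D_def)
          show "\<forall>A\<in>insert m D. \<forall>B\<in>insert m D. A \<subseteq> B \<or> B \<subseteq> A"
            using m(2) C(2) unfolding D_def by blast
        qed
        moreover have "m \<notin> D" using True m(1) by (auto simp: D_def)
        then have "sum w (insert m D) = w m + sum w D" using fC by (simp add: D_def)
        moreover have "sum w C = sum w D"
        proof (rule sum.mono_neutral_right[OF fC])
          show "\<forall>J\<in>C - D. w J = 0" using C(1) less.prems(1) by (force simp: D_def S_def)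
        qed (auto simp: D_def)
        ultimately show ?thesis using wC True th_le[OF m(1)] by simp
      qed
    qed
    moreover have "sum y M \<le> d"
    proof (rule anti[OF MN])
      show "antichain M"
        unfolding antichain_def pairwise_def
      proof (intro ballI impI)
        fix A B assume "A \<in> M" "B \<in> M" "A \<noteq> B"
        then show "\<not> A \<subseteq> B \<and> \<not> B \<subseteq> A" unfolding M_def maximal_in_def by auto
      qed
    qed
    then have "\<theta> * sum y M \<le> \<theta> * d" using th by simp
    moreover have "N \<inter> M = M" using MN by auto
    ultimately show ?thesis using split[OF assms(1), of y] by (simp add: algebra_simps)
  qed
qed

context simple_building_set
begin

text \<open>Greedy: subtract from \<open>u\<close> the largest possible multiple of the half sum of one component of its
  support.\<close>

lemma nested_decomposition:
  assumes "\<And>\<beta>. \<beta> \<in> \<Delta> \<Longrightarrow> 0 \<le> coef u \<beta>"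
  shows "\<exists>N w. nested_index N \<and> (\<forall>J\<in>N. 0 \<le> w J) \<and> u = (\<Sum>J\<in>N. w J *\<^sub>R hsum J) \<and>
    \<Union>N \<subseteq> {\<beta>\<in>\<Delta>. coef u \<beta> \<noteq> 0}"
  using assms
proof (induction "card {\<beta>\<in>\<Delta>. coef u \<beta> \<noteq> 0}" arbitrary: u rule: less_induct)
  case less
  define U where "U = {\<beta>\<in>\<Delta>. coef u \<beta> \<noteq> 0}"
  have U: "U \<subseteq> \<Delta>" "finite U" by (auto simp: U_def)
  show ?case
  proof (cases "U = {}")
    case True
    then have "u = 0" by (intro coef_eqI) (auto simp: U_def)
    moreover have "nested_index {}" by (auto simp: nested_index_def)
    ultimately show ?thesis by (intro exI[of _ "{}"]) auto
  next
    case False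
    then obtain K where K: "K \<in> comps U" using comps_cover[OF U(1)] by blast
    note Kb = compsD(1)[OF K] and KU = compsD(2)[OF K]
    let ?q = "\<lambda>\<beta>. coef u \<beta> / coef (hsum K) \<beta>"
    \<comment> \<open>The largest multiple that keeps all coefficients nonnegative. It annihilates
      the coefficient at the minimising \<beta>0, so the support shrinks.\<close>
    define m where "m = Min (?q ` K)"
    have fK: "finite K" "K \<noteq> {}" using bld_finite[OF Kb] bld_nonempty[OF Kb] by auto
    have "m \<in> ?q ` K" unfolding m_def using fK by (intro Min_in) auto
    then obtain \<beta>0 where b0: "\<beta>0 \<in> K" "m = ?q \<beta>0" by auto
    have cK: "0 < coef (hsum K) \<beta>" if "\<beta> \<in> K" for \<beta> using coef_hsum_pos[OF bld_subset[OF Kb] that] .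
    have m_le: "m * coef (hsum K) \<beta> \<le> coef u \<beta>" if "\<beta> \<in> K" for \<beta>
    proof -
      have "m \<le> ?q \<beta>" unfolding m_def using fK that by (intro Min_le) auto
      then show ?thesis using cK[OF that] by (simp add: pos_le_divide_eq)
    qed
    have b0D: "\<beta>0 \<in> \<Delta>" using b0 KU U by auto
    have m0: "0 \<le> m" using b0 cK[OF b0(1)] less.prems[OF b0D] by simp
    define u' where "u' = u - m *\<^sub>R hsum K"
    have outside: "coef u' \<beta> = coef u \<beta>" if "\<beta> \<in> \<Delta>" "\<beta> \<notin> K" for \<beta>
      using coef_hsum_outside[OF bld_subset[OF Kb] that] by (simp add: u'_def)
    have sub: "{\<beta>\<in>\<Delta>. coef u' \<beta> \<noteq> 0} \<subseteq> U - {\<beta>0}"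
    proof
      fix \<beta> assume b: "\<beta> \<in> {\<beta>\<in>\<Delta>. coef u' \<beta> \<noteq> 0}"
      have "coef u' \<beta>0 = 0" using b0 cK[OF b0(1)] by (simp add: u'_def)
      then have "\<beta> \<noteq> \<beta>0" using b by auto
      moreover have "\<beta> \<in> U" using b outside[of \<beta>] KU by (cases "\<beta> \<in> K") (auto simp: U_def)
      ultimately show "\<beta> \<in> U - {\<beta>0}" by simp
    qed
    have "\<beta>0 \<in> U" using b0 KU by auto
    then have "card {\<beta>\<in>\<Delta>. coef u' \<beta> \<noteq> 0} < card U"
      using sub U(2) by (intro psubset_card_mono) auto
    moreover have "0 \<le> coef u' \<beta>" if "\<beta> \<in> \<Delta>" for \<beta>
      using outside[OF that] less.prems[OF that] m_le by (cases "\<beta> \<in> K") (auto simp: u'_def)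
    ultimately obtain N w where N: "nested_index N" "\<forall>J\<in>N. 0 \<le> w J"
        "u' = (\<Sum>J\<in>N. w J *\<^sub>R hsum J)" "\<Union>N \<subseteq> {\<beta>\<in>\<Delta>. coef u' \<beta> \<noteq> 0}"
      using less.hyps[of u'] unfolding U_def by blast
    have KN: "K \<notin> N" using N(4) sub b0(1) by blast
    have NU: "\<Union>N \<subseteq> U" using N(4) sub by auto
    \<comment> \<open>All members of N lie in U, where K is maximal; so no union of K with members
      incomparable to it can belong to \<open>bld\<close>.\<close>
    have "nested_index (insert K N)"
    proof (rule nested_index_insert[OF N(1) Kb])
      fix T assume T: "T \<subseteq> N" "T \<noteq> {}" "antichain (insert K T)" "K \<notin> T"
      then obtain L where L: "L \<in> T" by auto
      then have "L \<noteq> K" using T(4) by auto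
      then have LK: "\<not> L \<subseteq> K" using T(3) L unfolding antichain_def pairwise_insert by blast
      have "\<Union>T \<subseteq> U" using NU T(1) by blast
      then have "K \<union> \<Union>T \<subseteq> U" using KU by simp
      show "K \<union> \<Union>T \<notin> bld"
      proof
        assume "K \<union> \<Union>T \<in> bld"
        then have "K \<union> \<Union>T = K" using comps_maximal[OF K _ \<open>K \<union> \<Union>T \<subseteq> U\<close>] by simp
        then show False using L LK by blast
      qed
    qed
    moreover have "u = (\<Sum>J\<in>insert K N. (w(K := m)) J *\<^sub>R hsum J)"
    proof -
      have "(\<Sum>J\<in>N. (w(K := m)) J *\<^sub>R hsum J) = u'" unfolding N(3) using KN by (intro sum.cong) auto
      then show ?thesis using KN nested_index_finite[OF N(1)] by (simp add: u'_def)
    qed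
    moreover have "\<forall>J\<in>insert K N. 0 \<le> (w(K := m)) J" using N(2) m0 by simp
    moreover have "\<Union>(insert K N) \<subseteq> U" using KU NU by simp
    ultimately show ?thesis unfolding U_def by blast
  qed
qed

end

section \<open>The permutonestohedron\<close>

context simple_root_basis
begin

lemma regular_inner_pos:
  assumes "\<And>\<beta>. \<beta> \<in> \<Delta> \<Longrightarrow> 0 < x \<bullet> \<beta>" "\<gamma> \<in> pos"
  shows "0 < x \<bullet> \<gamma>"
proof -
  have "\<exists>\<beta>\<in>\<Delta>. coef \<gamma> \<beta> \<noteq> 0" using coef_eqI[of \<gamma> 0] pos_nonzero[OF assms(2)] by auto
  then obtain \<beta> where b: "\<beta> \<in> \<Delta>" "0 < coef \<gamma> \<beta>"
    using pos_coef[OF assms(2)] by (metis less_eq_real_def)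
  have "0 < (\<Sum>\<beta>\<in>\<Delta>. coef \<gamma> \<beta> * (\<beta> \<bullet> x))"
  proof (rule sum_pos2[OF finite_simple b(1)])
    show "0 < coef \<gamma> \<beta> * (\<beta> \<bullet> x)" using b assms(1) by (simp add: inner_commute)
    show "0 \<le> coef \<gamma> \<kappa> * (\<kappa> \<bullet> x)" if "\<kappa> \<in> \<Delta>" for \<kappa>
      using that assms(1)[OF that] pos_coef[OF assms(2) that] by (simp add: inner_commute)
  qed
  then show ?thesis using inner_expansion[of \<gamma> x] by (simp add: inner_commute)
qed

lemma regular_inner_nonzero:
  assumes "\<And>\<beta>. \<beta> \<in> \<Delta> \<Longrightarrow> 0 < x \<bullet> \<beta>" "\<gamma> \<in> \<Phi>"
  shows "x \<bullet> \<gamma> \<noteq> 0"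
  using pos_cases[OF assms(2)] regular_inner_pos[of x \<gamma>] regular_inner_pos[of x "- \<gamma>"] assms(1)
  by fastforce

lemma weyl_inner_swap:
  assumes "\<sigma> \<in> weyl_group \<Phi>" "\<And>x. \<tau> (\<sigma> x) = x" "\<And>x. \<sigma> (\<tau> x) = x"
  shows "\<sigma> x \<bullet> y = x \<bullet> \<tau> y"
  using weyl_inner[OF assms(1), of x "\<tau> y"] assms(3) by simp

end

context suitable_building_set
begin

section \<open>Half-spaces as bounds on pairings with half sums\<close>

definition eps_sum :: "'a set \<Rightarrow> real" where "eps_sum I = (\<Sum>J\<in>comps I. \<epsilon> (card J))"

text \<open>\<open>HS\<close> and \<open>HS_bar\<close> merge into one family over all proper
  nonempty I, because a member of \<open>bld\<close> is its own only component.\<close>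

definition facet_bounds :: "'a \<Rightarrow> bool" where
  "facet_bounds z \<longleftrightarrow> z \<bullet> hsum \<Delta> \<le> a \<and>
    (\<forall>I. I \<subset> \<Delta> \<and> I \<noteq> {} \<longrightarrow> z \<bullet> (hsum \<Delta> - hsum I) \<le> a - eps_sum I)"

lemma eps_sum_bld: "I \<in> bld \<Longrightarrow> eps_sum I = \<epsilon> (card I)"
  by (simp add: eps_sum_def comps_bld)

lemma hsum_UNIV: "half_sum \<Phi> \<Delta> UNIV = hsum \<Delta>"
  by (simp add: hsum_def span_simple)

text \<open>On the hyperplane of \<Delta>, the upper bound for the normal
  \<open>hsum \<Delta> - hsum I\<close> becomes a lower bound for \<open>hsum I\<close>; the bound
  for \<Delta> itself holds with equality.\<close>

lemma nestohedron_iff: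
  "x \<in> fund_nestohedron \<Phi> \<Delta> \<G> \<epsilon> a \<longleftrightarrow>
    x \<bullet> hsum \<Delta> = a \<and> (\<forall>I\<in>bld. \<epsilon> (card I) \<le> x \<bullet> hsum I)"
proof -
  have HS: "x \<in> HS \<Phi> \<Delta> \<epsilon> a (span I) \<longleftrightarrow> \<epsilon> (card I) \<le> x \<bullet> hsum I"
    if "I \<in> bld - {\<Delta>}" "x \<bullet> hsum \<Delta> = a" for I
    using that bld_subset[of I]
    by (simp add: HS_def delta_def level_def span_eq_UNIV_iff hsum_UNIV dim_simple
        inner_diff_right flip: hsum_def)
  have H: "x \<in> H \<Phi> \<Delta> \<epsilon> a UNIV \<longleftrightarrow> x \<bullet> hsum \<Delta> = a"
    by (simp add: H_def delta_def level_def hsum_UNIV)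
  have "inj_on span bld" using inj_on_span bld_subset by (metis Pow_iff subsetI)
  then have f: "fund_building \<Delta> \<G> - {UNIV} = span ` (bld - {\<Delta>})"
    using inj_on_image_set_diff[of span bld bld "{\<Delta>}"] bld_simple span_simple
    by (simp add: fund_building_eq)
  have "x \<in> fund_nestohedron \<Phi> \<Delta> \<G> \<epsilon> a \<longleftrightarrow>
      x \<bullet> hsum \<Delta> = a \<and> (\<forall>I\<in>bld - {\<Delta>}. x \<in> HS \<Phi> \<Delta> \<epsilon> a (span I))"
    unfolding fund_nestohedron_def f Int_iff H by simp
  also have "\<dots> \<longleftrightarrow> x \<bullet> hsum \<Delta> = a \<and> (\<forall>I\<in>bld - {\<Delta>}. \<epsilon> (card I) \<le> x \<bullet> hsum I)"
    using HS by (intro conj_cong ball_cong) simp_all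
  also have "\<dots> \<longleftrightarrow> x \<bullet> hsum \<Delta> = a \<and> (\<forall>I\<in>bld. \<epsilon> (card I) \<le> x \<bullet> hsum I)"
    using eps_top by fastforce
  finally show ?thesis .
qed

text \<open>The line of \<beta> belongs to the building set and its half sum is half of \<beta>, so
  the bound for dimension 1 forces a positive pairing.\<close>

lemma nestohedron_regular:
  assumes "x \<in> fund_nestohedron \<Phi> \<Delta> \<G> \<epsilon> a" "\<beta> \<in> \<Delta>"
  shows "0 < x \<bullet> \<beta>"
proof -
  have "\<epsilon> 1 \<le> x \<bullet> hsum {\<beta>}" using assms nestohedron_iff bld_singleton[OF assms(2)] by fastforce
  moreover have "0 < \<epsilon> 1" by (rule eps_pos) simp_all
  ultimately show ?thesis by (simp add: hsum_singleton[OF assms(2)])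
qed

lemma nestohedron_dominant: "x \<in> fund_nestohedron \<Phi> \<Delta> \<G> \<epsilon> a \<Longrightarrow> dominant x"
  using nestohedron_regular by (auto simp: dominant_def less_imp_le)

lemma nestohedron_eps_sum:
  assumes "x \<in> fund_nestohedron \<Phi> \<Delta> \<G> \<epsilon> a" "I \<subseteq> \<Delta>"
  shows "eps_sum I \<le> x \<bullet> hsum I"
  unfolding eps_sum_def hsum_comps[OF assms(2)] inner_sum_right
  using assms(1) compsD(1) by (intro sum_mono) (auto simp: nestohedron_iff)

lemma on_vertex_in_nestohedron:
  assumes N: "maximal_nested_index N" and x: "on_vertex N x"
  shows "x \<in> fund_nestohedron \<Phi> \<Delta> \<G> \<epsilon> a"
  using on_vertex_feasible[OF N x] x maximal_nested_top[OF N] eps_top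
  by (auto simp: nestohedron_iff on_vertex_def)

lemma on_vertex_exists: "maximal_nested_index N \<Longrightarrow> \<exists>x. on_vertex N x"
  using node_values_exist[of N "\<lambda>I. \<epsilon> (card I)"] by (simp add: on_vertex_def)

lemma on_vertex_unique: "maximal_nested_index N \<Longrightarrow> on_vertex N x \<Longrightarrow> on_vertex N y \<Longrightarrow> x = y"
  using node_values_unique[of N x y] by (simp add: on_vertex_def)

lemma maximal_nested_exists: "\<exists>N. maximal_nested_index N"
proof -
  have "nested_index {}" by (auto simp: nested_index_def)
  then show ?thesis using nested_index_extend by metis
qed

lemma nestohedron_nonempty: "fund_nestohedron \<Phi> \<Delta> \<G> \<epsilon> a \<noteq> {}"
  using maximal_nested_exists on_vertex_exists on_vertex_in_nestohedron by blast

text \<open>Any point of the nestohedron witnesses the inequality. It makes the levels in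
  \<open>HS_bar\<close> nonnegative, which selects the first branch of that definition.\<close>

lemma eps_sum_le:
  assumes "I \<subseteq> \<Delta>"
  shows "eps_sum I \<le> a"
proof -
  obtain x where x: "x \<in> fund_nestohedron \<Phi> \<Delta> \<G> \<epsilon> a" using nestohedron_nonempty by blast
  have "eps_sum I \<le> x \<bullet> hsum I" using nestohedron_eps_sum[OF x assms] .
  also have "\<dots> \<le> x \<bullet> hsum \<Delta>"
    using dominant_inner_hsum_nonneg[OF assms nestohedron_dominant[OF x]] by (simp add: inner_diff_right)
  also have "\<dots> = a" using x by (simp add: nestohedron_iff)
  finally show ?thesis .
qed

lemma HS_top: "HS \<Phi> \<Delta> \<epsilon> a (span \<Delta>) = {x. x \<bullet> hsum \<Delta> \<le> a}"
  by (simp add: HS_def delta_def level_def hsum_UNIV span_simple)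

lemma HS_bld:
  assumes "I \<in> bld" "I \<noteq> \<Delta>"
  shows "HS \<Phi> \<Delta> \<epsilon> a (span I) = {x. x \<bullet> (hsum \<Delta> - hsum I) \<le> a - eps_sum I}"
  using assms bld_subset[OF assms(1)]
  by (simp add: HS_def delta_def level_def hsum_UNIV span_eq_UNIV_iff dim_simple
      eps_sum_bld flip: hsum_def)

lemma HS_bar_not_bld:
  assumes I: "I \<subseteq> \<Delta>"
  shows "HS_bar \<Phi> \<Delta> \<G> \<epsilon> a (span I) = {x. x \<bullet> (hsum \<Delta> - hsum I) \<le> a - eps_sum I}"
proof -
  have inj: "inj_on span (comps I)" using inj_on_span comps_Pow by blast
  have "(\<Sum>A\<in>span ` comps I. half_sum \<Phi> \<Delta> A) = hsum I"
    unfolding hsum_comps[OF I] sum.reindex[OF inj] by (simp add: hsum_def)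
  then have d: "delta_bar \<Phi> \<Delta> \<G> (span I) = hsum \<Delta> - hsum I"
    by (simp add: delta_bar_def hsum_UNIV maximal_fund_building[OF I])
  have "(\<Sum>A\<in>span ` comps I. \<epsilon> (dim A)) = eps_sum I"
    unfolding eps_sum_def sum.reindex[OF inj] using comps_Pow[of I]
    by (intro sum.cong refl) (auto simp: dim_simple)
  then have "level_bar \<Delta> \<G> \<epsilon> a (span I) = a - eps_sum I"
    by (simp add: level_bar_def maximal_fund_building[OF I])
  then show ?thesis using eps_sum_le[OF I] d by (simp add: HS_bar_def)
qed

lemma facet_bounds_eq:
  "{z. facet_bounds z} = (\<Inter>A \<in> fund_building \<Delta> \<G>. HS \<Phi> \<Delta> \<epsilon> a A) \<inter>
    (\<Inter>B \<in> fund_subspaces \<Delta> - fund_building \<Delta> \<G>. HS_bar \<Phi> \<Delta> \<G> \<epsilon> a B)"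
proof -
  have f: "fund_subspaces \<Delta> - fund_building \<Delta> \<G> = span ` {I. I \<subseteq> \<Delta> \<and> I \<noteq> {} \<and> I \<notin> bld}"
  proof -
    have inj: "inj_on span (Pow \<Delta>)" using inj_on_span by simp
    have b: "bld \<subseteq> Pow \<Delta>" using bld_subset by blast
    have "fund_subspaces \<Delta> = span ` {I. I \<subseteq> \<Delta> \<and> I \<noteq> {}}"
      unfolding fund_subspaces_def by (simp add: setcompr_eq_image)
    moreover have "{I. I \<subseteq> \<Delta> \<and> I \<noteq> {}} - bld = {I. I \<subseteq> \<Delta> \<and> I \<noteq> {} \<and> I \<notin> bld}" by auto
    moreover have "{I. I \<subseteq> \<Delta> \<and> I \<noteq> {}} - bld \<subseteq> Pow \<Delta>" by auto
    ultimately show ?thesis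
      using inj_on_image_set_diff[OF inj _ b, of "{I. I \<subseteq> \<Delta> \<and> I \<noteq> {}}"] by (simp add: fund_building_eq)
  qed
  have E: "facet_bounds z \<longleftrightarrow> (\<forall>I\<in>bld. z \<in> HS \<Phi> \<Delta> \<epsilon> a (span I)) \<and>
      (\<forall>I. I \<subseteq> \<Delta> \<and> I \<noteq> {} \<and> I \<notin> bld \<longrightarrow> z \<in> HS_bar \<Phi> \<Delta> \<G> \<epsilon> a (span I))" (is "_ \<longleftrightarrow> ?A \<and> ?B") for z
  proof
    assume *: "facet_bounds z"
    have ?A
    proof
      fix I assume I: "I \<in> bld"
      show "z \<in> HS \<Phi> \<Delta> \<epsilon> a (span I)"
        using * I bld_subset[OF I] bld_nonempty[OF I]
        by (cases "I = \<Delta>") (auto simp: HS_top HS_bld facet_bounds_def)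
    qed
    moreover have ?B
      using * bld_simple by (auto simp: HS_bar_not_bld facet_bounds_def)
    ultimately show "?A \<and> ?B" by blast
  next
    assume *: "?A \<and> ?B"
    have "z \<bullet> (hsum \<Delta> - hsum I) \<le> a - eps_sum I" if I: "I \<subset> \<Delta>" "I \<noteq> {}" for I
      using * I HS_bld[of I] HS_bar_not_bld[of I] by (cases "I \<in> bld") auto
    moreover have "z \<bullet> hsum \<Delta> \<le> a" using * bld_simple HS_top by auto
    ultimately show "facet_bounds z" by (simp add: facet_bounds_def)
  qed
  show ?thesis unfolding f unfolding fund_building_eq by (rule set_eqI) (simp add: E)
qed

lemma weyl_image_iff:
  assumes "\<tau> \<in> weyl_group \<Phi>" "\<And>x. \<tau> (\<sigma> x) = x" "\<And>x. \<sigma> (\<tau> x) = x"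
  shows "x \<in> \<tau> ` X \<longleftrightarrow> \<sigma> x \<in> X"
  using assms(2,3) by (metis image_iff)

lemma permutonestohedron_eq:
  "permutonestohedron \<Phi> \<Delta> \<G> \<epsilon> a = (\<Inter>\<sigma>\<in>weyl_group \<Phi>. \<sigma> ` {z. facet_bounds z})"
proof -
  have "\<sigma> ` {z. facet_bounds z} = (\<Inter>A \<in> fund_building \<Delta> \<G>. \<sigma> ` HS \<Phi> \<Delta> \<epsilon> a A) \<inter>
      (\<Inter>B \<in> fund_subspaces \<Delta> - fund_building \<Delta> \<G>. \<sigma> ` HS_bar \<Phi> \<Delta> \<G> \<epsilon> a B)"
    if \<sigma>: "\<sigma> \<in> weyl_group \<Phi>" for \<sigma>
  proof -
    obtain \<tau> where \<tau>: "\<tau> \<in> weyl_group \<Phi>" "\<And>x. \<tau> (\<sigma> x) = x" "\<And>x. \<sigma> (\<tau> x) = x"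
      using weyl_inverse[OF \<sigma>] by blast
    have "x \<in> \<sigma> ` X \<longleftrightarrow> \<tau> x \<in> X" for x X using weyl_image_iff[OF \<sigma> \<tau>(3,2)] .
    then show ?thesis unfolding facet_bounds_eq by (intro set_eqI) simp
  qed
  then show ?thesis unfolding permutonestohedron_def by (intro INF_cong) simp_all
qed

lemma permutonestohedron_iff:
  "x \<in> permutonestohedron \<Phi> \<Delta> \<G> \<epsilon> a \<longleftrightarrow> (\<forall>\<sigma>\<in>weyl_group \<Phi>. facet_bounds (\<sigma> x))"
proof
  assume x: "x \<in> permutonestohedron \<Phi> \<Delta> \<G> \<epsilon> a"
  show "\<forall>\<sigma>\<in>weyl_group \<Phi>. facet_bounds (\<sigma> x)"
  proof
    fix \<sigma> assume \<sigma>: "\<sigma> \<in> weyl_group \<Phi>"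
    then obtain \<tau> where \<tau>: "\<tau> \<in> weyl_group \<Phi>" "\<And>x. \<tau> (\<sigma> x) = x" "\<And>x. \<sigma> (\<tau> x) = x"
      using weyl_inverse by blast
    have "x \<in> \<tau> ` {z. facet_bounds z}" using x \<tau>(1) by (simp add: permutonestohedron_eq)
    then show "facet_bounds (\<sigma> x)" using weyl_image_iff[OF \<tau>] by simp
  qed
next
  assume *: "\<forall>\<sigma>\<in>weyl_group \<Phi>. facet_bounds (\<sigma> x)"
  have "x \<in> \<sigma> ` {z. facet_bounds z}" if \<sigma>: "\<sigma> \<in> weyl_group \<Phi>" for \<sigma>
  proof -
    obtain \<tau> where \<tau>: "\<tau> \<in> weyl_group \<Phi>" "\<And>x. \<tau> (\<sigma> x) = x" "\<And>x. \<sigma> (\<tau> x) = x"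
      using weyl_inverse[OF \<sigma>] by blast
    then show ?thesis using weyl_image_iff[OF \<sigma> \<tau>(3,2)] * by simp
  qed
  then show "x \<in> permutonestohedron \<Phi> \<Delta> \<G> \<epsilon> a" by (simp add: permutonestohedron_eq)
qed

lemma permutonestohedron_invariant:
  assumes "x \<in> permutonestohedron \<Phi> \<Delta> \<G> \<epsilon> a" "\<sigma> \<in> weyl_group \<Phi>"
  shows "\<sigma> x \<in> permutonestohedron \<Phi> \<Delta> \<G> \<epsilon> a"
  unfolding permutonestohedron_iff
proof
  fix \<tau> assume "\<tau> \<in> weyl_group \<Phi>"
  then have "facet_bounds ((\<tau> \<circ> \<sigma>) x)"
    using assms weyl_comp unfolding permutonestohedron_iff by blast
  then show "facet_bounds (\<tau> (\<sigma> x))" by simp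
qed

lemma convex_permutonestohedron: "convex (permutonestohedron \<Phi> \<Delta> \<G> \<epsilon> a)"
proof -
  have "{z. facet_bounds z} = {z. hsum \<Delta> \<bullet> z \<le> a} \<inter>
      (\<Inter>I\<in>{I. I \<subset> \<Delta> \<and> I \<noteq> {}}. {z. (hsum \<Delta> - hsum I) \<bullet> z \<le> a - eps_sum I})"
    by (auto simp: facet_bounds_def inner_commute)
  moreover have "convex \<dots>" by (intro convex_Int convex_INT convex_halfspace_le)
  ultimately have "convex {z. facet_bounds z}" by simp
  then show ?thesis
    unfolding permutonestohedron_eq by (intro convex_INT convex_linear_image weyl_linear)
qed

text \<open>All normals are dominant, so on the orbit of the dominant point x each of them is
  maximised at x, and only x itself has to be checked.\<close>

lemma nestohedron_subset: "fund_nestohedron \<Phi> \<Delta> \<G> \<epsilon> a \<subseteq> permutonestohedron \<Phi> \<Delta> \<G> \<epsilon> a"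
proof
  fix x assume x: "x \<in> fund_nestohedron \<Phi> \<Delta> \<G> \<epsilon> a"
  have top: "x \<bullet> hsum \<Delta> = a" using x by (simp add: nestohedron_iff)
  show "x \<in> permutonestohedron \<Phi> \<Delta> \<G> \<epsilon> a"
    unfolding permutonestohedron_iff
  proof
    fix \<sigma> assume \<sigma>: "\<sigma> \<in> weyl_group \<Phi>"
    obtain \<tau> where \<tau>: "\<tau> \<in> weyl_group \<Phi>" "\<And>x. \<tau> (\<sigma> x) = x" "\<And>x. \<sigma> (\<tau> x) = x"
      using weyl_inverse[OF \<sigma>] by blast
    have le: "\<sigma> x \<bullet> \<mu> \<le> x \<bullet> \<mu>" if "dominant \<mu>" for \<mu>
      using dominant_inner_weyl_le[OF nestohedron_dominant[OF x] that \<tau>(1)]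
        weyl_inner_swap[OF \<sigma> \<tau>(2,3)] by simp
    have "dominant (hsum \<Delta>)" by (simp add: dominant_def hsum_inner_member)
    then have "\<sigma> x \<bullet> hsum \<Delta> \<le> a" using le top by metis
    moreover have "\<sigma> x \<bullet> (hsum \<Delta> - hsum I) \<le> a - eps_sum I" if "I \<subset> \<Delta>" for I
    proof -
      have I: "I \<subseteq> \<Delta>" using that by auto
      have "\<sigma> x \<bullet> (hsum \<Delta> - hsum I) \<le> x \<bullet> (hsum \<Delta> - hsum I)" by (rule le[OF dominant_hsum_diff[OF I]])
      also have "\<dots> \<le> a - eps_sum I"
        using nestohedron_eps_sum[OF x I] top by (simp add: inner_diff_right)
      finally show ?thesis .
    qed
    ultimately show "facet_bounds (\<sigma> x)" by (simp add: facet_bounds_def)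
  qed
qed

text \<open>Take \<alpha> in a minimal member A of N below the smallest member of C. A member
  avoiding \<alpha> is incomparable with A, hence orthogonal to it.\<close>

lemma nested_chain_root:
  assumes N: "nested_index N" and C: "C \<subseteq> N" "\<forall>A\<in>C. \<forall>B\<in>C. A \<subseteq> B \<or> B \<subseteq> A"
  obtains \<alpha> where "\<alpha> \<in> \<Delta>" "\<forall>J\<in>C. \<alpha> \<in> J" "\<forall>J\<in>N. \<alpha> \<notin> J \<longrightarrow> hsum J \<bullet> \<alpha> = 0"
proof (cases "N = {}")
  case True
  then show thesis using that simple_nonempty C by blast
next
  case False
  have fN: "finite N" using nested_index_finite[OF N] .
  have "\<exists>m\<in>N. \<forall>J\<in>C. m \<subseteq> J"
  proof (cases "C = {}")
    case False
    have "finite C" using C(1) fN by (rule finite_subset)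
    from finite_has_minimal[OF this False] obtain m where m: "m \<in> C" "\<forall>J\<in>C. J \<subseteq> m \<longrightarrow> m = J" by auto
    then have "m \<subseteq> J" if "J \<in> C" for J using that C(2) by blast
    then show ?thesis using m(1) C(1) by blast
  qed (use False in auto)
  then obtain m where m: "m \<in> N" "\<forall>J\<in>C. m \<subseteq> J" by blast
  from finite_has_minimal2[OF fN m(1)] obtain A
    where A: "A \<in> N" "A \<subseteq> m" "\<forall>J\<in>N. J \<subseteq> A \<longrightarrow> A = J" by auto
  have Ab: "A \<in> bld" using A(1) nested_indexD[OF N] by auto
  obtain \<alpha> where \<alpha>: "\<alpha> \<in> A" using bld_nonempty[OF Ab] by blast
  have "hsum J \<bullet> \<alpha> = 0" if J: "J \<in> N" "\<alpha> \<notin> J" for J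
  proof (rule hsum_inner_orthogonal)
    show "J \<subseteq> \<Delta>" using J(1) nested_indexD[OF N] bld_subset by auto
    have "\<not> A \<subseteq> J" "\<not> J \<subseteq> A" using \<alpha> J A(3) by auto
    then show "\<beta> \<bullet> \<alpha> = 0" if "\<beta> \<in> J" for \<beta>
      using nested_index_orthogonal[OF N J(1) A(1)] that \<alpha> by blast
  qed
  then show thesis using that[of \<alpha>] \<alpha> m(2) A(2) bld_subset[OF Ab] by blast
qed

text \<open>At a vertex of any maximal nested set containing \<open>N0\<close>, the pairing with
  \<mu> is \<open>t * a - (\<Sum>J\<in>N0. w J * \<epsilon> (card J))\<close>. The antichain cover
  shows that this number bounds \<open>z \<bullet> \<mu>\<close>.\<close>

lemma dominant_bound:
  assumes z: "facet_bounds z" and \<mu>: "dominant \<mu>"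
  obtains N where "maximal_nested_index N" "\<And>p. on_vertex N p \<Longrightarrow> z \<bullet> \<mu> \<le> p \<bullet> \<mu>"
proof -
  let ?q = "\<lambda>\<beta>. coef \<mu> \<beta> / coef (hsum \<Delta>) \<beta>"
  have c: "0 < coef (hsum \<Delta>) \<beta>" if "\<beta> \<in> \<Delta>" for \<beta> using coef_hsum_pos that by simp
  \<comment> \<open>The least number for which \<open>t *\<^sub>R hsum \<Delta> - \<mu>\<close> has
    nonnegative coefficients; the one at \<beta>0 is then zero.\<close>
  define t where "t = Max (?q ` \<Delta>)"
  have "t \<in> ?q ` \<Delta>" unfolding t_def using simple_nonempty by (intro Max_in) auto
  then obtain \<beta>0 where b0: "\<beta>0 \<in> \<Delta>" "t = ?q \<beta>0" by auto
  define u where "u = t *\<^sub>R hsum \<Delta> - \<mu>"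
  have "0 \<le> coef u \<beta>" if "\<beta> \<in> \<Delta>" for \<beta>
  proof -
    have "?q \<beta> \<le> t" unfolding t_def using that by (intro Max_ge) auto
    then show ?thesis using c[OF that] by (simp add: u_def pos_divide_le_eq)
  qed
  then obtain N0 w where N0: "nested_index N0" "\<forall>J\<in>N0. 0 \<le> w J"
      "u = (\<Sum>J\<in>N0. w J *\<^sub>R hsum J)" "\<Union>N0 \<subseteq> {\<beta>\<in>\<Delta>. coef u \<beta> \<noteq> 0}"
    using nested_decomposition[of u] by blast
  have fN: "finite N0" using nested_index_finite[OF N0(1)] .
  have "coef u \<beta>0 = 0" using c[OF b0(1)] b0(2) by (simp add: u_def)
  \<comment> \<open>Hence the union of any members of \<open>N0\<close> is a proper subset of
    \<Delta>, as \<open>facet_bounds\<close> requires.\<close>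
  then have b0N: "\<beta>0 \<notin> \<Union>N0" using N0(4) by blast
  have \<mu>_eq: "x \<bullet> \<mu> = t * (x \<bullet> hsum \<Delta>) - (\<Sum>J\<in>N0. w J * (x \<bullet> hsum J))" for x
  proof -
    have "\<mu> = t *\<^sub>R hsum \<Delta> - (\<Sum>J\<in>N0. w J *\<^sub>R hsum J)" using N0(3) by (simp add: u_def algebra_simps)
    then show ?thesis by (simp add: inner_diff_right inner_sum_right)
  qed
  \<comment> \<open>The deficit of z at J. The facet inequality for the union of an antichain says
    that the deficits of its members add up to at most the deficit
    \<open>a - z \<bullet> hsum \<Delta>\<close>.\<close>
  define y where "y J = \<epsilon> (card J) - z \<bullet> hsum J" for J
  have main: "(\<Sum>J\<in>N0. w J * y J) \<le> t * (a - z \<bullet> hsum \<Delta>)"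
  proof (rule antichain_chain_bound[OF fN])
    show "0 \<le> w J" if "J \<in> N0" for J using N0(2) that by simp
    show "sum y T \<le> a - z \<bullet> hsum \<Delta>" if T: "T \<subseteq> N0" "antichain T" for T
    proof (cases "T = {}")
      case True
      then show ?thesis using z by (simp add: facet_bounds_def)
    next
      case False
      have TD: "\<Union>T \<subset> \<Delta>" using T(1) N0(4) b0(1) b0N by blast
      obtain J where "J \<in> T" using False by auto
      moreover have "J \<noteq> {}" using \<open>J \<in> T\<close> T(1) nested_indexD[OF N0(1)] bld_nonempty by blast
      ultimately have "\<Union>T \<noteq> {}" by auto
      then have "z \<bullet> (hsum \<Delta> - hsum (\<Union>T)) \<le> a - eps_sum (\<Union>T)"
        using z TD by (simp add: facet_bounds_def)
      moreover have "hsum (\<Union>T) = (\<Sum>J\<in>T. hsum J)"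
        using hsum_comps[of "\<Union>T"] TD comps_antichain[OF N0(1) T] by simp
      moreover have "eps_sum (\<Union>T) = (\<Sum>J\<in>T. \<epsilon> (card J))"
        by (simp add: eps_sum_def comps_antichain[OF N0(1) T])
      ultimately show ?thesis
        by (simp add: y_def sum_subtractf inner_diff_right inner_sum_right)
    qed
    show "sum w C \<le> t" if C: "C \<subseteq> N0" "\<forall>A\<in>C. \<forall>B\<in>C. A \<subseteq> B \<or> B \<subseteq> A" for C
    proof -
      obtain \<alpha> where \<alpha>: "\<alpha> \<in> \<Delta>" "\<forall>J\<in>C. \<alpha> \<in> J" "\<forall>J\<in>N0. \<alpha> \<notin> J \<longrightarrow> hsum J \<bullet> \<alpha> = 0"
        using nested_chain_root[OF N0(1) C] by blast
      have sub: "J \<subseteq> \<Delta>" if "J \<in> N0" for J using that nested_indexD[OF N0(1)] bld_subset by blast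
      have "(\<Sum>J\<in>N0. w J * (\<alpha> \<bullet> hsum J)) = (\<Sum>J\<in>N0. if \<alpha> \<in> J then w J * ((\<alpha> \<bullet> \<alpha>) / 2) else 0)"
        using \<alpha>(3) hsum_inner_member[OF sub, of _ \<alpha>] by (intro sum.cong) (auto simp: inner_commute)
      also have "\<dots> = (\<Sum>J\<in>{J\<in>N0. \<alpha> \<in> J}. w J * ((\<alpha> \<bullet> \<alpha>) / 2))"
        by (rule sum.inter_filter[OF fN, symmetric])
      also have "\<dots> = (\<Sum>J\<in>{J\<in>N0. \<alpha> \<in> J}. w J) * ((\<alpha> \<bullet> \<alpha>) / 2)" by (simp only: sum_distrib_right)
      \<comment> \<open>Members avoiding \<alpha> contribute nothing and all others pair equally
        with \<alpha>, so the sign of \<open>\<alpha> \<bullet> \<mu>\<close> compares t with the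
        total weight of the members through \<alpha>.\<close>
      finally have "\<alpha> \<bullet> \<mu> = (t - (\<Sum>J\<in>{J\<in>N0. \<alpha> \<in> J}. w J)) * ((\<alpha> \<bullet> \<alpha>) / 2)"
        unfolding \<mu>_eq using hsum_inner_member[of \<Delta> \<alpha>] \<alpha>(1) by (simp add: inner_commute left_diff_distrib)
      moreover have "0 \<le> \<alpha> \<bullet> \<mu>" using \<mu> \<alpha>(1) by (simp add: dominant_def inner_commute)
      ultimately have "0 \<le> (t - (\<Sum>J\<in>{J\<in>N0. \<alpha> \<in> J}. w J)) * ((\<alpha> \<bullet> \<alpha>) / 2)" by metis
      moreover have "0 < (\<alpha> \<bullet> \<alpha>) / 2" using simple_norm_pos[OF \<alpha>(1)] by simp
      ultimately have "(\<Sum>J\<in>{J\<in>N0. \<alpha> \<in> J}. w J) \<le> t"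
        using zero_le_mult_iff by (smt (verit))
      moreover have "sum w C \<le> (\<Sum>J\<in>{J\<in>N0. \<alpha> \<in> J}. w J)"
        using C(1) \<alpha>(2) fN N0(2) by (intro sum_mono2) auto
      ultimately show ?thesis by linarith
    qed
  qed
  obtain N where N: "N0 \<subseteq> N" "maximal_nested_index N" using nested_index_extend[OF N0(1)] .
  have "z \<bullet> \<mu> \<le> p \<bullet> \<mu>" if p: "on_vertex N p" for p
  proof -
    have "p \<bullet> hsum \<Delta> = a" using p maximal_nested_top[OF N(2)] eps_top by (simp add: on_vertex_def)
    moreover have "(\<Sum>J\<in>N0. w J * (p \<bullet> hsum J)) = (\<Sum>J\<in>N0. w J * \<epsilon> (card J))"
      using p N(1) by (intro sum.cong) (auto simp: on_vertex_def)
    moreover have "(\<Sum>J\<in>N0. w J * y J) = (\<Sum>J\<in>N0. w J * \<epsilon> (card J)) - (\<Sum>J\<in>N0. w J * (z \<bullet> hsum J))"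
      by (simp add: y_def right_diff_distrib sum_subtractf)
    ultimately show ?thesis using main unfolding \<mu>_eq by (simp add: right_diff_distrib)
  qed
  then show thesis using that[OF N(2)] by blast
qed

section \<open>Convex hull, chambers and extreme points\<close>

definition vertices :: "'a set" where
  "vertices = {\<sigma> p | \<sigma> p N. \<sigma> \<in> weyl_group \<Phi> \<and> maximal_nested_index N \<and> on_vertex N p}"

lemma finite_vertices: "finite vertices"
proof -
  have "finite {N. maximal_nested_index N}"
    by (rule finite_subset[of _ "Pow bld"]) (use nested_indexD[OF maximal_nestedD] in auto)
  moreover have "vertices \<subseteq> (\<lambda>(\<sigma>, N). \<sigma> (THE p. on_vertex N p)) `
      (weyl_group \<Phi> \<times> {N. maximal_nested_index N})"
  proof
    fix v assume "v \<in> vertices"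
    then obtain \<sigma> p N where v: "v = \<sigma> p" "\<sigma> \<in> weyl_group \<Phi>" "maximal_nested_index N" "on_vertex N p"
      by (auto simp: vertices_def)
    have "(THE p. on_vertex N p) = p"
      using v(3,4) on_vertex_unique[OF v(3)] by (intro the_equality)
    then have "v = (\<lambda>(\<sigma>, N). \<sigma> (THE p. on_vertex N p)) (\<sigma>, N)" using v(1) by simp
    then show "v \<in> (\<lambda>(\<sigma>, N). \<sigma> (THE p. on_vertex N p)) ` (weyl_group \<Phi> \<times> {N. maximal_nested_index N})"
      using v(2,3) by blast
  qed
  ultimately show ?thesis using weyl_finite finite_subset by (metis finite_SigmaI finite_imageI)
qed

lemma vertices_subset: "vertices \<subseteq> (\<Union>\<sigma>\<in>weyl_group \<Phi>. \<sigma> ` fund_nestohedron \<Phi> \<Delta> \<G> \<epsilon> a)"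
  using on_vertex_in_nestohedron by (auto simp: vertices_def)

lemma orbit_subset:
  "(\<Union>\<sigma>\<in>weyl_group \<Phi>. \<sigma> ` fund_nestohedron \<Phi> \<Delta> \<G> \<epsilon> a) \<subseteq> permutonestohedron \<Phi> \<Delta> \<G> \<epsilon> a"
  using nestohedron_subset permutonestohedron_invariant by blast

text \<open>The group moves a functional separating x from the hull into the dominant cone, where
  \<open>dominant_bound\<close> produces a vertex on the wrong side of the hyperplane.\<close>

lemma permutonestohedron_subset_hull: "permutonestohedron \<Phi> \<Delta> \<G> \<epsilon> a \<subseteq> convex hull vertices"
proof
  fix x assume x: "x \<in> permutonestohedron \<Phi> \<Delta> \<G> \<epsilon> a"
  show "x \<in> convex hull vertices"
  proof (rule ccontr)
    assume "x \<notin> convex hull vertices"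
    moreover have "closed (convex hull vertices)"
      using finite_vertices by (simp add: compact_imp_closed finite_imp_compact_convex_hull)
    ultimately obtain \<nu> b where \<nu>: "\<nu> \<bullet> x < b" "\<forall>v\<in>convex hull vertices. b < \<nu> \<bullet> v"
      using separating_hyperplane_closed_point[OF convex_convex_hull] by metis
    \<comment> \<open>\<nu> is smaller at x than on the hull, so it is \<open>- \<nu>\<close> that
      has to be maximised and made dominant.\<close>
    obtain \<sigma> where \<sigma>: "\<sigma> \<in> weyl_group \<Phi>" "dominant (\<sigma> (- \<nu>))" using weyl_dominant_conjugate by blast
    obtain \<tau> where \<tau>: "\<tau> \<in> weyl_group \<Phi>" "\<And>x. \<tau> (\<sigma> x) = x" "\<And>x. \<sigma> (\<tau> x) = x"
      using weyl_inverse[OF \<sigma>(1)] by blast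
    have "facet_bounds (\<sigma> x)" using x \<sigma>(1) by (simp add: permutonestohedron_iff)
    then obtain N where N: "maximal_nested_index N"
      "\<And>p. on_vertex N p \<Longrightarrow> \<sigma> x \<bullet> \<sigma> (- \<nu>) \<le> p \<bullet> \<sigma> (- \<nu>)"
      using dominant_bound[OF _ \<sigma>(2)] by blast
    obtain p where p: "on_vertex N p" using on_vertex_exists[OF N(1)] by blast
    have "x \<bullet> (- \<nu>) \<le> \<tau> p \<bullet> (- \<nu>)"
      using N(2)[OF p] unfolding weyl_inner[OF \<sigma>(1)] weyl_inner_swap[OF \<tau>(1,3,2)] .
    moreover have "\<tau> p \<in> convex hull vertices"
      using \<tau>(1) N(1) p by (intro hull_inc) (auto simp: vertices_def)
    ultimately show False using \<nu> by (force simp: inner_commute)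
  qed
qed

lemma permutonestohedron_hull_vertices: "permutonestohedron \<Phi> \<Delta> \<G> \<epsilon> a = convex hull vertices"
  by (intro equalityI permutonestohedron_subset_hull hull_minimal convex_permutonestohedron
      subset_trans[OF vertices_subset orbit_subset])

lemma permutonestohedron_hull_orbit:
  "permutonestohedron \<Phi> \<Delta> \<G> \<epsilon> a =
    convex hull (\<Union>\<sigma>\<in>weyl_group \<Phi>. \<sigma> ` fund_nestohedron \<Phi> \<Delta> \<G> \<epsilon> a)"
proof
  show "permutonestohedron \<Phi> \<Delta> \<G> \<epsilon> a \<subseteq>
      convex hull (\<Union>\<sigma>\<in>weyl_group \<Phi>. \<sigma> ` fund_nestohedron \<Phi> \<Delta> \<G> \<epsilon> a)"
    unfolding permutonestohedron_hull_vertices by (rule hull_mono[OF vertices_subset])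
  show "convex hull (\<Union>\<sigma>\<in>weyl_group \<Phi>. \<sigma> ` fund_nestohedron \<Phi> \<Delta> \<G> \<epsilon> a) \<subseteq>
      permutonestohedron \<Phi> \<Delta> \<G> \<epsilon> a"
    by (intro hull_minimal orbit_subset convex_permutonestohedron)
qed

lemma polytope_nestohedron: "polytope (fund_nestohedron \<Phi> \<Delta> \<G> \<epsilon> a)"
proof -
  have "fund_nestohedron \<Phi> \<Delta> \<G> \<epsilon> a = {x. hsum \<Delta> \<bullet> x = a} \<inter>
      \<Inter>((\<lambda>I. {x. \<epsilon> (card I) \<le> hsum I \<bullet> x}) ` bld)"
    by (rule set_eqI) (simp add: nestohedron_iff inner_commute)
  moreover have "polyhedron \<dots>"
    using polyhedron_halfspace_ge by (intro polyhedron_Int polyhedron_hyperplane polyhedron_Inter) auto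
  \<comment> \<open>Boundedness is inherited from the convex hull of the finite set
    \<open>vertices\<close>.\<close>
  moreover have "bounded (fund_nestohedron \<Phi> \<Delta> \<G> \<epsilon> a)"
    using nestohedron_subset permutonestohedron_hull_vertices finite_vertices
    by (metis bounded_convex_hull bounded_subset finite_imp_bounded)
  ultimately show ?thesis by (simp add: polytope_eq_bounded_polyhedron)
qed

text \<open>Positive pairings with the simple roots keep the nestohedron and its images off all
  mirrors; each image is convex, hence connected, and stays in one component.\<close>

lemma orbit_in_chamber:
  assumes \<sigma>: "\<sigma> \<in> weyl_group \<Phi>"
  shows "\<exists>C\<in>open_chambers \<Phi>. \<sigma> ` fund_nestohedron \<Phi> \<Delta> \<G> \<epsilon> a \<subseteq> C"
proof -
  let ?P = "\<sigma> ` fund_nestohedron \<Phi> \<Delta> \<G> \<epsilon> a"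
  obtain \<tau> where \<tau>: "\<tau> \<in> weyl_group \<Phi>" "\<And>x. \<tau> (\<sigma> x) = x" "\<And>x. \<sigma> (\<tau> x) = x"
    using weyl_inverse[OF \<sigma>] by blast
  have "?P \<subseteq> UNIV - (\<Union>\<alpha>\<in>\<Phi>. {x. x \<bullet> \<alpha> = 0})"
    using regular_inner_nonzero[OF nestohedron_regular weyl_root[OF \<tau>(1)]]
      weyl_inner_swap[OF \<sigma> \<tau>(2,3)] by auto
  moreover have "connected ?P"
    using convex_linear_image[OF weyl_linear[OF \<sigma>]] polytope_imp_convex[OF polytope_nestohedron]
      convex_connected by blast
  moreover have "?P \<noteq> {}" using nestohedron_nonempty by simp
  ultimately show ?thesis
    unfolding open_chambers_def using exists_component_superset by (metis subset_empty)
qed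

text \<open>The inequalities indexed by N are equalities at p, hence at both ends of any segment
  with p in its interior. Since the node values determine a point, the ends coincide.\<close>

lemma vertex_extreme:
  assumes \<sigma>: "\<sigma> \<in> weyl_group \<Phi>" and N: "maximal_nested_index N" and p: "on_vertex N p"
  shows "\<sigma> p extreme_point_of permutonestohedron \<Phi> \<Delta> \<G> \<epsilon> a"
  unfolding extreme_point_of_def
proof (intro conjI ballI notI)
  show "\<sigma> p \<in> permutonestohedron \<Phi> \<Delta> \<G> \<epsilon> a"
    using \<sigma> N p vertices_subset orbit_subset by (auto simp: vertices_def)
  fix y z assume y: "y \<in> permutonestohedron \<Phi> \<Delta> \<G> \<epsilon> a"
    and z: "z \<in> permutonestohedron \<Phi> \<Delta> \<G> \<epsilon> a" and seg: "\<sigma> p \<in> open_segment y z"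
  obtain \<tau> where \<tau>: "\<tau> \<in> weyl_group \<Phi>" "\<And>x. \<tau> (\<sigma> x) = x" "\<And>x. \<sigma> (\<tau> x) = x"
    using weyl_inverse[OF \<sigma>] by blast
  obtain s where s: "y \<noteq> z" "0 < s" "s < 1" "\<sigma> p = (1 - s) *\<^sub>R y + s *\<^sub>R z"
    using seg by (auto simp: in_segment)
  have "p = \<tau> ((1 - s) *\<^sub>R y + s *\<^sub>R z)" using s(4) \<tau>(2) by metis
  then have p_eq: "p = (1 - s) *\<^sub>R \<tau> y + s *\<^sub>R \<tau> z"
    by (simp add: linear_add[OF weyl_linear[OF \<tau>(1)]] linear_scale[OF weyl_linear[OF \<tau>(1)]])
  have fb: "facet_bounds (\<tau> y)" "facet_bounds (\<tau> z)"
    using y z \<tau>(1) by (auto simp: permutonestohedron_iff)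
  \<comment> \<open>Two nonnegative gaps combined with positive weights vanish only if both
    vanish.\<close>
  have tight: "\<tau> y \<bullet> d = l \<and> \<tau> z \<bullet> d = l"
    if "\<tau> y \<bullet> d \<le> l" "\<tau> z \<bullet> d \<le> l" "p \<bullet> d = l" for d l
  proof -
    have "(1 - s) * (l - \<tau> y \<bullet> d) + s * (l - \<tau> z \<bullet> d) = 0"
      using that(3) by (simp add: p_eq inner_add_left algebra_simps)
    moreover have "0 \<le> (1 - s) * (l - \<tau> y \<bullet> d)" "0 \<le> s * (l - \<tau> z \<bullet> d)"
      using s that by auto
    ultimately show ?thesis using s by (simp add: add_nonneg_eq_0_iff)
  qed
  have top: "\<tau> y \<bullet> hsum \<Delta> = a \<and> \<tau> z \<bullet> hsum \<Delta> = a"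
    using fb p maximal_nested_top[OF N] eps_top
    by (intro tight) (auto simp: facet_bounds_def on_vertex_def)
  have "\<tau> y \<bullet> hsum I = \<epsilon> (card I) \<and> \<tau> z \<bullet> hsum I = \<epsilon> (card I)" if I: "I \<in> N" for I
  proof (cases "I = \<Delta>")
    case True
    then show ?thesis using top eps_top by simp
  next
    case False
    have Ib: "I \<in> bld" using I nested_indexD[OF maximal_nestedD[OF N]] by auto
    then have I': "I \<subset> \<Delta>" "I \<noteq> {}" using False bld_subset bld_nonempty by auto
    have "\<tau> y \<bullet> (hsum \<Delta> - hsum I) = a - eps_sum I \<and> \<tau> z \<bullet> (hsum \<Delta> - hsum I) = a - eps_sum I"
    proof (rule tight)
      have "p \<bullet> hsum I = \<epsilon> (card I)" "p \<bullet> hsum \<Delta> = a"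
        using p I maximal_nested_top[OF N] eps_top by (auto simp: on_vertex_def)
      then show "p \<bullet> (hsum \<Delta> - hsum I) = a - eps_sum I"
        by (simp add: eps_sum_bld[OF Ib] inner_diff_right)
    qed (use fb I' in \<open>auto simp: facet_bounds_def\<close>)
    then show ?thesis using top by (simp add: inner_diff_right eps_sum_bld[OF Ib])
  qed
  then have "\<tau> y = \<tau> z" by (intro node_values_unique[OF N]) simp
  then show False using s(1) \<tau>(3) by metis
qed

lemma extreme_points: "{x. x extreme_point_of permutonestohedron \<Phi> \<Delta> \<G> \<epsilon> a} = vertices"
proof
  show "{x. x extreme_point_of permutonestohedron \<Phi> \<Delta> \<G> \<epsilon> a} \<subseteq> vertices"
    unfolding permutonestohedron_hull_vertices using extreme_point_of_convex_hull by blast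
  show "vertices \<subseteq> {x. x extreme_point_of permutonestohedron \<Phi> \<Delta> \<G> \<epsilon> a}"
    using vertex_extreme by (auto simp: vertices_def)
qed

lemma nested_vertex_on_vertex:
  assumes N: "maximal_nested_index N"
  shows "on_vertex N (nested_vertex \<Phi> \<Delta> \<epsilon> a (span ` N))"
proof -
  note top = maximal_nested_top[OF N]
  have HD: "x \<in> H \<Phi> \<Delta> \<epsilon> a (span \<Delta>) \<longleftrightarrow> x \<bullet> hsum \<Delta> = \<epsilon> (card \<Delta>)" for x
    by (simp add: H_def delta_def level_def hsum_UNIV span_simple eps_top)
  have HI: "x \<in> H \<Phi> \<Delta> \<epsilon> a (span I) \<longleftrightarrow> x \<bullet> hsum I = \<epsilon> (card I)"
    if "I \<in> N" "x \<bullet> hsum \<Delta> = \<epsilon> (card \<Delta>)" for x I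
  proof (cases "I = \<Delta>")
    case False
    then show ?thesis
      using node_in_simple[OF N that(1)] that(2) eps_top
      by (auto simp: H_def delta_def level_def hsum_UNIV span_eq_UNIV_iff dim_simple
          inner_diff_right simp flip: hsum_def)
  qed (use HD that in simp)
  have "x \<in> (\<Inter>A\<in>span ` N. H \<Phi> \<Delta> \<epsilon> a A) \<longleftrightarrow> on_vertex N x" for x
    using HD HI top unfolding on_vertex_def by auto
  then have "nested_vertex \<Phi> \<Delta> \<epsilon> a (span ` N) = (THE x. on_vertex N x)"
    by (simp only: nested_vertex_def)
  moreover obtain p where p: "on_vertex N p" using on_vertex_exists[OF N] by blast
  have "on_vertex N (THE x. on_vertex N x)"
    by (rule theI[where P = "on_vertex N", OF p]) (rule on_vertex_unique[OF N _ p])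
  ultimately show ?thesis by simp
qed

lemma vertices_eq:
  "vertices = {\<sigma> (nested_vertex \<Phi> \<Delta> \<epsilon> a \<S>) | \<sigma> \<S>. \<sigma> \<in> weyl_group \<Phi> \<and> maximal_nested \<Delta> \<G> \<S>}"
proof (intro equalityI subsetI)
  fix v assume "v \<in> vertices"
  then obtain \<sigma> p N where v: "v = \<sigma> p" "\<sigma> \<in> weyl_group \<Phi>" "maximal_nested_index N" "on_vertex N p"
    by (auto simp: vertices_def)
  have "v = \<sigma> (nested_vertex \<Phi> \<Delta> \<epsilon> a (span ` N))"
    using on_vertex_unique[OF v(3,4) nested_vertex_on_vertex[OF v(3)]] v(1) by simp
  moreover have "maximal_nested \<Delta> \<G> (span ` N)" using v(3) maximal_nested_iff by blast
  ultimately show "v \<in> {\<sigma> (nested_vertex \<Phi> \<Delta> \<epsilon> a \<S>) | \<sigma> \<S>. \<sigma> \<in> weyl_group \<Phi> \<and> maximal_nested \<Delta> \<G> \<S>}"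
    using v(2) by blast
next
  fix v assume "v \<in> {\<sigma> (nested_vertex \<Phi> \<Delta> \<epsilon> a \<S>) | \<sigma> \<S>. \<sigma> \<in> weyl_group \<Phi> \<and> maximal_nested \<Delta> \<G> \<S>}"
  then obtain \<sigma> \<S> where v: "v = \<sigma> (nested_vertex \<Phi> \<Delta> \<epsilon> a \<S>)" "\<sigma> \<in> weyl_group \<Phi>" "maximal_nested \<Delta> \<G> \<S>"
    by blast
  then obtain N where "\<S> = span ` N" "maximal_nested_index N" using maximal_nested_iff by blast
  then show "v \<in> vertices" using v nested_vertex_on_vertex unfolding vertices_def by blast
qed

end

theorem theorem3p10:
  fixes \<Phi> \<Delta> :: "'a::euclidean_space set"
    and \<G> :: "'a set set"
    and \<epsilon> :: "nat \<Rightarrow> real"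
    and a :: real
  assumes "root_system \<Phi>"
    and "simple_system \<Phi> \<Delta>"
    and "building_set \<Phi> \<G>"
    and "weyl_invariant \<Phi> \<G>"
    and "UNIV \<in> \<G>"
    and "suitable_list \<Phi> \<Delta> \<G> \<epsilon> a"
  shows "permutonestohedron \<Phi> \<Delta> \<G> \<epsilon> a =
           convex hull (\<Union>\<sigma>\<in>weyl_group \<Phi>. \<sigma> ` fund_nestohedron \<Phi> \<Delta> \<G> \<epsilon> a) \<and>
         (\<forall>\<sigma>\<in>weyl_group \<Phi>. polytope (\<sigma> ` fund_nestohedron \<Phi> \<Delta> \<G> \<epsilon> a) \<and>
           (\<exists>C\<in>open_chambers \<Phi>. \<sigma> ` fund_nestohedron \<Phi> \<Delta> \<G> \<epsilon> a \<subseteq> C)) \<and>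
         {x. x extreme_point_of permutonestohedron \<Phi> \<Delta> \<G> \<epsilon> a} =
           {\<sigma> (nested_vertex \<Phi> \<Delta> \<epsilon> a \<S>) | \<sigma> \<S>. \<sigma> \<in> weyl_group \<Phi> \<and> maximal_nested \<Delta> \<G> \<S>}"
proof -
  interpret suitable_building_set \<Phi> \<Delta> \<G> \<epsilon> a
    using assms by unfold_locales
  show ?thesis
    using permutonestohedron_hull_orbit orbit_in_chamber extreme_points vertices_eq
      polytope_linear_image[OF weyl_linear polytope_nestohedron] by simp
qed

end
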